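(* Let $n=2^e\ge 4$ and let $G$ be an $n$-isobicyclic group. Then either (i) $G$ is metacyclic, and $G\cong G_1(e,f)$ for some $f\in\{2,\dots,e\}$; or (ii) $G$ is not metacyclic, in which case either $e=2$ and $G\cong G_2(2;0,0)$, or $e\ge 3$ and $G\cong G_2(e;k,l)$ for some $k,l\in\{0,1\}$. In the latter case, for each $e\ge 3$ there are, up to isomorphism, exactly three groups among the four groups $G_2(e;k,l)$ ($k,l\in\{0,1\}$), with $G_2(e;0,1)\cong G_2(e;1,1)$.
   Context: Conventions: $x^y=y^{-1}xy$ and $[x,y]=x^{-1}y^{-1}xy$. A group is metacyclic if it has a cyclic normal subgroup with cyclic quotient. A finite group $G$ is called $n$-isobicyclic if there are elements $a,b\in G$ of order $n$ such that $G=\langle a\rangle\langle b\rangle$, $\langle a\rangle\cap\langle b\rangle=1$, and there is an automorphism of $G$ transposing $a$ and $b$. For $2\le f\le e$ define $$G_1(e,f)=\langle h,g\mid h^{2^e}=g^{2^e}=1,\ h^g=h^{1+2^f}\rangle .$$ For $n=2^e\ge 4$ and $k,l\in\{0,1\}$ (with $k=l=0$ when $n=4$) define $$G_2(e;k,l)=\langle a,b\mid a^n=b^n=[b^2,a^2]=1,\ [b,a]=a^2b^{-2}(a^{n/2}b^{n/2})^k,\ (b^2)^a=b^{-2}(a^{n/2}b^{n/2})^l,\ (a^2)^b=a^{-2}(a^{n/2}b^{n/2})^l\rangle .$$ *)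

theory Defs
  imports "HOL-Algebra.Algebra"
begin

section \<open>Groups given by generators and relations\<close>

text \<open>
  A word is a list of signed generators: \<open>(x, True)\<close> stands for $x$ and \<open>(x, False)\<close>
  for $x^{-1}$.  Words are not required to be reduced.
\<close>

type_synonym 'x word = "('x \<times> bool) list"

definition gen :: "'x \<Rightarrow> 'x word" where
  "gen x = [(x, True)]"

definition winv :: "'x word \<Rightarrow> 'x word" where
  "winv w = rev (map (\<lambda>(x, s). (x, \<not> s)) w)"

definition wpow :: "'x word \<Rightarrow> nat \<Rightarrow> 'x word" where
  "wpow w m = concat (replicate m w)"

definition wconj :: "'x word \<Rightarrow> 'x word \<Rightarrow> 'x word" where
  "wconj x y = winv y @ x @ y"

definition wcomm :: "'x word \<Rightarrow> 'x word \<Rightarrow> 'x word" where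
  "wcomm x y = winv x @ winv y @ x @ y"

text \<open>
  A set \<open>R\<close> of pairs of words is read as a set of relations $u = v$; a relator $u = 1$ is the
  pair \<open>(u, [])\<close>.  The predicate below is the least congruence on the free monoid of words that
  cancels $x x^{-1}$ and $x^{-1} x$ and contains \<open>R\<close>, so its classes are the elements of the free
  group modulo the normal closure of the elements $u v^{-1}$.
\<close>

inductive pres_eq :: "('x word \<times> 'x word) set \<Rightarrow> 'x word \<Rightarrow> 'x word \<Rightarrow> bool"
  for R :: "('x word \<times> 'x word) set" where
  refl: "pres_eq R u u"
| sym: "pres_eq R u v \<Longrightarrow> pres_eq R v u"
| trans: "pres_eq R u v \<Longrightarrow> pres_eq R v w \<Longrightarrow> pres_eq R u w"
| append: "pres_eq R u u' \<Longrightarrow> pres_eq R v v' \<Longrightarrow> pres_eq R (u @ v) (u' @ v')"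
| cancel: "pres_eq R [(x, s), (x, \<not> s)] []"
| rel: "(u, v) \<in> R \<Longrightarrow> pres_eq R u v"

definition pres_class :: "('x word \<times> 'x word) set \<Rightarrow> 'x word \<Rightarrow> 'x word set" where
  "pres_class R u = {v. pres_eq R u v}"

definition presented_group :: "('x word \<times> 'x word) set \<Rightarrow> 'x word set monoid" where
  "presented_group R =
     \<lparr>carrier = range (pres_class R),
      monoid.mult = (\<lambda>C D. \<Union>u\<in>C. \<Union>v\<in>D. pres_class R (u @ v)),
      one = pres_class R []\<rparr>"

lemma pres_class_eq_iff: "pres_class R u = pres_class R v \<longleftrightarrow> pres_eq R u v"
proof
  assume "pres_class R u = pres_class R v"
  moreover have "v \<in> pres_class R v"
    by (simp add: pres_class_def pres_eq.refl)
  ultimately have "v \<in> pres_class R u"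
    by (rule ssubst)
  then show "pres_eq R u v"
    by (simp add: pres_class_def)
next
  assume uv: "pres_eq R u v"
  show "pres_class R u = pres_class R v"
    unfolding pres_class_def
    using pres_eq.trans[OF uv] pres_eq.trans[OF pres_eq.sym[OF uv]] by blast
qed

lemma presented_group_simps:
  "carrier (presented_group R) = range (pres_class R)"
  "\<one>\<^bsub>presented_group R\<^esub> = pres_class R []"
  by (simp_all add: presented_group_def)

lemma presented_group_mult:
  "pres_class R u \<otimes>\<^bsub>presented_group R\<^esub> pres_class R v = pres_class R (u @ v)"
proof -
  have eq: "pres_class R (u' @ v') = pres_class R (u @ v)"
    if "u' \<in> pres_class R u" "v' \<in> pres_class R v" for u' v'
  proof -
    have "pres_eq R u u'" "pres_eq R v v'"
      using that by (simp_all add: pres_class_def)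
    then show ?thesis
      unfolding pres_class_eq_iff by (rule pres_eq.sym[OF pres_eq.append])
  qed
  have mem: "u \<in> pres_class R u" "v \<in> pres_class R v"
    by (simp_all add: pres_class_def pres_eq.refl)
  have "(\<Union>u'\<in>pres_class R u. \<Union>v'\<in>pres_class R v. pres_class R (u' @ v')) =
      pres_class R (u @ v)"
    using eq mem by blast
  then show ?thesis
    by (simp add: presented_group_def)
qed

lemma pres_eq_winv_left: "pres_eq R (winv w @ w) []"
proof (induction w)
  case Nil
  show ?case by (simp add: winv_def pres_eq.refl)
next
  case (Cons p w)
  obtain x s where p: "p = (x, s)" by (cases p)
  have "pres_eq R [(x, \<not> s), (x, s)] []"
    using pres_eq.cancel[of R x "\<not> s"] by simp
  from pres_eq.append[OF this pres_eq.refl[of R w]]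
  have "pres_eq R ([(x, \<not> s), (x, s)] @ w) w" by simp
  from pres_eq.append[OF pres_eq.refl[of R "winv w"] this]
  have "pres_eq R (winv (p # w) @ p # w) (winv w @ w)" by (simp add: p winv_def)
  from pres_eq.trans[OF this Cons.IH] show ?case .
qed

lemma group_presented_group: "group (presented_group R)"
proof (rule groupI)
  fix C assume "C \<in> carrier (presented_group R)"
  then obtain w where w: "C = pres_class R w"
    unfolding presented_group_simps by blast
  have "pres_class R (winv w) \<otimes>\<^bsub>presented_group R\<^esub> C = \<one>\<^bsub>presented_group R\<^esub>"
    unfolding w presented_group_mult presented_group_simps pres_class_eq_iff
    by (rule pres_eq_winv_left)
  then show "\<exists>D \<in> carrier (presented_group R). D \<otimes>\<^bsub>presented_group R\<^esub> C = \<one>\<^bsub>presented_group R\<^esub>"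
    unfolding presented_group_simps(1) by blast
next
  fix C D assume "C \<in> carrier (presented_group R)" "D \<in> carrier (presented_group R)"
  then obtain u v where "C = pres_class R u" "D = pres_class R v"
    unfolding presented_group_simps by blast
  then show "C \<otimes>\<^bsub>presented_group R\<^esub> D \<in> carrier (presented_group R)"
    by (simp add: presented_group_mult presented_group_simps)
next
  fix C D E
  assume "C \<in> carrier (presented_group R)" "D \<in> carrier (presented_group R)"
    "E \<in> carrier (presented_group R)"
  then obtain u v w where "C = pres_class R u" "D = pres_class R v" "E = pres_class R w"
    unfolding presented_group_simps by blast
  then show "C \<otimes>\<^bsub>presented_group R\<^esub> D \<otimes>\<^bsub>presented_group R\<^esub> E =
      C \<otimes>\<^bsub>presented_group R\<^esub> (D \<otimes>\<^bsub>presented_group R\<^esub> E)"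
    by (simp add: presented_group_mult)
next
  fix C assume "C \<in> carrier (presented_group R)"
  then obtain w where "C = pres_class R w"
    unfolding presented_group_simps by blast
  then show "\<one>\<^bsub>presented_group R\<^esub> \<otimes>\<^bsub>presented_group R\<^esub> C = C"
    by (simp add: presented_group_simps presented_group_mult)
next
  show "\<one>\<^bsub>presented_group R\<^esub> \<in> carrier (presented_group R)"
    by (simp add: presented_group_simps)
qed


section \<open>Metacyclic and isobicyclic groups\<close>

definition metacyclic :: "('a, 'b) monoid_scheme \<Rightarrow> bool" where
  "metacyclic G \<longleftrightarrow>
     group G \<and>
     (\<exists>N. N \<lhd> G \<and> cyclic_group (G\<lparr>carrier := N\<rparr>) \<and> cyclic_group (G Mod N))"

definition isobicyclic :: "nat \<Rightarrow> ('a, 'b) monoid_scheme \<Rightarrow> bool" where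
  "isobicyclic n G \<longleftrightarrow>
     group G \<and> finite (carrier G) \<and>
     (\<exists>a \<in> carrier G. \<exists>b \<in> carrier G.
        group.ord G a = n \<and> group.ord G b = n \<and>
        carrier G = generate G {a} <#>\<^bsub>G\<^esub> generate G {b} \<and>
        generate G {a} \<inter> generate G {b} = {\<one>\<^bsub>G\<^esub>} \<and>
        (\<exists>\<phi> \<in> iso G G. \<phi> a = b \<and> \<phi> b = a))"


section \<open>The two families\<close>

datatype gen2 = GenX | GenY

text \<open>The intended parameters are $2 \le f \le e$.\<close>

definition G1 :: "nat \<Rightarrow> nat \<Rightarrow> gen2 word set monoid" where
  "G1 e f =
     (let h = gen GenX; g = gen GenY in
      presented_group
        {(wpow h (2 ^ e), []),
         (wpow g (2 ^ e), []),
         (wconj h g, wpow h (1 + 2 ^ f))})"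

text \<open>The intended parameters are $e \ge 2$ and $k, l \in \{0, 1\}$, with $k = l = 0$ if $e = 2$.\<close>

definition G2 :: "nat \<Rightarrow> nat \<Rightarrow> nat \<Rightarrow> gen2 word set monoid" where
  "G2 e k l =
     (let a = gen GenX; b = gen GenY; n = 2 ^ e;
          z = wpow a (n div 2) @ wpow b (n div 2) in
      presented_group
        {(wpow a n, []),
         (wpow b n, []),
         (wcomm (wpow b 2) (wpow a 2), []),
         (wcomm b a, wpow a 2 @ wpow (winv b) 2 @ wpow z k),
         (wconj (wpow b 2) a, wpow (winv b) 2 @ wpow z l),
         (wconj (wpow a 2) b, wpow (winv a) 2 @ wpow z l)})"


section \<open>Counting groups up to isomorphism\<close>

definition num_iso_classes :: "('a, 'b) monoid_scheme set \<Rightarrow> nat" where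
  "num_iso_classes S = card (S // {(G, H). G \<in> S \<and> H \<in> S \<and> G \<cong> H})"

end

theory Submission
  imports Defs "HOL-Number_Theory.Cong"
begin

text \<open>
  Let $n = 2^e$ and let $\sigma$ be the automorphism transposing $a$ and $b$.  If $a^{n/2}$ did not
  commute with $b$, then $\langle a\rangle \cap \langle a\rangle^b = 1$, so counting would give
  $G = \langle a\rangle\langle a\rangle^b$, which is impossible for a conjugate of a proper
  subgroup.  Hence $z_1 = a^{n/2}$ and $z_2 = b^{n/2}$ are central, and
  $G / \langle z_1, z_2\rangle$ is $n/2$-isobicyclic.

  The relations are found by induction along these quotients: a relation lifts with an error in
  $\{1, z_1, z_2, z_1 z_2\}$, and applying $\sigma$ forces the error into
  $\{1, z_1 z_2\}$.  At $n = 4$ two cases arise.  Either $h = a^{-1} b$ satisfies $h^a = h^r$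
  with $r \equiv 1 \pmod 4$, which yields the groups $G_1(e, f)$, or, with $z = z_1 z_2$,
  \[(ab)^2 = z^m, \quad (b^2)^a = b^{-2} z^l, \quad (a^2)^b = a^{-2} z^l, \quad [a^2, b^2] = 1,\]
  which is the presentation of $G_2(e; k, l)$ for $m = k + l$.

  If $l = 0$, then $ab$ inverts every square, and an element inverting every square has square
  $z^m$; if $l = 1$, no element inverts $a^2$.  For $l = 1$ replacing $a$ by $a^3$ changes the
  parity of $m$.
\<close>

text \<open>An error is forced into \<open>{1, z1 z2}\<close> because a lifted relation and its
  image under \<sigma> express the same element, so the error is fixed by \<sigma>, and \<sigma>
  exchanges \<open>z1\<close> and \<open>z2\<close>. With h^a = h^r the error disappears again:
  h^(n/2) = z1 z2, so \<open>r\<close> can be changed by n/2. In the other case it stays as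
  \<open>m\<close> or \<open>l\<close>. The obstacle there is that a nonzero parameter of the
  quotient lifts not to a central element but to a factor a^(n/4) b^(n/4), whose square is z1 z2.
  This is contradictory, so the quotient always has m = l = 0 and parameters never accumulate.
  Nonmetacyclicity is computed only at n = 4, where z1 z2 is a commutator but not a square; it
  passes upwards because a consequence of being metacyclic passes to images. A group is matched with
  its presentation by collection: every element of the presented group is a product of two powers,
  and such a product is trivial in the concrete group only if both exponents are multiples of n. The
  count of the four groups rests on z \<noteq> 1 and a^4 \<noteq> 1 in the presented groups, which
  an explicit action on cosets detects.\<close>

context group
begin

section \<open>Conjugation and products of two powers\<close>

definition conj_by :: "'a \<Rightarrow> 'a \<Rightarrow> 'a" where
  "conj_by g x = inv g \<otimes> x \<otimes> g"

lemma conj_by_closed [simp]: "g \<in> carrier G \<Longrightarrow> x \<in> carrier G \<Longrightarrow> conj_by g x \<in> carrier G"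
  by (simp add: conj_by_def)

lemma inv_mult_cancel [simp]:
  "x \<in> carrier G \<Longrightarrow> y \<in> carrier G \<Longrightarrow> inv x \<otimes> (x \<otimes> y) = y"
  "x \<in> carrier G \<Longrightarrow> y \<in> carrier G \<Longrightarrow> x \<otimes> (inv x \<otimes> y) = y"
  by (simp_all flip: m_assoc)

lemma conj_by_mult: "g \<in> carrier G \<Longrightarrow> x \<in> carrier G \<Longrightarrow> y \<in> carrier G \<Longrightarrow>
    conj_by g (x \<otimes> y) = conj_by g x \<otimes> conj_by g y"
  by (simp add: conj_by_def m_assoc)

lemma conj_by_one [simp]: "g \<in> carrier G \<Longrightarrow> conj_by g \<one> = \<one>"
  by (simp add: conj_by_def)

lemma conj_by_inv: "g \<in> carrier G \<Longrightarrow> x \<in> carrier G \<Longrightarrow> conj_by g (inv x) = inv (conj_by g x)"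
  by (simp add: conj_by_def inv_mult_group m_assoc)

lemma conj_by_pow: "g \<in> carrier G \<Longrightarrow> x \<in> carrier G \<Longrightarrow> conj_by g (x [^] (k::nat)) = conj_by g x [^] k"
  by (induction k) (simp_all add: conj_by_mult)

lemma conj_by_conj_by: "g \<in> carrier G \<Longrightarrow> h \<in> carrier G \<Longrightarrow> x \<in> carrier G \<Longrightarrow>
    conj_by h (conj_by g x) = conj_by (g \<otimes> h) x"
  by (simp add: conj_by_def inv_mult_group m_assoc)

lemma conj_by_eq_iff: "g \<in> carrier G \<Longrightarrow> x \<in> carrier G \<Longrightarrow> y \<in> carrier G \<Longrightarrow>
    conj_by g x = y \<longleftrightarrow> x \<otimes> g = g \<otimes> y"
  by (metis conj_by_def inv_closed inv_solve_left' m_assoc m_closed)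

lemma conj_by_inj: "g \<in> carrier G \<Longrightarrow> x \<in> carrier G \<Longrightarrow> y \<in> carrier G \<Longrightarrow>
    conj_by g x = conj_by g y \<longleftrightarrow> x = y"
  by (simp add: conj_by_def)

lemma pow_mod: "x \<in> carrier G \<Longrightarrow> x [^] (n::nat) = \<one> \<Longrightarrow> x [^] (k mod n) = x [^] (k::nat)"
  by (metis div_mod_decomp l_one mult.commute nat_pow_closed nat_pow_mult nat_pow_one nat_pow_pow)

lemma pow_cong: "x \<in> carrier G \<Longrightarrow> x [^] (n::nat) = \<one> \<Longrightarrow> [i = j] (mod n) \<Longrightarrow> x [^] i = x [^] (j::nat)"
  by (metis pow_mod cong_def)

lemma inv_pow_eq: 
  assumes "x \<in> carrier G" "x [^] (n::nat) = \<one>" "n > 0"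
  shows "inv x = x [^] (n - 1)"
  using assms by (metis Suc_diff_1 inv_equality nat_pow_Suc nat_pow_closed)

lemma prod_pow_eq_iff:
  assumes a: "a \<in> carrier G" and c: "c \<in> carrier G" and n: "n > 0"
    and an: "a [^] (n::nat) = \<one>" and cn: "c [^] n = \<one>"
    and ind: "\<And>(i::nat) (j::nat). a [^] i \<otimes> c [^] j = \<one> \<Longrightarrow> n dvd i \<and> n dvd j"
  shows "a [^] (i::nat) \<otimes> c [^] (j::nat) = a [^] (i'::nat) \<otimes> c [^] (j'::nat) \<longleftrightarrow>
    [i = i'] (mod n) \<and> [j = j'] (mod n)"
proof
  assume eq: "a [^] i \<otimes> c [^] j = a [^] i' \<otimes> c [^] j'"
  \<comment> \<open>Exponents are natural numbers, so \<open>(n - 1) * i'\<close> stands in for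
    \<open>- i'\<close>. It is used to cancel \<open>a [^] i'\<close> on the left and, likewise,
    \<open>c [^] j'\<close> on the right.\<close>
  have n1: "(n - 1) * k + k = n * k" "k + (n - 1) * k = n * k" for k
    using n by (simp_all add: mult_eq_if)
  have 1: "a [^] ((n - 1) * i') \<otimes> a [^] i' = \<one>"
    unfolding nat_pow_mult[OF a] n1 unfolding nat_pow_pow[OF a, symmetric] an by simp
  have 2: "c [^] j' \<otimes> c [^] ((n - 1) * j') = \<one>"
    unfolding nat_pow_mult[OF c] n1 unfolding nat_pow_pow[OF c, symmetric] cn by simp
  have "a [^] ((n - 1) * i' + i) \<otimes> c [^] (j + (n - 1) * j') =
      a [^] ((n - 1) * i') \<otimes> (a [^] i \<otimes> c [^] j) \<otimes> c [^] ((n - 1) * j')"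
    using a c by (simp add: m_assoc flip: nat_pow_mult)
  also have "\<dots> = (a [^] ((n - 1) * i') \<otimes> a [^] i') \<otimes> (c [^] j' \<otimes> c [^] ((n - 1) * j'))"
    unfolding eq using a c by (simp add: m_assoc)
  also have "\<dots> = \<one>" unfolding 1 2 by simp
  finally have "n dvd (n - 1) * i' + i" "n dvd j + (n - 1) * j'"
    using ind by blast+
  then have "[(n - 1) * i' + i = (n - 1) * i' + i'] (mod n)"
    "[(n - 1) * j' + j = (n - 1) * j' + j'] (mod n)"
    unfolding n1 by (simp_all add: cong_def mod_eq_0_iff_dvd add.commute)
  then show "[i = i'] (mod n) \<and> [j = j'] (mod n)"
    by (simp add: cong_add_lcancel_nat)
next
  assume "[i = i'] (mod n) \<and> [j = j'] (mod n)"
  then show "a [^] i \<otimes> c [^] j = a [^] i' \<otimes> c [^] j'"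
    using pow_cong[OF a an] pow_cong[OF c cn] by metis
qed

lemma inj_on_prod_pow:
  assumes "a \<in> carrier G" "c \<in> carrier G" "n > 0"
    and "a [^] (n::nat) = \<one>" "c [^] n = \<one>"
    and "\<And>(i::nat) (j::nat). a [^] i \<otimes> c [^] j = \<one> \<Longrightarrow> n dvd i \<and> n dvd j"
  shows "inj_on (\<lambda>(i, j). a [^] i \<otimes> c [^] j) ({..<n} \<times> {..<n})"
  using prod_pow_eq_iff[OF assms] by (auto simp: inj_on_def cong_def)

end

lemma (in group) inv_commute:
  assumes "x \<in> carrier G" "y \<in> carrier G" "y \<otimes> x = x \<otimes> y"
  shows "inv x \<otimes> y = y \<otimes> inv x"
proof -
  have "inv x \<otimes> y = inv x \<otimes> (y \<otimes> x) \<otimes> inv x" using assms(1,2) by (simp add: m_assoc)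
  also have "\<dots> = y \<otimes> inv x" unfolding assms(3) using assms(1,2) by simp
  finally show ?thesis .
qed

text \<open>For \<open>s = 2 ^ v * u\<close> with \<open>u\<close> odd and \<open>v < e\<close>, the
  multiplier \<open>2 ^ (e - 1 - v)\<close> works. Thus each nontrivial element of a cyclic group of
  order \<open>2 ^ e\<close> has a power that is the involution of that group.\<close>

lemma mult_cong_half:
  assumes "\<not> 2 ^ e dvd (s::nat)" "e \<ge> 1"
  shows "\<exists>k. [k * s = 2 ^ (e - 1)] (mod 2 ^ e)"
proof -
  have "s \<noteq> 0" using assms by (metis dvd_0_right)
  then obtain v u where s: "s = 2 ^ v * u" "odd u"
    by (metis dvd_def mult.commute multiplicity_decompose' not_is_unit_0 zero_less_iff_neq_zero
        odd_one prime_nat_iff two_is_prime_nat)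
  have "v < e" using assms s by (metis dvd_triv_left le_imp_power_dvd linorder_not_less dvd_trans)
  then have "2 ^ (e - 1 - v) * s = 2 ^ (e - 1) * u"
    by (simp add: s flip: power_add mult.assoc)
  moreover obtain w where "u = 2 * w + 1" using s by (metis oddE)
  moreover have "(2::nat) ^ (e - 1) * (2 * w + 1) = 2 ^ (e - 1) + 2 ^ e * w"
    using assms by (cases e) (auto simp: algebra_simps)
  ultimately show ?thesis by (metis cong_add_rcancel_0_nat cong_mult_self_left add.commute cong_add_lcancel_0_nat)
qed

text \<open>
  The assumption \<open>indep\<close> says at once that $a$ and $b$ have order $2^e$ and that
  $\langle a\rangle \cap \langle b\rangle = 1$.
\<close>

locale isobicyclic_triple = group G for G :: "('a, 'm) monoid_scheme" (structure) +
  fixes a b :: 'a and \<sigma> :: "'a \<Rightarrow> 'a" and e :: nat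
  assumes a_in [simp]: "a \<in> carrier G" and b_in [simp]: "b \<in> carrier G"
    and factor: "x \<in> carrier G \<Longrightarrow> \<exists>(i::nat) (j::nat). x = a [^] i \<otimes> b [^] j"
    and indep: "a [^] (i::nat) \<otimes> b [^] (j::nat) = \<one> \<longleftrightarrow> 2 ^ e dvd i \<and> 2 ^ e dvd j"
    and sig_hom: "\<sigma> \<in> hom G G" and sig_a: "\<sigma> a = b" and sig_b: "\<sigma> b = a"
begin

lemma a_pow: "a [^] (2 ^ e :: nat) = \<one>" and b_pow: "b [^] (2 ^ e :: nat) = \<one>"
  using indep[of "2 ^ e" 0] indep[of 0 "2 ^ e"] by simp_all

lemma a_pow_eq_one: "a [^] (i::nat) = \<one> \<longleftrightarrow> 2 ^ e dvd i"
  using indep[of i 0] by simp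

lemma b_pow_eq_one: "b [^] (i::nat) = \<one> \<longleftrightarrow> 2 ^ e dvd i"
  using indep[of 0 i] by simp

lemma ab_eq_iff: "a [^] (i::nat) \<otimes> b [^] (j::nat) = a [^] (i'::nat) \<otimes> b [^] (j'::nat) \<longleftrightarrow>
    [i = i'] (mod 2 ^ e) \<and> [j = j'] (mod 2 ^ e)"
  by (rule prod_pow_eq_iff) (use a_pow b_pow indep in auto)

lemma carrier_eq: "carrier G = (\<lambda>(i, j). a [^] i \<otimes> b [^] j) ` ({..<2 ^ e :: nat} \<times> {..<2 ^ e :: nat})"
proof
  show "carrier G \<subseteq> (\<lambda>(i, j). a [^] i \<otimes> b [^] j) ` ({..<2 ^ e :: nat} \<times> {..<2 ^ e :: nat})"
  proof
    fix x assume "x \<in> carrier G"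
    then obtain i j :: nat where "x = a [^] i \<otimes> b [^] j" using factor by blast
    then have "x = a [^] (i mod 2 ^ e) \<otimes> b [^] (j mod 2 ^ e)"
      by (simp add: pow_mod a_pow b_pow)
    then show "x \<in> (\<lambda>(i, j). a [^] i \<otimes> b [^] j) ` ({..<2 ^ e :: nat} \<times> {..<2 ^ e :: nat})"
      by (intro image_eqI[where x = "(i mod 2 ^ e, j mod 2 ^ e)"]) simp_all
  qed
qed auto

lemma card_carrier: "card (carrier G) = 2 ^ e * 2 ^ e"
  unfolding carrier_eq
  by (subst card_image, rule inj_on_prod_pow) (use a_pow b_pow indep in auto)

lemma finite_carrier: "finite (carrier G)"
  unfolding carrier_eq by blast

text \<open>Counting: by \<open>ind\<close> the \<open>2 ^ e * 2 ^ e\<close> products with reduced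
  exponents are distinct, and this is already the order of the group.\<close>

lemma pow_generates:
  assumes c: "c \<in> carrier G" and cn: "c [^] (2 ^ e :: nat) = \<one>"
    and ind: "\<And>(i::nat) (j::nat). a [^] i \<otimes> c [^] j = \<one> \<Longrightarrow> 2 ^ e dvd i \<and> 2 ^ e dvd j"
    and x: "x \<in> carrier G"
  shows "\<exists>(i::nat) (j::nat). x = a [^] i \<otimes> c [^] j"
proof -
  let ?f = "\<lambda>(i, j). a [^] i \<otimes> c [^] j" and ?D = "{..<2 ^ e :: nat} \<times> {..<2 ^ e :: nat}"
  have "inj_on ?f ?D"
    by (rule inj_on_prod_pow) (use a_pow cn ind c in auto)
  then have "card (?f ` ?D) = card (carrier G)"
    by (simp add: card_carrier card_image)
  moreover have "?f ` ?D \<subseteq> carrier G" using c by auto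
  ultimately have "?f ` ?D = carrier G"
    using finite_carrier by (metis card_subset_eq)
  with x show ?thesis by (metis (no_types, lifting) imageE case_prod_beta)
qed

lemma half_pow_eq:
  assumes e: "e \<ge> 1" 
  shows "a [^] (2 ^ (e - 1) :: nat) \<otimes> a [^] (2 ^ (e - 1) :: nat) = \<one>"
    "b [^] (2 ^ (e - 1) :: nat) \<otimes> b [^] (2 ^ (e - 1) :: nat) = \<one>"
  using e a_pow b_pow by (cases e; simp add: nat_pow_mult mult_2)+

lemma half_pow_commute_b:
  assumes e: "e \<ge> 1"
  shows "conj_by b (a [^] (2 ^ (e - 1) :: nat)) = a [^] (2 ^ (e - 1) :: nat)" (is "conj_by b ?z = ?z")
proof (rule ccontr)
  assume nz: "conj_by b ?z \<noteq> ?z"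
  define c where "c = conj_by b a"
  have c: "c \<in> carrier G" by (simp add: c_def)
  have cpow: "c [^] k = conj_by b (a [^] k)" for k :: nat by (simp add: c_def conj_by_pow)
  have cn: "c [^] (2 ^ e :: nat) = \<one>" by (simp add: cpow a_pow)
  have c1: "c [^] k = \<one> \<longleftrightarrow> 2 ^ e dvd k" for k :: nat
    by (metis cpow a_pow_eq_one conj_by_inj conj_by_one a_in b_in nat_pow_closed one_closed)
  \<comment> \<open>A relation with \<open>a [^] s\<close> nontrivial would put the involution of
    \<open>\<langle>a\<rangle>\<close> into \<open>\<langle>c\<rangle>\<close>, whose only
    involution is \<open>conj_by b ?z\<close>. The two would agree, against
    \<open>nz\<close>.\<close>
  have ind: "2 ^ e dvd s \<and> 2 ^ e dvd t" if eq: "a [^] s \<otimes> c [^] t = \<one>" for s t :: nat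
  proof (cases "2 ^ e dvd s")
    case True
    then have "c [^] t = \<one>" using eq c by (simp flip: a_pow_eq_one)
    with True show ?thesis by (simp add: c1)
  next
    case False
    then obtain k where k: "[k * s = 2 ^ (e - 1)] (mod 2 ^ e)" using mult_cong_half e by blast
    have "c [^] t = inv (a [^] s)" using eq c by (metis a_in inv_equality inv_inv nat_pow_closed inv_closed)
    then have "c [^] (t * k) = inv (a [^] s) [^] k" using c by (simp flip: nat_pow_pow)
    also have "\<dots> = inv (a [^] (k * s))" by (simp add: nat_pow_inv nat_pow_pow mult.commute)
    also have "a [^] (k * s) = ?z" by (rule pow_cong[OF a_in a_pow k])
    also have "inv ?z = ?z" using half_pow_eq(1)[OF e] by (metis inv_equality a_in nat_pow_closed)
    finally have ctk: "c [^] (t * k) = ?z" .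
    have "c [^] (2 * (t * k)) = \<one>"
      using half_pow_eq(1)[OF e] c by (simp add: mult_2 ctk flip: nat_pow_mult)
    then have "2 ^ e dvd 2 * (t * k)" by (simp only: c1)
    then have "2 ^ (e - 1) dvd t * k" using e by (cases e) auto
    then obtain q where q: "t * k = 2 ^ (e - 1) * q" by blast
    have "\<not> 2 ^ e dvd (2 ^ (e - 1) :: nat)"
      using e by (auto dest!: dvd_imp_le)
    then have "?z \<noteq> \<one>" by (simp only: a_pow_eq_one not_False_eq_True)
    then have ntk: "\<not> 2 ^ e dvd t * k" using ctk c1 by metis
    obtain d where d: "e = Suc d" using e by (cases e) auto
    \<comment> \<open>An odd multiple of \<open>2 ^ (e - 1)\<close> is congruent to
      \<open>2 ^ (e - 1)\<close> modulo \<open>2 ^ e\<close>, so \<open>c [^] (t * k)\<close> is the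
      involution of \<open>\<langle>c\<rangle>\<close>.\<close>
    have "odd q" using q ntk by (auto elim!: evenE simp: d)
    then obtain p where "t * k = 2 ^ (e - 1) + 2 ^ e * p"
      using q by (auto elim!: oddE simp: d algebra_simps)
    then have "[t * k = 2 ^ (e - 1)] (mod 2 ^ e)" by (simp add: cong_def)
    then have "c [^] (t * k) = conj_by b ?z" using cn c cpow pow_cong by metis
    then show ?thesis using ctk nz by simp
  qed
  \<comment> \<open>The conjugating element itself is expanded: in
    \<open>b = a [^] i \<otimes> inv b \<otimes> a [^] j \<otimes> b\<close> the last
    \<open>b\<close> cancels, and \<open>b\<close> becomes a power of \<open>a\<close>.\<close>
  obtain i j :: nat where "b = a [^] i \<otimes> c [^] j"
    using pow_generates[OF c cn ind b_in] by blast
  then have "b = a [^] i \<otimes> (inv b \<otimes> (a [^] j \<otimes> b))" by (simp add: cpow conj_by_def m_assoc)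
  then have "\<one> \<otimes> b = (a [^] i \<otimes> inv b \<otimes> a [^] j) \<otimes> b" by (simp add: m_assoc)
  then have "\<one> = a [^] i \<otimes> inv b \<otimes> a [^] j" by (subst (asm) r_cancel) auto
  then have "inv (a [^] i) \<otimes> inv (a [^] j) = inv b"
    by (metis a_in b_in inv_closed inv_solve_left' inv_solve_right m_closed nat_pow_closed one_closed r_one l_one)
  then have "b = a [^] (j + i)"
    by (metis a_in b_in inv_inv inv_mult_group nat_pow_closed nat_pow_mult)
  then have "a [^] (0::nat) \<otimes> b [^] (1::nat) = a [^] (j + i) \<otimes> b [^] (0::nat)" by simp
  then have "[1 = 0] (mod (2::nat) ^ e)" by (simp only: ab_eq_iff)
  then show False using e by (simp add: cong_def)
qed

end

section \<open>Central involutions and the quotient by them\<close>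

definition (in group) central :: "'a \<Rightarrow> bool" where
  "central w \<longleftrightarrow> w \<in> carrier G \<and> (\<forall>x \<in> carrier G. w \<otimes> x = x \<otimes> w)"

context group
begin

lemma central_closed: "central w \<Longrightarrow> w \<in> carrier G"
  by (simp add: central_def)

lemma central_commute: "central w \<Longrightarrow> x \<in> carrier G \<Longrightarrow> w \<otimes> x = x \<otimes> w"
  by (simp add: central_def)

lemma central_commute2: "central w \<Longrightarrow> x \<in> carrier G \<Longrightarrow> y \<in> carrier G \<Longrightarrow>
    w \<otimes> (x \<otimes> y) = x \<otimes> (w \<otimes> y)"
  by (metis central_closed central_commute m_assoc)

lemma central_one [simp]: "central \<one>"
  by (simp add: central_def)

lemma central_mult: "central v \<Longrightarrow> central w \<Longrightarrow> central (v \<otimes> w)"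
  unfolding central_def
proof (intro conjI ballI)
  fix x
  assume *: "v \<in> carrier G \<and> (\<forall>x\<in>carrier G. v \<otimes> x = x \<otimes> v)"
    "w \<in> carrier G \<and> (\<forall>x\<in>carrier G. w \<otimes> x = x \<otimes> w)" and x: "x \<in> carrier G"
  have "v \<otimes> w \<otimes> x = v \<otimes> (x \<otimes> w)" using * x by (metis m_assoc)
  also have "\<dots> = x \<otimes> v \<otimes> w" using * x by (metis m_assoc)
  finally show "v \<otimes> w \<otimes> x = x \<otimes> (v \<otimes> w)" using * x by (metis m_assoc)
next
  assume "v \<in> carrier G \<and> (\<forall>x\<in>carrier G. v \<otimes> x = x \<otimes> v)"
    "w \<in> carrier G \<and> (\<forall>x\<in>carrier G. w \<otimes> x = x \<otimes> w)"
  then show "v \<otimes> w \<in> carrier G" by blast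
qed

lemma central_pow: "central w \<Longrightarrow> central (w [^] (k::nat))"
  by (induction k) (simp_all add: central_mult)

lemma conj_by_central: "central w \<Longrightarrow> g \<in> carrier G \<Longrightarrow> conj_by g w = w"
  by (simp add: central_closed central_commute conj_by_eq_iff)

end

context isobicyclic_triple
begin

lemma sig_closed [simp]: "x \<in> carrier G \<Longrightarrow> \<sigma> x \<in> carrier G"
  using sig_hom by (auto simp: hom_def)

lemma sig_mult: "x \<in> carrier G \<Longrightarrow> y \<in> carrier G \<Longrightarrow> \<sigma> (x \<otimes> y) = \<sigma> x \<otimes> \<sigma> y"
  using sig_hom by (auto simp: hom_def)

lemma sig_group_hom: "group_hom G G \<sigma>"
  by unfold_locales (rule sig_hom)

lemma sig_one [simp]: "\<sigma> \<one> = \<one>"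
  by (rule group_hom.hom_one[OF sig_group_hom])

lemma sig_pow: "x \<in> carrier G \<Longrightarrow> \<sigma> (x [^] (k::nat)) = \<sigma> x [^] k"
  by (rule group_hom.hom_nat_pow[OF sig_group_hom])

lemma sig_inv: "x \<in> carrier G \<Longrightarrow> \<sigma> (inv x) = inv (\<sigma> x)"
  by (rule group_hom.hom_inv[OF sig_group_hom])

lemma sig_conj_by: "g \<in> carrier G \<Longrightarrow> x \<in> carrier G \<Longrightarrow> \<sigma> (conj_by g x) = conj_by (\<sigma> g) (\<sigma> x)"
  by (simp add: conj_by_def sig_mult sig_inv)

lemma sig_sig: "x \<in> carrier G \<Longrightarrow> \<sigma> (\<sigma> x) = x"
  using factor[of x] by (auto simp: sig_mult sig_pow sig_a sig_b)

lemma centralI: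
  assumes w: "w \<in> carrier G" and "w \<otimes> a = a \<otimes> w" "w \<otimes> b = b \<otimes> w"
  shows "central w"
  unfolding central_def
proof (intro conjI ballI w)
  fix x assume "x \<in> carrier G"
  then obtain i j :: nat where x: "x = a [^] i \<otimes> b [^] j" using factor by blast
  have 1: "w \<otimes> a [^] i = a [^] i \<otimes> w" "w \<otimes> b [^] j = b [^] j \<otimes> w"
    using assms group_commutes_pow[of a w i] group_commutes_pow[of b w j] by auto
  have "w \<otimes> x = (w \<otimes> a [^] i) \<otimes> b [^] j" using w by (simp add: x m_assoc)
  also have "\<dots> = a [^] i \<otimes> (w \<otimes> b [^] j)" using w by (simp add: 1 m_assoc)
  also have "\<dots> = x \<otimes> w" using w by (simp only: 1) (simp add: x m_assoc)
  finally show "w \<otimes> x = x \<otimes> w" .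
qed

definition "z1 = a [^] (2 ^ (e - 1) :: nat)"
definition "z2 = b [^] (2 ^ (e - 1) :: nat)"
definition "klein = {\<one>, z1, z2, z1 \<otimes> z2}"

lemma z_in [simp]: "z1 \<in> carrier G" "z2 \<in> carrier G"
  by (simp_all add: z1_def z2_def)

lemma sig_z [simp]: "\<sigma> z1 = z2" "\<sigma> z2 = z1"
  by (simp_all add: z1_def z2_def sig_pow sig_a sig_b)

context
  assumes e: "e \<ge> 1"
begin

lemma z_sq: "z1 \<otimes> z1 = \<one>" "z2 \<otimes> z2 = \<one>"
  using half_pow_eq[OF e] by (simp_all add: z1_def z2_def)

lemma z_sq2 [simp]: "x \<in> carrier G \<Longrightarrow> z1 \<otimes> (z1 \<otimes> x) = x" "x \<in> carrier G \<Longrightarrow> z2 \<otimes> (z2 \<otimes> x) = x"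
  using z_sq by (simp_all flip: m_assoc)

lemma z1_central: "central z1"
proof (rule centralI)
  show "z1 \<otimes> a = a \<otimes> z1"
    unfolding z1_def by (metis a_in nat_pow_Suc nat_pow_Suc2)
  show "z1 \<otimes> b = b \<otimes> z1"
    using half_pow_commute_b[OF e, folded z1_def] by (simp add: conj_by_eq_iff)
qed simp

lemma z2_central: "central z2"
  unfolding central_def
proof (intro conjI ballI)
  fix x assume x: "x \<in> carrier G"
  then have "\<sigma> (z1 \<otimes> \<sigma> x) = \<sigma> (\<sigma> x \<otimes> z1)" by (simp add: central_commute z1_central)
  then show "z2 \<otimes> x = x \<otimes> z2" using x by (simp add: sig_mult sig_sig)
qed simp

lemma klein_central: "w \<in> klein \<Longrightarrow> central w"
  by (auto simp: klein_def z1_central z2_central central_mult)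

lemma klein_closed: "w \<in> klein \<Longrightarrow> w \<in> carrier G"
  by (simp add: klein_central central_closed)

lemma klein_sq: "w \<in> klein \<Longrightarrow> w \<otimes> w = \<one>"
  unfolding klein_def by (auto simp: z_sq m_assoc central_commute2[OF z2_central])

lemma klein_inv: "w \<in> klein \<Longrightarrow> inv w = w"
  using klein_sq klein_closed inv_equality by blast

lemma klein_mult: "v \<in> klein \<Longrightarrow> w \<in> klein \<Longrightarrow> v \<otimes> w \<in> klein"
  unfolding klein_def
  by (auto simp: z_sq m_assoc central_commute2[OF z2_central] central_commute[OF z2_central])

lemma klein_one [simp]: "\<one> \<in> klein"
  by (simp add: klein_def)

lemma klein_sig: "w \<in> klein \<Longrightarrow> \<sigma> w \<in> klein"
  unfolding klein_def by (auto simp: sig_mult central_commute[OF z2_central])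

lemma z_distinct: "z1 \<noteq> \<one>" "z2 \<noteq> \<one>" "z1 \<otimes> z2 \<noteq> \<one>" "z1 \<noteq> z2"
proof -
  have d: "\<not> 2 ^ e dvd (2 ^ (e - 1) :: nat)" using e by (auto dest!: dvd_imp_le)
  show "z1 \<noteq> \<one>" "z2 \<noteq> \<one>" using d by (simp_all add: z1_def z2_def a_pow_eq_one b_pow_eq_one)
  show *: "z1 \<otimes> z2 \<noteq> \<one>" using d by (simp add: z1_def z2_def indep)
  show "z1 \<noteq> z2" using * z_sq by auto
qed

text \<open>\<open>\<sigma>\<close> exchanges \<open>z1\<close> and \<open>z2\<close>, which are
  different. The errors met in lifting the relations are reduced to a single bit by this.\<close>

lemma klein_sig_fixed: "w \<in> klein \<Longrightarrow> \<sigma> w = w \<Longrightarrow> w = \<one> \<or> w = z1 \<otimes> z2"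
  using z_distinct unfolding klein_def by auto

lemma klein_pow_even: "w \<in> klein \<Longrightarrow> even k \<Longrightarrow> w [^] (k::nat) = \<one>"
proof -
  assume w: "w \<in> klein" and "even k"
  then obtain c where k: "k = 2 * c" by blast
  have "w [^] (2::nat) = \<one>" using w by (simp add: numeral_2_eq_2 klein_closed klein_sq)
  then show ?thesis unfolding k using klein_closed[OF w] by (simp flip: nat_pow_pow)
qed

lemma klein_pow: "w \<in> klein \<Longrightarrow> w [^] (k::nat) \<in> klein"
  by (induction k) (simp_all add: klein_mult)

text \<open>The elements of \<open>klein\<close> are the products
  \<open>z1 [^] s \<otimes> z2 [^] t\<close>, and exponents are unique modulo \<open>2 ^ e\<close>.
  This turns triviality in the quotient into divisibility by \<open>2 ^ (e - 1)\<close>.\<close>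

lemma klein_dvd: "a [^] (i::nat) \<otimes> b [^] (j::nat) \<in> klein \<longleftrightarrow> 2 ^ (e - 1) dvd i \<and> 2 ^ (e - 1) dvd j"
proof
  have z: "z1 [^] (s::nat) \<otimes> z2 [^] (t::nat) = a [^] (2 ^ (e - 1) * s) \<otimes> b [^] (2 ^ (e - 1) * t)" for s t
    by (simp add: z1_def z2_def nat_pow_pow)
  assume "a [^] i \<otimes> b [^] j \<in> klein"
  then consider "a [^] i \<otimes> b [^] j = z1 [^] (0::nat) \<otimes> z2 [^] (0::nat)"
    | "a [^] i \<otimes> b [^] j = z1 [^] Suc 0 \<otimes> z2 [^] (0::nat)"
    | "a [^] i \<otimes> b [^] j = z1 [^] (0::nat) \<otimes> z2 [^] Suc 0"
    | "a [^] i \<otimes> b [^] j = z1 [^] Suc 0 \<otimes> z2 [^] Suc 0"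
    unfolding klein_def by auto
  then have "\<exists>(s::nat) (t::nat). a [^] i \<otimes> b [^] j = z1 [^] s \<otimes> z2 [^] t"
    by cases blast+
  then obtain s t :: nat where "a [^] i \<otimes> b [^] j = a [^] (2 ^ (e - 1) * s) \<otimes> b [^] (2 ^ (e - 1) * t)"
    unfolding z by blast
  then have "[i = 2 ^ (e - 1) * s] (mod 2 ^ e)" "[j = 2 ^ (e - 1) * t] (mod 2 ^ e)"
    unfolding ab_eq_iff by auto
  then have "[i = 2 ^ (e - 1) * s] (mod 2 ^ (e - 1))" "[j = 2 ^ (e - 1) * t] (mod 2 ^ (e - 1))"
    by (meson cong_dvd_modulus_nat diff_le_self le_imp_power_dvd)+
  then show "2 ^ (e - 1) dvd i \<and> 2 ^ (e - 1) dvd j"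
    by (simp add: cong_dvd_iff)
next
  assume "2 ^ (e - 1) dvd i \<and> 2 ^ (e - 1) dvd j"
  then obtain s t where "i = 2 ^ (e - 1) * s" "j = 2 ^ (e - 1) * t" by blast
  then have "a [^] i \<otimes> b [^] j = z1 [^] s \<otimes> z2 [^] t"
    by (simp add: z1_def z2_def nat_pow_pow)
  moreover have "z1 \<in> klein" "z2 \<in> klein" by (simp_all add: klein_def)
  ultimately show "a [^] i \<otimes> b [^] j \<in> klein"
    by (simp add: klein_mult klein_pow)
qed

text \<open>
  Cosets are represented by chosen elements, so that the quotient lives on the type of $G$ and the
  induction on $e$ stays within one type.
\<close>

definition klein_rep :: "'a \<Rightarrow> 'a" where
  "klein_rep x = (SOME y. \<exists>w\<in>klein. y = x \<otimes> w)"

definition klein_quot :: "('a, 'm) monoid_scheme" where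
  "klein_quot = G\<lparr>carrier := klein_rep ` carrier G, monoid.mult := \<lambda>x y. klein_rep (x \<otimes> y), one := klein_rep \<one>\<rparr>"

lemma klein_rep_ex: "\<exists>w\<in>klein. klein_rep x = x \<otimes> w"
  unfolding klein_rep_def by (rule someI_ex) (use klein_one in blast)

lemma klein_rep_mult_klein: 
  assumes x: "x \<in> carrier G" and w: "w \<in> klein"
  shows "klein_rep (x \<otimes> w) = klein_rep x"
proof -
  have "(\<exists>v\<in>klein. y = x \<otimes> w \<otimes> v) \<longleftrightarrow> (\<exists>v\<in>klein. y = x \<otimes> v)" for y
  proof
    assume "\<exists>v\<in>klein. y = x \<otimes> w \<otimes> v"
    then obtain v where "v \<in> klein" "y = x \<otimes> w \<otimes> v" by blast
    then show "\<exists>v\<in>klein. y = x \<otimes> v"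
      using x w klein_mult klein_closed m_assoc by metis
  next
    assume "\<exists>v\<in>klein. y = x \<otimes> v"
    then obtain v where v: "v \<in> klein" "y = x \<otimes> v" by blast
    have "x \<otimes> w \<otimes> (w \<otimes> v) = x \<otimes> ((w \<otimes> w) \<otimes> v)"
      using x w v klein_closed by (simp add: m_assoc)
    then have "y = x \<otimes> w \<otimes> (w \<otimes> v)" using v w klein_sq klein_closed by simp
    then show "\<exists>v\<in>klein. y = x \<otimes> w \<otimes> v" using klein_mult v w by blast
  qed
  then show ?thesis by (simp add: klein_rep_def)
qed

lemma klein_rep_closed [simp]: "x \<in> carrier G \<Longrightarrow> klein_rep x \<in> carrier G"
  using klein_rep_ex[of x] klein_closed by auto

lemma klein_rep_eq_iff:
  assumes x: "x \<in> carrier G" and y: "y \<in> carrier G"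
  shows "klein_rep x = klein_rep y \<longleftrightarrow> (\<exists>w\<in>klein. y = x \<otimes> w)"
proof
  assume eq: "klein_rep x = klein_rep y"
  obtain v w where vw: "v \<in> klein" "w \<in> klein" "klein_rep x = x \<otimes> v" "klein_rep y = y \<otimes> w"
    using klein_rep_ex by meson
  have "y = y \<otimes> (w \<otimes> w)" using vw y by (simp add: klein_sq)
  also have "\<dots> = x \<otimes> v \<otimes> w" using vw eq x y klein_closed by (simp flip: m_assoc)
  also have "\<dots> = x \<otimes> (v \<otimes> w)" using vw x klein_closed by (simp add: m_assoc)
  finally show "\<exists>w\<in>klein. y = x \<otimes> w" using vw klein_mult by blast
qed (use x klein_rep_mult_klein in auto)

lemma klein_rep_mult:
  assumes x: "x \<in> carrier G" and y: "y \<in> carrier G"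
  shows "klein_rep (klein_rep x \<otimes> klein_rep y) = klein_rep (x \<otimes> y)"
proof -
  obtain v w where vw: "v \<in> klein" "w \<in> klein" "klein_rep x = x \<otimes> v" "klein_rep y = y \<otimes> w"
    using klein_rep_ex by meson
  have "klein_rep x \<otimes> klein_rep y = x \<otimes> (v \<otimes> y) \<otimes> w"
    using vw x y klein_closed by (simp add: m_assoc)
  also have "v \<otimes> y = y \<otimes> v" using klein_central vw y central_commute by blast
  also have "x \<otimes> (y \<otimes> v) \<otimes> w = (x \<otimes> y) \<otimes> (v \<otimes> w)"
    using vw x y klein_closed by (simp add: m_assoc)
  finally show ?thesis using vw x y by (simp add: klein_rep_mult_klein klein_mult)
qed

lemma klein_quot_simps [simp]: "carrier klein_quot = klein_rep ` carrier G" 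
  "x \<otimes>\<^bsub>klein_quot\<^esub> y = klein_rep (x \<otimes> y)" "\<one>\<^bsub>klein_quot\<^esub> = klein_rep \<one>"
  by (simp_all add: klein_quot_def)

lemma klein_rep_hom: "klein_rep \<in> hom G klein_quot"
  by (auto simp: hom_def klein_rep_mult)

lemma group_klein_quot: "group klein_quot"
proof -
  \<comment> \<open>\<open>hom_imp_img_group\<close> speaks of the target with carrier and unit
    replaced by the images; here the replacement changes nothing.\<close>
  have "klein_quot\<lparr>carrier := klein_rep ` carrier G, one := klein_rep \<one>\<rparr> = klein_quot"
    by (rule monoid.equality) (simp_all add: klein_quot_def)
  then show ?thesis using hom_imp_img_group[OF klein_rep_hom] by metis
qed

lemma klein_rep_group_hom: "group_hom G klein_quot klein_rep"
  using group_klein_quot klein_rep_hom by (simp add: group_hom_def group_hom_axioms_def is_group)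

lemma klein_rep_pow: "x \<in> carrier G \<Longrightarrow> klein_rep x [^]\<^bsub>klein_quot\<^esub> (k::nat) = klein_rep (x [^] k)"
  by (simp add: group_hom.hom_nat_pow[OF klein_rep_group_hom])

lemma klein_rep_inv: "x \<in> carrier G \<Longrightarrow> inv\<^bsub>klein_quot\<^esub> (klein_rep x) = klein_rep (inv x)"
  by (simp add: group_hom.hom_inv[OF klein_rep_group_hom])

lemma klein_rep_hom_mult: "x \<in> carrier G \<Longrightarrow> y \<in> carrier G \<Longrightarrow> klein_rep x \<otimes>\<^bsub>klein_quot\<^esub> klein_rep y = klein_rep (x \<otimes> y)"
  by (simp add: klein_rep_mult)

lemma klein_rep_sig:
  assumes x: "x \<in> carrier G" shows "klein_rep (\<sigma> (klein_rep x)) = klein_rep (\<sigma> x)"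
proof -
  obtain v where v: "v \<in> klein" "klein_rep x = x \<otimes> v" using klein_rep_ex by meson
  then have "\<sigma> (klein_rep x) = \<sigma> x \<otimes> \<sigma> v" using x by (simp add: sig_mult klein_closed)
  then show ?thesis using x v by (simp add: klein_rep_mult_klein klein_sig)
qed

text \<open>\<open>\<sigma>\<close> preserves \<open>klein\<close>, so
  \<open>klein_rep \<circ> \<sigma>\<close> is a homomorphism on the representatives;
  \<open>klein_dvd\<close> supplies the independence condition with exponent
  \<open>e - 1\<close>.\<close>

lemma klein_quot_triple: "isobicyclic_triple klein_quot (klein_rep a) (klein_rep b) (klein_rep \<circ> \<sigma>) (e - 1)"
proof (rule isobicyclic_triple.intro[OF group_klein_quot], unfold_locales)
  show "klein_rep a \<in> carrier klein_quot" "klein_rep b \<in> carrier klein_quot" by simp_all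
next
  fix x assume "x \<in> carrier klein_quot"
  then obtain y where y: "y \<in> carrier G" "x = klein_rep y" by auto
  then obtain i j :: nat where ij: "y = a [^] i \<otimes> b [^] j" using factor by blast
  have "x = klein_rep a [^]\<^bsub>klein_quot\<^esub> i \<otimes>\<^bsub>klein_quot\<^esub> klein_rep b [^]\<^bsub>klein_quot\<^esub> j"
    unfolding y ij klein_rep_pow[OF a_in] klein_rep_pow[OF b_in] by (rule klein_rep_hom_mult[symmetric]) auto
  then show "\<exists>(i::nat) (j::nat). x = klein_rep a [^]\<^bsub>klein_quot\<^esub> i \<otimes>\<^bsub>klein_quot\<^esub> klein_rep b [^]\<^bsub>klein_quot\<^esub> j"
    by blast
next
  fix i j :: nat
  have "klein_rep a [^]\<^bsub>klein_quot\<^esub> i \<otimes>\<^bsub>klein_quot\<^esub> klein_rep b [^]\<^bsub>klein_quot\<^esub> j = klein_rep (a [^] i \<otimes> b [^] j)"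
    unfolding klein_rep_pow[OF a_in] klein_rep_pow[OF b_in] by (rule klein_rep_hom_mult) auto
  moreover have "klein_rep (a [^] i \<otimes> b [^] j) = klein_rep \<one> \<longleftrightarrow> a [^] i \<otimes> b [^] j \<in> klein"
    using klein_rep_eq_iff[of \<one> "a [^] i \<otimes> b [^] j"] klein_closed by auto
  ultimately show "klein_rep a [^]\<^bsub>klein_quot\<^esub> i \<otimes>\<^bsub>klein_quot\<^esub> klein_rep b [^]\<^bsub>klein_quot\<^esub> j = \<one>\<^bsub>klein_quot\<^esub> \<longleftrightarrow>
      2 ^ (e - 1) dvd i \<and> 2 ^ (e - 1) dvd j"
    unfolding klein_dvd[symmetric] by simp
next
  show "klein_rep \<circ> \<sigma> \<in> hom klein_quot klein_quot"
    by (auto simp: hom_def klein_rep_sig sig_mult klein_rep_mult)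
next
  show "(klein_rep \<circ> \<sigma>) (klein_rep a) = klein_rep b" "(klein_rep \<circ> \<sigma>) (klein_rep b) = klein_rep a"
    by (simp_all add: klein_rep_sig sig_a sig_b)
qed

end

end

section \<open>Lifting the metacyclic relations\<close>

text \<open>
  A consequence of being metacyclic that passes to homomorphic images without forming quotients.
\<close>

definition (in group) split_cyclic :: bool where
  "split_cyclic \<longleftrightarrow> (\<exists>x\<in>carrier G. \<exists>y\<in>carrier G.
     (\<forall>g\<in>carrier G. \<exists>i::int. conj_by g x = x [^] i) \<and>
     (\<forall>g\<in>carrier G. \<exists>(i::int) (j::int). g = x [^] i \<otimes> y [^] j))"

lemma (in group_hom) hom_conj_by:
  "g \<in> carrier G \<Longrightarrow> x \<in> carrier G \<Longrightarrow> h (G.conj_by g x) = H.conj_by (h g) (h x)"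
  by (simp add: G.conj_by_def H.conj_by_def)

lemma (in group_hom) split_cyclic_image:
  assumes "G.split_cyclic" and surj: "h ` carrier G = carrier H"
  shows "H.split_cyclic"
proof -
  obtain x y where xy: "x \<in> carrier G" "y \<in> carrier G"
    and 1: "\<And>g. g \<in> carrier G \<Longrightarrow> \<exists>i::int. G.conj_by g x = x [^]\<^bsub>G\<^esub> i"
    and 2: "\<And>g. g \<in> carrier G \<Longrightarrow> \<exists>(i::int) (j::int). g = x [^]\<^bsub>G\<^esub> i \<otimes>\<^bsub>G\<^esub> y [^]\<^bsub>G\<^esub> j"
    using assms(1) unfolding G.split_cyclic_def by blast
  have "\<exists>i::int. H.conj_by g' (h x) = h x [^]\<^bsub>H\<^esub> i" if g': "g' \<in> carrier H" for g'
  proof -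
    obtain g where g: "g \<in> carrier G" "g' = h g" using surj g' by blast
    obtain i :: int where "G.conj_by g x = x [^]\<^bsub>G\<^esub> i" using 1 g by blast
    then have "H.conj_by g' (h x) = h (x [^]\<^bsub>G\<^esub> i)" using g xy hom_conj_by by metis
    then show ?thesis using xy hom_int_pow by metis
  qed
  moreover have "\<exists>(i::int) (j::int). g' = h x [^]\<^bsub>H\<^esub> i \<otimes>\<^bsub>H\<^esub> h y [^]\<^bsub>H\<^esub> j"
    if g': "g' \<in> carrier H" for g'
  proof -
    obtain g where g: "g \<in> carrier G" "g' = h g" using surj g' by blast
    obtain i j :: int where "g = x [^]\<^bsub>G\<^esub> i \<otimes>\<^bsub>G\<^esub> y [^]\<^bsub>G\<^esub> j" using 2 g by blast
    then have "g' = h (x [^]\<^bsub>G\<^esub> i) \<otimes>\<^bsub>H\<^esub> h (y [^]\<^bsub>G\<^esub> j)" using g xy by simp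
    then show ?thesis using xy hom_int_pow by metis
  qed
  ultimately show ?thesis unfolding H.split_cyclic_def using xy
    by (intro bexI[where x = "h x"] bexI[where x = "h y"] conjI ballI) auto
qed

context isobicyclic_triple
begin

definition "ab_quot = inv a \<otimes> b"

text \<open>The condition \<open>r mod 4 = 1\<close> is what lets some odd power of \<open>r\<close>
  have the form \<open>1 + 2 ^ f\<close> with \<open>f \<ge> 2\<close> modulo \<open>2 ^ e\<close>.
  The last equation makes the possible error \<open>z1 \<otimes> z2\<close> a power of
  \<open>ab_quot\<close>, so that it can be absorbed into \<open>r\<close>.\<close>

definition "metacyclic_case \<longleftrightarrow> (\<exists>r::nat. r mod 4 = 1 \<and> conj_by a ab_quot = ab_quot [^] r \<and> ab_quot [^] (2 ^ (e - 1) :: nat) = z1 \<otimes> z2)"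

text \<open>The parameter \<open>m\<close> is \<open>k + l\<close> modulo 2. The relation for
  \<open>conj_by b (a \<otimes> a)\<close> is left out because it follows by
  \<open>\<sigma>\<close>. The clause \<open>\<not> split_cyclic\<close> travels with the relations:
  it passes from the quotient to the group.\<close>

definition "nonmetacyclic_case \<longleftrightarrow> (\<exists>(m::nat) (l::nat). m < 2 \<and> l < 2 \<and> (e = 2 \<longrightarrow> m = 0 \<and> l = 0) \<and>
   (a \<otimes> b) \<otimes> (a \<otimes> b) = (z1 \<otimes> z2) [^] m \<and>
   conj_by a (b \<otimes> b) = inv (b \<otimes> b) \<otimes> (z1 \<otimes> z2) [^] l \<and>
   (b \<otimes> b) \<otimes> (a \<otimes> a) = (a \<otimes> a) \<otimes> (b \<otimes> b)) \<and> \<not> split_cyclic"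

lemma ab_quot_in [simp]: "ab_quot \<in> carrier G"
  by (simp add: ab_quot_def)

lemma a_ab_quot: "a \<otimes> ab_quot = b"
  by (simp add: ab_quot_def)

lemma sig_ab_quot: "\<sigma> ab_quot = inv ab_quot"
  by (simp add: ab_quot_def sig_mult sig_inv sig_a sig_b inv_mult_group)

lemma commuting_metacyclic_case:
  assumes e: "e \<ge> 1" and ab: "a \<otimes> b = b \<otimes> a"
  shows "metacyclic_case"
proof -
  have 1: "inv a \<otimes> b = b \<otimes> inv a" using ab by (metis a_in b_in inv_solve_left inv_solve_right m_assoc inv_closed m_closed)
  have "conj_by a ab_quot = ab_quot" by (simp add: conj_by_eq_iff a_ab_quot) (simp add: ab_quot_def 1 m_assoc)
  moreover have "ab_quot [^] (2 ^ (e - 1) :: nat) = inv a [^] (2 ^ (e - 1) :: nat) \<otimes> z2"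
    unfolding ab_quot_def z2_def by (rule pow_mult_distrib) (use 1 in auto)
  moreover have "inv a [^] (2 ^ (e - 1) :: nat) = z1"
    unfolding z1_def using nat_pow_inv[OF a_in] z_sq(1)[OF e] by (metis inv_equality z1_def z_in(1))
  ultimately show ?thesis unfolding metacyclic_case_def by (intro exI[of _ 1]) simp
qed

lemma klein_rep_conj_by: "e \<ge> 1 \<Longrightarrow> x \<in> carrier G \<Longrightarrow> y \<in> carrier G \<Longrightarrow>
    group.conj_by klein_quot (klein_rep x) (klein_rep y) = klein_rep (conj_by x y)"
  using group_hom.hom_conj_by[OF klein_rep_group_hom] by simp

lemma klein_rep_eqD: "e \<ge> 1 \<Longrightarrow> x \<in> carrier G \<Longrightarrow> y \<in> carrier G \<Longrightarrow> klein_rep x = klein_rep y \<Longrightarrow> \<exists>w\<in>klein. x = y \<otimes> w"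
  using klein_rep_eq_iff by metis

lemma base_commute:
  assumes e: "e = 1" shows "a \<otimes> b = b \<otimes> a"
proof -
  have "z1 = a" unfolding z1_def unfolding e by simp
  moreover have "central z1" by (rule z1_central) (simp add: e)
  then have "z1 \<otimes> b = b \<otimes> z1" by (rule central_commute) simp
  ultimately show ?thesis by (simp only:)
qed

text \<open>For \<open>e \<ge> 2\<close> the images in \<open>klein_quot\<close> of these elements
  are its own \<open>z1\<close>, \<open>z2\<close> and \<open>z1 \<otimes> z2\<close>. A power of
  the latter in a relation of the quotient therefore lifts to a power of
  \<open>quarter_ab\<close>.\<close>

definition "quarter_a = a [^] (2 ^ (e - 2) :: nat)"
definition "quarter_b = b [^] (2 ^ (e - 2) :: nat)"
definition "quarter_ab = quarter_a \<otimes> quarter_b"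

lemma quarter_in [simp]: "quarter_a \<in> carrier G" "quarter_b \<in> carrier G" "quarter_ab \<in> carrier G"
  by (simp_all add: quarter_a_def quarter_b_def quarter_ab_def)

lemma sig_quarter [simp]: "\<sigma> quarter_a = quarter_b" "\<sigma> quarter_b = quarter_a"
  by (simp_all add: quarter_a_def quarter_b_def sig_pow sig_a sig_b)

text \<open>The image of \<open>quarter_a\<close> is the central involution \<open>z1\<close> of the
  quotient.\<close>

lemma conj_by_b_quarter_a:
  assumes e: "e \<ge> 2" shows "\<exists>t\<in>klein. conj_by b quarter_a = quarter_a \<otimes> t"
proof -
  have e1: "e \<ge> 1" using e by simp
  interpret Q: isobicyclic_triple klein_quot "klein_rep a" "klein_rep b" "klein_rep \<circ> \<sigma>" "e - 1" by (rule klein_quot_triple[OF e1])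
  have "Q.z1 = klein_rep quarter_a"
    unfolding Q.z1_def quarter_a_def using klein_rep_pow[OF e1 a_in] e by (simp add: numeral_2_eq_2)
  then have "Q.central (klein_rep quarter_a)" using Q.z1_central e by simp
  then have "Q.conj_by (klein_rep b) (klein_rep quarter_a) = klein_rep quarter_a" using Q.conj_by_central Q.b_in by blast
  then have "klein_rep (conj_by b quarter_a) = klein_rep quarter_a" using klein_rep_conj_by[OF e1] by simp
  then show ?thesis using klein_rep_eqD[OF e1] by simp
qed

context
  assumes e3: "e \<ge> 3"
begin

lemma e_ge_1: "e \<ge> 1" using e3 by simp

text \<open>Conjugating twice by \<open>b\<close> introduces the same central error twice, and its
  square is 1.\<close>

lemma quarter_a_commute_q: "conj_by (b \<otimes> b) quarter_a = quarter_a"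
proof -
  obtain t where t: "t \<in> klein" "conj_by b quarter_a = quarter_a \<otimes> t" using conj_by_b_quarter_a e3 by auto
  have tc: "t \<in> carrier G" "conj_by b t = t" "t \<otimes> t = \<one>"
    using t klein_closed klein_central klein_sq conj_by_central e_ge_1 by auto
  have "conj_by (b \<otimes> b) quarter_a = conj_by b (conj_by b quarter_a)" by (simp add: conj_by_conj_by)
  also have "\<dots> = quarter_a \<otimes> t \<otimes> t" using t tc by (simp add: conj_by_mult)
  also have "\<dots> = quarter_a" using tc by (simp add: m_assoc)
  finally show ?thesis .
qed

lemma pow_half: "quarter_a = (a \<otimes> a) [^] (2 ^ (e - 3) :: nat)" "quarter_b = (b \<otimes> b) [^] (2 ^ (e - 3) :: nat)"
proof -
  have "e - 2 = Suc (e - 3)" using e3 by simp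
  then have *: "(2::nat) ^ (e - 2) = 2 * 2 ^ (e - 3)" by simp
  have sq: "x \<otimes> x = x [^] (2::nat)" if "x \<in> carrier G" for x using that by (simp add: numeral_2_eq_2)
  show "quarter_a = (a \<otimes> a) [^] (2 ^ (e - 3) :: nat)" "quarter_b = (b \<otimes> b) [^] (2 ^ (e - 3) :: nat)"
    unfolding quarter_a_def quarter_b_def * by (simp_all add: sq nat_pow_pow)
qed

lemma quarter_commute: "quarter_a \<otimes> quarter_b = quarter_b \<otimes> quarter_a"
  unfolding pow_half(2) using quarter_a_commute_q by (simp add: conj_by_eq_iff group_commutes_pow)

lemma quarter_sq: "quarter_a \<otimes> quarter_a = z1" "quarter_b \<otimes> quarter_b = z2"
proof -
  have "e - 1 = Suc (e - 2)" using e3 by simp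
  then have *: "(2::nat) ^ (e - 1) = 2 ^ (e - 2) + 2 ^ (e - 2)" by simp
  show "quarter_a \<otimes> quarter_a = z1" "quarter_b \<otimes> quarter_b = z2"
    unfolding quarter_a_def quarter_b_def z1_def z2_def * by (simp_all add: nat_pow_mult)
qed

lemma quarter_ab_sq: "quarter_ab \<otimes> quarter_ab = z1 \<otimes> z2"
proof -
  have "quarter_ab \<otimes> quarter_ab = quarter_a \<otimes> (quarter_b \<otimes> quarter_a) \<otimes> quarter_b" by (simp add: quarter_ab_def m_assoc)
  also have "\<dots> = (quarter_a \<otimes> quarter_a) \<otimes> (quarter_b \<otimes> quarter_b)" by (simp add: m_assoc flip: quarter_commute)
  finally show ?thesis by (simp add: quarter_sq)
qed

lemma klein_quot_quarter_ab:
  assumes "isobicyclic_triple klein_quot (klein_rep a) (klein_rep b) (klein_rep \<circ> \<sigma>) (e - 1)" 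
  shows "isobicyclic_triple.z1 klein_quot (klein_rep a) (e - 1) \<otimes>\<^bsub>klein_quot\<^esub> isobicyclic_triple.z2 klein_quot (klein_rep b) (e - 1) = klein_rep quarter_ab"
proof -
  interpret Q: isobicyclic_triple klein_quot "klein_rep a" "klein_rep b" "klein_rep \<circ> \<sigma>" "e - 1" by fact
  have d: "e - 1 - 1 = e - 2" by simp
  show ?thesis
    unfolding Q.z1_def Q.z2_def d klein_rep_pow[OF e_ge_1 a_in] klein_rep_pow[OF e_ge_1 b_in]
      quarter_a_def[symmetric] quarter_b_def[symmetric] quarter_ab_def
    by (rule klein_rep_hom_mult[OF e_ge_1]) simp_all
qed

text \<open>The power relation lifts only up to an element of \<open>klein\<close>, but squaring
  kills this error, and \<open>quarter_ab\<close> squares to \<open>z1 \<otimes> z2\<close>. The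
  error in the conjugation relation is trivial or is itself a power of
  \<open>ab_quot\<close>.\<close>

lemma metacyclic_case_step:
  assumes A: "isobicyclic_triple.metacyclic_case klein_quot (klein_rep a) (klein_rep b) (e - 1)"
  shows "metacyclic_case"
proof -
  interpret Q: isobicyclic_triple klein_quot "klein_rep a" "klein_rep b" "klein_rep \<circ> \<sigma>" "e - 1" by (rule klein_quot_triple[OF e_ge_1])
  have ab_quot: "Q.ab_quot = klein_rep ab_quot"
    unfolding Q.ab_quot_def ab_quot_def using klein_rep_inv[OF e_ge_1 a_in] klein_rep_hom_mult[OF e_ge_1] by simp
  obtain r :: nat where r: "r mod 4 = 1" "Q.conj_by (klein_rep a) (klein_rep ab_quot) = klein_rep ab_quot [^]\<^bsub>klein_quot\<^esub> r"
    "klein_rep ab_quot [^]\<^bsub>klein_quot\<^esub> (2 ^ (e - 1 - 1) :: nat) = klein_rep quarter_ab"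
    using A unfolding Q.metacyclic_case_def ab_quot klein_quot_quarter_ab[OF Q.isobicyclic_triple_axioms] by blast
  have "klein_rep (ab_quot [^] (2 ^ (e - 2) :: nat)) = klein_rep quarter_ab"
    using r(3) by (simp add: klein_rep_pow[OF e_ge_1] numeral_2_eq_2)
  then obtain v where v: "v \<in> klein" "ab_quot [^] (2 ^ (e - 2) :: nat) = quarter_ab \<otimes> v"
    using klein_rep_eqD[OF e_ge_1] by (meson ab_quot_in nat_pow_closed quarter_in(3))
  have vc: "v \<in> carrier G" "v \<otimes> v = \<one>" "v \<otimes> quarter_ab = quarter_ab \<otimes> v"
    by (rule klein_closed[OF e_ge_1 v(1)] klein_sq[OF e_ge_1 v(1)] central_commute[OF klein_central[OF e_ge_1 v(1)] quarter_in(3)])+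
  have "e - 1 = Suc (e - 2)" using e3 by simp
  then have "(2::nat) ^ (e - 1) = 2 ^ (e - 2) + 2 ^ (e - 2)" by simp
  then have "ab_quot [^] (2 ^ (e - 1) :: nat) = (quarter_ab \<otimes> v) \<otimes> (quarter_ab \<otimes> v)"
    by (simp add: v flip: nat_pow_mult)
  also have "\<dots> = quarter_ab \<otimes> (v \<otimes> quarter_ab) \<otimes> v" using vc(1) by (simp add: m_assoc)
  also have "\<dots> = (quarter_ab \<otimes> quarter_ab) \<otimes> (v \<otimes> v)" unfolding vc(3) using vc(1) by (simp add: m_assoc)
  finally have hz: "ab_quot [^] (2 ^ (e - 1) :: nat) = z1 \<otimes> z2" by (simp add: vc quarter_ab_sq)
  have "klein_rep (conj_by a ab_quot) = klein_rep (ab_quot [^] r)"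
    using r(2) by (simp add: klein_rep_conj_by[OF e_ge_1] klein_rep_pow[OF e_ge_1])
  then obtain w where w: "w \<in> klein" "conj_by a ab_quot = ab_quot [^] r \<otimes> w"
    using klein_rep_eqD[OF e_ge_1] by (meson a_in conj_by_closed ab_quot_in nat_pow_closed)
  have wc: "w \<in> carrier G" "central w" using w klein_closed klein_central e_ge_1 by auto
  \<comment> \<open>As \<open>b = a \<otimes> ab_quot\<close>, both \<open>a\<close> and
    \<open>b\<close> conjugate \<open>ab_quot\<close> alike. Since \<open>\<sigma>\<close> inverts
    \<open>ab_quot\<close>, the image of the relation under \<open>\<sigma>\<close> can be compared
    with its inverse.\<close>
  have "conj_by b ab_quot = conj_by ab_quot (conj_by a ab_quot)" by (simp add: conj_by_conj_by a_ab_quot)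
  also have "\<dots> = conj_by ab_quot ab_quot [^] r \<otimes> w" using wc by (simp add: w conj_by_mult conj_by_pow conj_by_central)
  also have "conj_by ab_quot ab_quot = ab_quot" by (simp add: conj_by_def)
  finally have 1: "conj_by b ab_quot = ab_quot [^] r \<otimes> w" .
  have "conj_by b (inv ab_quot) = inv ab_quot [^] r \<otimes> \<sigma> w"
    using arg_cong[OF w(2), of \<sigma>] wc by (simp add: sig_conj_by sig_a sig_ab_quot sig_mult sig_pow)
  then have "inv (ab_quot [^] r \<otimes> w) = inv ab_quot [^] r \<otimes> \<sigma> w" by (simp add: conj_by_inv 1)
  then have "inv (ab_quot [^] r) \<otimes> w = inv (ab_quot [^] r) \<otimes> \<sigma> w"
    using wc central_commute[OF wc(2)] w klein_inv[OF e_ge_1] by (simp add: inv_mult_group nat_pow_inv)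
  then have "\<sigma> w = w" using wc by simp
  then consider "w = \<one>" | "w = z1 \<otimes> z2" using klein_sig_fixed[OF e_ge_1 w(1)] by blast
  then show ?thesis
  proof cases
    case 1
    then show ?thesis unfolding metacyclic_case_def using r(1) w(2) hz by auto
  next
    case 2
    have "conj_by a ab_quot = ab_quot [^] (r + 2 ^ (e - 1))"
      unfolding nat_pow_mult[symmetric, OF ab_quot_in] hz w 2 ..
    \<comment> \<open>Here \<open>e \<ge> 3\<close> matters: the change of exponent by
      \<open>2 ^ (e - 1)\<close> must keep it 1 modulo 4.\<close>
    moreover have "(4::nat) dvd 2 ^ (e - 1)"
      using le_imp_power_dvd[of 2 "e - 1" "2::nat"] e3 by simp
    then have "(r + 2 ^ (e - 1)) mod 4 = 1" using r(1) by (auto elim!: dvdE)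
    ultimately show ?thesis unfolding metacyclic_case_def using hz by blast
  qed
qed

end

end

section \<open>The case of order sixteen\<close>

context group
begin

lemma involution_int_pow:
  assumes u: "u \<in> carrier G" "u \<otimes> u = \<one>"
  shows "u [^] (c::int) = \<one> \<or> u [^] c = u"
proof -
  have "u [^] (2 * d) = \<one>" for d :: int
  proof -
    have "u [^] (2::int) = \<one>"
      using u int_pow_mult[of u 1 1] by simp
    then show ?thesis using u int_pow_pow[of u 2 d] by simp
  qed
  moreover have "u [^] (2 * d + 1) = u" for d :: int
    using u calculation[of d] by (simp add: int_pow_mult)
  ultimately show ?thesis by (metis evenE oddE)
qed

text \<open>The subgroup generated by \<open>x\<close> is normal and its quotient is generated by
  the image of \<open>y\<close>, hence abelian, so commutators are powers of
  \<open>x\<close>.\<close>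

lemma split_cyclic_commutator:
  assumes x: "x \<in> carrier G" and y: "y \<in> carrier G"
    and conj: "\<And>g. g \<in> carrier G \<Longrightarrow> \<exists>i::int. conj_by g x = x [^] i"
    and gen: "\<And>g. g \<in> carrier G \<Longrightarrow> \<exists>(i::int) (j::int). g = x [^] i \<otimes> y [^] j"
    and g: "g \<in> carrier G" and h: "h \<in> carrier G"
  shows "\<exists>k::int. g \<otimes> h = x [^] k \<otimes> (h \<otimes> g)"
proof -
  have push: "\<exists>i'::int. y [^] j \<otimes> x [^] i = x [^] i' \<otimes> y [^] j" for i j :: int
  proof -
    obtain c :: int where c: "conj_by (inv (y [^] j)) x = x [^] c" using conj y by blast
    have "conj_by (inv (y [^] j)) (x [^] i) = conj_by (inv (y [^] j)) x [^] i"
      using group_hom.hom_int_pow[of G G "conj_by (inv (y [^] j))" x i] x y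
      by (simp add: group_hom_def group_hom_axioms_def is_group hom_def conj_by_mult)
    then have "conj_by (inv (y [^] j)) (x [^] i) = x [^] (c * i)"
      using x c by (simp add: int_pow_pow)
    then show ?thesis using x y by (metis conj_by_eq_iff conj_by_def int_pow_closed inv_closed inv_inv inv_solve_right m_closed)
  qed
  obtain i j k l :: int where gh: "g = x [^] i \<otimes> y [^] j" "h = x [^] k \<otimes> y [^] l"
    using gen g h by meson
  obtain k' :: int where k': "y [^] j \<otimes> x [^] k = x [^] k' \<otimes> y [^] j" using push by blast
  obtain i' :: int where i': "y [^] l \<otimes> x [^] i = x [^] i' \<otimes> y [^] l" using push by blast
  have "g \<otimes> h = x [^] i \<otimes> (y [^] j \<otimes> x [^] k) \<otimes> y [^] l" using x y by (simp add: gh m_assoc)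
  also have "\<dots> = x [^] (i + k') \<otimes> y [^] (j + l)" using x y by (simp add: k' m_assoc int_pow_mult)
  finally have 1: "g \<otimes> h = x [^] (i + k') \<otimes> y [^] (j + l)" .
  have "h \<otimes> g = x [^] k \<otimes> (y [^] l \<otimes> x [^] i) \<otimes> y [^] j" using x y by (simp add: gh m_assoc)
  also have "\<dots> = x [^] (k + i') \<otimes> y [^] (l + j)" using x y by (simp add: i' m_assoc int_pow_mult)
  finally have 2: "h \<otimes> g = x [^] (k + i') \<otimes> y [^] (j + l)" by (simp add: add.commute)
  have "x [^] ((i + k') - (k + i')) \<otimes> x [^] (k + i') = x [^] (i + k')"
    using x by (simp add: int_pow_mult[symmetric])
  then have "g \<otimes> h = x [^] ((i + k') - (k + i')) \<otimes> (h \<otimes> g)"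
    unfolding 1 2 using x y by (simp add: m_assoc[symmetric])
  then show ?thesis by blast
qed

end

context isobicyclic_triple
begin

lemma z_in_klein: "z1 \<in> klein" "z2 \<in> klein" "z1 \<otimes> z2 \<in> klein"
  by (simp_all add: klein_def)

lemma z_squares: "a \<otimes> a = z1" "b \<otimes> b = z2" if "e = 2"
  unfolding z1_def z2_def using that by (simp_all add: numeral_2_eq_2)

text \<open>Modulo the central elementary abelian group \<open>klein\<close> there are four
  representatives 1, \<open>a\<close>, \<open>b\<close>, \<open>a \<otimes> b\<close>, and a factor
  from \<open>klein\<close> does not affect the square. In particular \<open>z1 \<otimes> z2\<close>
  is not a square.\<close>

lemma squares_e2:
  assumes e: "e = 2" and sq: "(a \<otimes> b) \<otimes> (a \<otimes> b) = \<one>" and g: "g \<in> carrier G"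
  shows "g \<otimes> g \<in> {\<one>, z1, z2}"
proof -
  have e1: "e \<ge> 1" using e by simp
  obtain i j :: nat where ij: "g = a [^] i \<otimes> b [^] j" using factor g by blast
  have pw: "x [^] i = (x \<otimes> x) [^] (i div 2) \<otimes> x [^] (i mod 2)" if "x \<in> carrier G" for x and i :: nat
  proof -
    have "x \<otimes> x = x [^] (2::nat)" using that by (simp add: numeral_2_eq_2)
    then show ?thesis using that by (simp add: nat_pow_pow nat_pow_mult)
  qed
  define v where "v = z1 [^] (i div 2) \<otimes> z2 [^] (j div 2)"
  define h where "h = a [^] (i mod 2) \<otimes> b [^] (j mod 2)"
  have v: "v \<in> klein" unfolding v_def by (intro klein_mult klein_pow e1 z_in_klein)
  have vc: "v \<in> carrier G" "v \<otimes> v = \<one>" by (rule klein_closed[OF e1 v] klein_sq[OF e1 v])+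
  have hc: "h \<in> carrier G" by (simp add: h_def)
  have "g = z1 [^] (i div 2) \<otimes> (a [^] (i mod 2) \<otimes> (z2 [^] (j div 2) \<otimes> b [^] (j mod 2)))"
    unfolding ij pw[of a i, OF a_in] pw[of b j, OF b_in] z_squares[OF e] by (simp add: m_assoc)
  also have "a [^] (i mod 2) \<otimes> (z2 [^] (j div 2) \<otimes> b [^] (j mod 2)) = z2 [^] (j div 2) \<otimes> h"
    unfolding h_def by (rule central_commute2[OF central_pow[OF z2_central[OF e1]], symmetric]) simp_all
  finally have gv: "g = v \<otimes> h" using hc by (simp add: v_def m_assoc)
  have "g \<otimes> g = v \<otimes> (h \<otimes> v) \<otimes> h" unfolding gv using vc(1) hc by (simp add: m_assoc)
  also have "h \<otimes> v = v \<otimes> h" using central_commute[OF klein_central[OF e1 v] hc] by simp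
  also have "v \<otimes> (v \<otimes> h) \<otimes> h = (v \<otimes> v) \<otimes> (h \<otimes> h)" using vc(1) hc by (simp add: m_assoc)
  finally have gh: "g \<otimes> g = h \<otimes> h" using vc hc by simp
  have "i mod 2 = 0 \<or> i mod 2 = 1" "j mod 2 = 0 \<or> j mod 2 = 1" by auto
  then show ?thesis unfolding gh h_def using z_squares[OF e] sq by auto
qed

text \<open>The commutator \<open>z1 \<otimes> z2\<close> would be some \<open>x [^] k\<close>. For
  even \<open>k\<close> it would be 1 or \<open>x \<otimes> x\<close>, which
  \<open>squares_e2\<close> excludes. For odd \<open>k\<close> the element \<open>x\<close> would
  lie in \<open>klein\<close>, so the group would be generated by a central element and
  \<open>y'\<close>, hence abelian.\<close>

lemma not_split_e2:
  assumes e: "e = 2" and ba: "b \<otimes> a = z1 \<otimes> z2 \<otimes> (a \<otimes> b)" and sq: "(a \<otimes> b) \<otimes> (a \<otimes> b) = \<one>"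
  shows "\<not> split_cyclic"
proof
  assume "split_cyclic"
  then obtain x y' where x: "x \<in> carrier G" and y': "y' \<in> carrier G"
    and 1: "\<And>g. g \<in> carrier G \<Longrightarrow> \<exists>i::int. conj_by g x = x [^] i"
    and 2: "\<And>g. g \<in> carrier G \<Longrightarrow> \<exists>(i::int) (j::int). g = x [^] i \<otimes> y' [^] j"
    unfolding split_cyclic_def by blast
  have e1: "e \<ge> 1" using e by simp
  note d = z_distinct[OF e1]
  obtain k :: int where "b \<otimes> a = x [^] k \<otimes> (a \<otimes> b)"
    using split_cyclic_commutator[OF x y' 1 2 b_in a_in] by blast
  then have k: "x [^] k = z1 \<otimes> z2" using ba x by simp
  have xx: "x \<otimes> x \<in> {\<one>, z1, z2}" by (rule squares_e2[OF e sq x])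
  have xxN: "x \<otimes> x \<in> klein" using xx by (auto simp: klein_def)
  have xx1: "(x \<otimes> x) \<otimes> (x \<otimes> x) = \<one>" by (rule klein_sq[OF e1 xxN])
  have xc: "(x \<otimes> x) [^] (c::int) = \<one> \<or> (x \<otimes> x) [^] c = x \<otimes> x" for c
    using involution_int_pow xx1 x by simp
  have x2: "x [^] (2 * c) = (x \<otimes> x) [^] c" for c :: int
  proof -
    have "x [^] (2::int) = x \<otimes> x" using x int_pow_mult[of x 1 1] by simp
    then show ?thesis using x by (metis int_pow_pow)
  qed
  show False
  proof (cases "even k")
    case True
    then obtain c where "k = 2 * c" by blast
    then have "z1 \<otimes> z2 = \<one> \<or> z1 \<otimes> z2 = x \<otimes> x" using k x2 xc by metis
    then have "z1 \<otimes> z2 \<in> {\<one>, z1, z2}" using xx by auto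
    then show False using d by auto
  next
    case False
    then obtain c where c: "k = 2 * c + 1" by (rule oddE)
    have cN: "(x \<otimes> x) [^] c \<in> klein" using xc[of c] xxN klein_one[OF e1] by auto
    have "(x \<otimes> x) [^] c \<otimes> x = z1 \<otimes> z2" using k c x x2 by (simp add: int_pow_mult)
    then have "x = inv ((x \<otimes> x) [^] c) \<otimes> (z1 \<otimes> z2)" using x by (metis inv_solve_left int_pow_closed m_closed z_in)
    moreover have "inv ((x \<otimes> x) [^] c) \<in> klein" using klein_inv[OF e1 cN] cN by simp
    ultimately have "x \<in> klein" using klein_mult[OF e1 _ z_in_klein(3)] by metis
    then have xcen: "central x" by (rule klein_central[OF e1])
    have xcen2: "x [^] (i::int) \<otimes> g = g \<otimes> x [^] i" if "g \<in> carrier G" for i g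
    proof -
      have "conj_by g (x [^] i) = conj_by g x [^] i"
        using group_hom.hom_int_pow[of G G "conj_by g" x i] x that
        by (simp add: group_hom_def group_hom_axioms_def is_group hom_def conj_by_mult)
      then show ?thesis using x that xcen by (simp add: conj_by_central conj_by_eq_iff)
    qed
    obtain i j k l :: int where gh: "a = x [^] i \<otimes> y' [^] j" "b = x [^] k \<otimes> y' [^] l"
      using 2 a_in b_in by meson
    have c: "y' [^] j \<otimes> x [^] k = x [^] k \<otimes> y' [^] j" "y' [^] l \<otimes> x [^] i = x [^] i \<otimes> y' [^] l"
      using xcen2 y' by simp_all
    have ba': "b \<otimes> a = x [^] k \<otimes> (y' [^] l \<otimes> x [^] i) \<otimes> y' [^] j"
      using x y' by (subst gh, subst gh) (simp add: m_assoc)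
    have "a \<otimes> b = x [^] i \<otimes> (y' [^] j \<otimes> x [^] k) \<otimes> y' [^] l"
      using x y' by (subst gh, subst gh) (simp add: m_assoc)
    also have "\<dots> = x [^] i \<otimes> x [^] k \<otimes> y' [^] (j + l)"
      unfolding c using x y' by (simp add: m_assoc int_pow_mult)
    also have "\<dots> = x [^] k \<otimes> x [^] i \<otimes> y' [^] (l + j)"
      using x by (simp add: int_pow_mult[symmetric] add.commute)
    also have "\<dots> = x [^] k \<otimes> (y' [^] l \<otimes> x [^] i) \<otimes> y' [^] j"
      unfolding c using x y' by (simp add: m_assoc int_pow_mult)
    also have "\<dots> = b \<otimes> a"
      by (rule ba'[symmetric])
    finally have "\<one> \<otimes> (a \<otimes> b) = z1 \<otimes> z2 \<otimes> (a \<otimes> b)" using ba by simp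
    then have "\<one> = z1 \<otimes> z2" by (subst (asm) r_cancel) auto
    then show False using d by simp
  qed
qed

lemma dichotomy_e2:
  assumes e: "e = 2" shows "metacyclic_case \<or> nonmetacyclic_case"
proof -
  have e1: "e \<ge> 1" using e by simp
  interpret Q: isobicyclic_triple klein_quot "klein_rep a" "klein_rep b" "klein_rep \<circ> \<sigma>" "e - 1" by (rule klein_quot_triple[OF e1])
  have "klein_rep (b \<otimes> a) = klein_rep (a \<otimes> b)"
    using Q.base_commute klein_rep_hom_mult[OF e1 a_in b_in] klein_rep_hom_mult[OF e1 b_in a_in] e by simp
  then obtain w where w: "w \<in> klein" "b \<otimes> a = a \<otimes> b \<otimes> w"
    using klein_rep_eqD[OF e1] by (meson a_in b_in m_closed)
  have wc: "w \<in> carrier G" "w \<otimes> w = \<one>" "central w"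
    by (rule klein_closed[OF e1 w(1)] klein_sq[OF e1 w(1)] klein_central[OF e1 w(1)])+
  \<comment> \<open>Exchanging \<open>a\<close> and \<open>b\<close> inverts the commutator, so
    \<open>\<sigma> w\<close> is the inverse of \<open>w\<close>, which is \<open>w\<close>
    itself.\<close>
  have "a \<otimes> b = b \<otimes> a \<otimes> \<sigma> w"
    using arg_cong[OF w(2), of \<sigma>] wc(1) by (simp add: sig_mult sig_a sig_b)
  also have "\<dots> = a \<otimes> b \<otimes> (w \<otimes> \<sigma> w)" unfolding w(2) using wc(1) by (simp add: m_assoc)
  finally have "a \<otimes> b \<otimes> \<one> = a \<otimes> b \<otimes> (w \<otimes> \<sigma> w)" by simp
  then have "\<one> = w \<otimes> \<sigma> w" by (subst (asm) l_cancel) (use wc in auto)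
  then have "w \<otimes> \<sigma> w = w \<otimes> w" using wc by simp
  then have "\<sigma> w = w" using wc(1) by (metis l_cancel sig_closed)
  then consider "w = \<one>" | "w = z1 \<otimes> z2" using klein_sig_fixed[OF e1 w(1)] by blast
  then show ?thesis
  proof cases
    case 1
    then have "a \<otimes> b = b \<otimes> a" using w by simp
    then show ?thesis using commuting_metacyclic_case e1 by blast
  next
    case 2
    \<comment> \<open>For \<open>e = 2\<close> the squares of \<open>a\<close> and \<open>b\<close>
      are \<open>z1\<close> and \<open>z2\<close>, whose product cancels against the commutator
      \<open>w\<close>.\<close>
    have "(a \<otimes> b) \<otimes> (a \<otimes> b) = a \<otimes> (b \<otimes> a) \<otimes> b" by (simp add: m_assoc)
    also have "\<dots> = a \<otimes> a \<otimes> b \<otimes> (w \<otimes> b)" unfolding w(2) using wc(1) by (simp add: m_assoc)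
    also have "w \<otimes> b = b \<otimes> w" by (rule central_commute[OF wc(3) b_in])
    also have "a \<otimes> a \<otimes> b \<otimes> (b \<otimes> w) = (a \<otimes> a) \<otimes> (b \<otimes> b) \<otimes> w" using wc(1) by (simp add: m_assoc)
    also have "\<dots> = w \<otimes> w" by (simp add: z_squares[OF e] 2)
    finally have sq: "(a \<otimes> b) \<otimes> (a \<otimes> b) = \<one>" using wc by simp
    have "b \<otimes> a = z1 \<otimes> z2 \<otimes> (a \<otimes> b)"
      unfolding w(2) using central_commute[OF wc(3)] 2 by simp
    then have ns: "\<not> split_cyclic" using not_split_e2[OF e _ sq] by blast
    have "conj_by a z2 = inv z2" using conj_by_central[OF z2_central[OF e1] a_in] z_sq(2)[OF e1]
      by (metis inv_equality z_in(2))
    moreover have "z2 \<otimes> z1 = z1 \<otimes> z2" using central_commute[OF z2_central[OF e1]] by simp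
    ultimately show ?thesis unfolding nonmetacyclic_case_def z_squares[OF e] using sq ns by (intro disjI2 conjI exI[of _ 0]) simp_all
  qed
qed

end

section \<open>Lifting the nonmetacyclic relations\<close>

context isobicyclic_triple
begin

text \<open>The error \<open>t\<close> is a central commutator of the squares of \<open>a\<close>
  and \<open>b\<close>. \<open>\<sigma>\<close> exchanges these squares and so inverts
  \<open>t\<close>, which is its own inverse.\<close>

lemma conj_by_sq_sig_fixed:
  assumes e1: "e \<ge> 1" and t: "t \<in> klein" and eq: "conj_by (a \<otimes> a) (b \<otimes> b) = b \<otimes> b \<otimes> t"
  shows "\<sigma> t = t"
proof -
  note tc = klein_closed[OF e1 t] klein_sq[OF e1 t]
  have "conj_by (b \<otimes> b) (a \<otimes> a) = a \<otimes> a \<otimes> \<sigma> t"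
    using arg_cong[OF eq, of \<sigma>] tc(1) by (simp add: sig_conj_by sig_mult sig_a sig_b)
  then have 1: "(a \<otimes> a) \<otimes> (b \<otimes> b) = (b \<otimes> b) \<otimes> (a \<otimes> a \<otimes> \<sigma> t)"
    using tc(1) by (subst (asm) conj_by_eq_iff) auto
  have 2: "(b \<otimes> b) \<otimes> (a \<otimes> a) = (a \<otimes> a) \<otimes> (b \<otimes> b \<otimes> t)"
    using eq tc(1) by (subst (asm) conj_by_eq_iff) auto
  have "(a \<otimes> a) \<otimes> (b \<otimes> b) = (b \<otimes> b) \<otimes> (a \<otimes> a) \<otimes> \<sigma> t"
    using 1 tc(1) by (simp add: m_assoc)
  also have "\<dots> = (a \<otimes> a) \<otimes> (b \<otimes> b) \<otimes> (t \<otimes> \<sigma> t)"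
    unfolding 2 using tc(1) by (simp add: m_assoc)
  finally have "(a \<otimes> a) \<otimes> (b \<otimes> b) \<otimes> (t \<otimes> \<sigma> t) = (a \<otimes> a) \<otimes> (b \<otimes> b) \<otimes> \<one>" by simp
  then have "t \<otimes> \<sigma> t = \<one>" by (subst (asm) l_cancel) (use tc(1) in auto)
  then show ?thesis using tc by (metis l_cancel sig_closed)
qed

context
  assumes e3: "e \<ge> 3"
begin

lemma quarter_ab_commute_q: "quarter_ab \<otimes> (b \<otimes> b) = (b \<otimes> b) \<otimes> quarter_ab"
proof -
  have 1: "quarter_a \<otimes> (b \<otimes> b) = (b \<otimes> b) \<otimes> quarter_a" using quarter_a_commute_q[OF e3] by (simp add: conj_by_eq_iff)
  have 2: "quarter_b \<otimes> (b \<otimes> b) = (b \<otimes> b) \<otimes> quarter_b"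
    unfolding pow_half(2)[OF e3] by (rule group_commutes_pow) simp_all
  have "quarter_ab \<otimes> (b \<otimes> b) = quarter_a \<otimes> (quarter_b \<otimes> (b \<otimes> b))" by (simp add: quarter_ab_def m_assoc)
  also have "\<dots> = (quarter_a \<otimes> (b \<otimes> b)) \<otimes> quarter_b" unfolding 2 by (simp add: m_assoc)
  also have "\<dots> = (b \<otimes> b) \<otimes> quarter_ab" unfolding 1 by (simp add: m_assoc quarter_ab_def)
  finally show ?thesis .
qed

lemma inv_quarter_b: "inv quarter_b = quarter_b \<otimes> z2"
proof (rule inv_equality)
  have "quarter_b \<otimes> z2 \<otimes> quarter_b = quarter_b \<otimes> (z2 \<otimes> quarter_b)" by (simp add: m_assoc)
  also have "z2 \<otimes> quarter_b = quarter_b \<otimes> z2" using central_commute[OF z2_central[OF e_ge_1[OF e3]]] by simp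
  also have "quarter_b \<otimes> (quarter_b \<otimes> z2) = (quarter_b \<otimes> quarter_b) \<otimes> z2" by (simp add: m_assoc)
  finally show "quarter_b \<otimes> z2 \<otimes> quarter_b = \<one>" by (simp add: quarter_sq[OF e3] z_sq[OF e_ge_1[OF e3]])
qed simp_all

text \<open>Raising the relation to the power \<open>2 ^ (e - 3)\<close> turns
  \<open>b \<otimes> b\<close> into \<open>quarter_b\<close>. The factor \<open>z2\<close> appears
  because \<open>quarter_b\<close> squares to \<open>z2\<close>, so its inverse is
  \<open>quarter_b \<otimes> z2\<close>.\<close>

lemma conj_by_a_quarter_b:
  assumes u: "u \<in> carrier G" "u \<otimes> (b \<otimes> b) = (b \<otimes> b) \<otimes> u" and eq: "conj_by a (b \<otimes> b) = inv (b \<otimes> b) \<otimes> u"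
  shows "conj_by a quarter_b = quarter_b \<otimes> (z2 \<otimes> u [^] (2 ^ (e - 3) :: nat))"
proof -
  let ?K = "2 ^ (e - 3) :: nat"
  have "conj_by a quarter_b = (inv (b \<otimes> b) \<otimes> u) [^] ?K"
    unfolding pow_half(2)[OF e3] using eq by (simp add: conj_by_pow)
  also have "\<dots> = inv (b \<otimes> b) [^] ?K \<otimes> u [^] ?K"
    by (rule pow_mult_distrib) (use u inv_commute[OF _ u(1) u(2)] in simp_all)
  also have "inv (b \<otimes> b) [^] ?K = inv quarter_b"
    unfolding pow_half(2)[OF e3] by (simp add: nat_pow_inv)
  finally show ?thesis using u(1) by (simp add: inv_quarter_b m_assoc)
qed

text \<open>The parameters of the quotient must vanish, since otherwise a factor
  \<open>quarter_ab\<close> enters a lifted relation, and each such factor is contradictory. What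
  remains are errors \<open>v\<close> and \<open>w\<close> in \<open>klein\<close>; once shown to be
  fixed by \<open>\<sigma>\<close>, they become the parameters of the group.\<close>

lemma nonmetacyclic_case_step:
  assumes B: "isobicyclic_triple.nonmetacyclic_case klein_quot (klein_rep a) (klein_rep b) (e - 1)"
  shows "nonmetacyclic_case"
proof -
  note e1 = e_ge_1[OF e3]
  interpret Q: isobicyclic_triple klein_quot "klein_rep a" "klein_rep b" "klein_rep \<circ> \<sigma>" "e - 1" by (rule klein_quot_triple[OF e1])
  note d = z_distinct[OF e1]
  obtain m l :: nat where ml: "m < 2" "l < 2" "e - 1 = 2 \<longrightarrow> m = 0 \<and> l = 0"
    and Q1: "(klein_rep a \<otimes>\<^bsub>klein_quot\<^esub> klein_rep b) \<otimes>\<^bsub>klein_quot\<^esub> (klein_rep a \<otimes>\<^bsub>klein_quot\<^esub> klein_rep b) = klein_rep quarter_ab [^]\<^bsub>klein_quot\<^esub> m"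
    and Q2: "Q.conj_by (klein_rep a) (klein_rep b \<otimes>\<^bsub>klein_quot\<^esub> klein_rep b) =
      inv\<^bsub>klein_quot\<^esub> (klein_rep b \<otimes>\<^bsub>klein_quot\<^esub> klein_rep b) \<otimes>\<^bsub>klein_quot\<^esub> klein_rep quarter_ab [^]\<^bsub>klein_quot\<^esub> l"
    and ns: "\<not> Q.split_cyclic"
    using B unfolding Q.nonmetacyclic_case_def klein_quot_quarter_ab[OF e3 Q.isobicyclic_triple_axioms] by blast
  note hom = klein_rep_hom_mult[OF e1] klein_rep_inv[OF e1] klein_rep_pow[OF e1] klein_rep_conj_by[OF e1]
  have "klein_rep ((a \<otimes> b) \<otimes> (a \<otimes> b)) = klein_rep (quarter_ab [^] m)"
    using Q1 by (simp only: hom a_in b_in m_closed quarter_in)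
  from klein_rep_eqD[OF e1 _ _ this]
  obtain v where v: "v \<in> klein" "(a \<otimes> b) \<otimes> (a \<otimes> b) = quarter_ab [^] m \<otimes> v" by auto
  have "klein_rep (conj_by a (b \<otimes> b)) = klein_rep (inv (b \<otimes> b) \<otimes> quarter_ab [^] l)"
    using Q2 by (simp only: hom a_in b_in m_closed inv_closed nat_pow_closed quarter_in)
  from klein_rep_eqD[OF e1 _ _ this]
  obtain w where w: "w \<in> klein" "conj_by a (b \<otimes> b) = inv (b \<otimes> b) \<otimes> quarter_ab [^] l \<otimes> w" by auto
  note vc = klein_closed[OF e1 v(1)] klein_sq[OF e1 v(1)] klein_central[OF e1 v(1)]
  note wc = klein_closed[OF e1 w(1)] klein_sq[OF e1 w(1)] klein_central[OF e1 w(1)]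
  let ?K = "2 ^ (e - 3) :: nat"
  have K: "even ?K" if "e \<ge> 4" using that by simp
  \<comment> \<open>With \<open>l = 1\<close>, put \<open>u = quarter_ab \<otimes> w\<close>.
    Conjugation by \<open>a\<close> multiplies \<open>u\<close> by
    \<open>t = z2 \<otimes> u [^] ?K\<close>, so conjugating \<open>b \<otimes> b\<close> twice by
    \<open>a\<close> produces the error \<open>t\<close>. Since \<open>u\<close> squares to
    \<open>z1 \<otimes> z2\<close> and \<open>?K\<close> is even, \<open>t\<close> is
    \<open>z1\<close> or \<open>z2\<close>, neither of which is fixed by
    \<open>\<sigma>\<close>.\<close>
  have l0: "l = 0"
  proof (rule ccontr)
    assume "l \<noteq> 0"
    then have l1: "l = 1" and e4: "e \<ge> 4" using ml e3 by (cases "e = 3"; simp)+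
    define u where "u = quarter_ab \<otimes> w"
    have uc: "u \<in> carrier G" using wc by (simp add: u_def)
    have uq: "u \<otimes> (b \<otimes> b) = (b \<otimes> b) \<otimes> u"
    proof -
      have "u \<otimes> (b \<otimes> b) = quarter_ab \<otimes> (w \<otimes> (b \<otimes> b))" using wc(1) by (simp add: u_def m_assoc)
      also have "w \<otimes> (b \<otimes> b) = (b \<otimes> b) \<otimes> w" using central_commute[OF wc(3)] by simp
      also have "quarter_ab \<otimes> ((b \<otimes> b) \<otimes> w) = (quarter_ab \<otimes> (b \<otimes> b)) \<otimes> w" using wc(1) by (simp add: m_assoc)
      finally show ?thesis unfolding quarter_ab_commute_q using wc(1) by (simp add: u_def m_assoc)
    qed
    have ca: "conj_by a (b \<otimes> b) = inv (b \<otimes> b) \<otimes> u"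
      using w(2) wc(1) by (simp add: l1 u_def m_assoc)
    obtain c where c: "?K = 2 * c" using K[OF e4] by blast
    have "u [^] (2::nat) = z1 \<otimes> z2"
    proof -
      have "u [^] (2::nat) = quarter_ab \<otimes> (w \<otimes> quarter_ab) \<otimes> w" using wc(1) by (simp add: numeral_2_eq_2 u_def m_assoc)
      also have "w \<otimes> quarter_ab = quarter_ab \<otimes> w" using central_commute[OF wc(3)] by simp
      also have "quarter_ab \<otimes> (quarter_ab \<otimes> w) \<otimes> w = (quarter_ab \<otimes> quarter_ab) \<otimes> (w \<otimes> w)" using wc(1) by (simp add: m_assoc)
      finally show ?thesis by (simp add: wc quarter_ab_sq[OF e3])
    qed
    then have "u [^] ?K = (z1 \<otimes> z2) [^] c" unfolding c using uc by (simp flip: nat_pow_pow)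
    moreover have "(z1 \<otimes> z2) [^] (k::nat) \<in> {\<one>, z1 \<otimes> z2}" for k
      by (induction k) (use klein_sq[OF e1 z_in_klein(3)] in auto)
    ultimately have uK: "u [^] ?K \<in> {\<one>, z1 \<otimes> z2}" by metis
    define t where "t = z2 \<otimes> u [^] ?K"
    have "z2 \<otimes> (z1 \<otimes> z2) = z1"
      using central_commute[OF z1_central[OF e1], of z2] by (simp add: z_sq2[OF e1])
    then have t: "t = z1 \<or> t = z2" using uK unfolding t_def by auto
    then have tN: "t \<in> klein" using z_in_klein by blast
    note tc = klein_closed[OF e1 tN]
    have cb: "conj_by a quarter_b = quarter_b \<otimes> t" using conj_by_a_quarter_b[OF uc uq ca] by (simp add: t_def)
    have "conj_by a quarter_a = quarter_a" unfolding quarter_a_def by (simp add: conj_by_pow) (simp add: conj_by_def)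
    then have "conj_by a quarter_ab = quarter_ab \<otimes> t" using tc by (simp add: quarter_ab_def conj_by_mult cb m_assoc)
    then have "conj_by a u = quarter_ab \<otimes> t \<otimes> w" using wc by (simp add: u_def conj_by_mult conj_by_central)
    also have "\<dots> = u \<otimes> t" using tc wc(1) central_commute[OF wc(3) tc] by (simp add: u_def m_assoc)
    finally have cu: "conj_by a u = u \<otimes> t" .
    have "conj_by (a \<otimes> a) (b \<otimes> b) = conj_by a (conj_by a (b \<otimes> b))" by (simp add: conj_by_conj_by)
    also have "\<dots> = inv (conj_by a (b \<otimes> b)) \<otimes> (u \<otimes> t)" using uc by (simp add: ca conj_by_mult conj_by_inv cu)
    also have "\<dots> = inv u \<otimes> ((b \<otimes> b) \<otimes> u) \<otimes> t"
      unfolding ca using uc tc by (simp add: inv_mult_group m_assoc)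
    also have "\<dots> = (b \<otimes> b) \<otimes> t" unfolding uq[symmetric] using uc tc by (simp add: m_assoc)
    finally have "\<sigma> t = t" using conj_by_sq_sig_fixed[OF e1 tN] by blast
    then show False using t d by auto
  qed
  have ca: "conj_by a (b \<otimes> b) = inv (b \<otimes> b) \<otimes> w" using w wc by (simp add: l0)
  have wq: "w \<otimes> (b \<otimes> b) = (b \<otimes> b) \<otimes> w" using central_commute[OF wc(3)] by simp
  have pq: "(b \<otimes> b) \<otimes> (a \<otimes> a) = (a \<otimes> a) \<otimes> (b \<otimes> b)"
  proof -
    have "conj_by (a \<otimes> a) (b \<otimes> b) = conj_by a (conj_by a (b \<otimes> b))" by (simp add: conj_by_conj_by)
    also have "\<dots> = inv (conj_by a (b \<otimes> b)) \<otimes> w" using wc by (simp add: ca conj_by_mult conj_by_inv conj_by_central)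
    also have "\<dots> = inv w \<otimes> ((b \<otimes> b) \<otimes> w)"
      unfolding ca using wc(1) by (simp add: inv_mult_group m_assoc)
    also have "\<dots> = b \<otimes> b" unfolding wq[symmetric] using wc(1) by simp
    finally show ?thesis by (subst (asm) conj_by_eq_iff) auto
  qed
  \<comment> \<open>With \<open>m = 1\<close>, \<open>quarter_ab\<close> differs from the square of
    \<open>a \<otimes> b\<close> by a central factor, so it commutes with
    \<open>a \<otimes> b\<close>. But \<open>a\<close> multiplies \<open>quarter_b\<close> by
    \<open>z2\<close> and \<open>b\<close> multiplies \<open>quarter_a\<close> by \<open>z1\<close>,
    so conjugation by \<open>a \<otimes> b\<close> multiplies \<open>quarter_ab\<close> by
    \<open>z1 \<otimes> z2\<close>.\<close>
  have m0: "m = 0"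
  proof (rule ccontr)
    assume "m \<noteq> 0"
    then have m1: "m = 1" and e4: "e \<ge> 4" using ml e3 by (cases "e = 3"; simp)+
    have cb: "conj_by a quarter_b = quarter_b \<otimes> z2"
      using conj_by_a_quarter_b[OF wc(1) wq ca] klein_pow_even[OF e1 w(1) K[OF e4]] by simp
    have cb': "conj_by b quarter_a = quarter_a \<otimes> z1" using arg_cong[OF cb, of \<sigma>] by (simp add: sig_conj_by sig_mult sig_a)
    have 1: "conj_by a quarter_a = quarter_a" "conj_by b quarter_b = quarter_b"
      unfolding quarter_a_def quarter_b_def by (simp_all add: conj_by_pow) (simp_all add: conj_by_def)
    have "conj_by (a \<otimes> b) quarter_ab = conj_by b (conj_by a quarter_ab)" by (simp add: conj_by_conj_by)
    also have "\<dots> = quarter_a \<otimes> (z1 \<otimes> quarter_b) \<otimes> z2"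
      by (simp add: quarter_ab_def conj_by_mult 1 cb cb' conj_by_central[OF z2_central[OF e1]] m_assoc)
    also have "z1 \<otimes> quarter_b = quarter_b \<otimes> z1" using central_commute[OF z1_central[OF e1]] by simp
    also have "quarter_a \<otimes> (quarter_b \<otimes> z1) \<otimes> z2 = quarter_ab \<otimes> (z1 \<otimes> z2)" by (simp add: quarter_ab_def m_assoc)
    finally have cy: "conj_by (a \<otimes> b) quarter_ab = quarter_ab \<otimes> (z1 \<otimes> z2)" .
    have abv: "(a \<otimes> b) \<otimes> (a \<otimes> b) = quarter_ab \<otimes> v" using v(2) by (simp add: m1)
    have "conj_by (a \<otimes> b) ((a \<otimes> b) \<otimes> (a \<otimes> b)) = (a \<otimes> b) \<otimes> (a \<otimes> b)"
      by (subst conj_by_eq_iff) (simp_all add: m_assoc)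
    then have "conj_by (a \<otimes> b) quarter_ab \<otimes> v = quarter_ab \<otimes> v"
      unfolding abv using vc by (simp add: conj_by_mult conj_by_central)
    then have "quarter_ab \<otimes> (z1 \<otimes> z2) = quarter_ab" unfolding cy using vc(1) by simp
    then show False using d by simp
  qed
  have abv: "(a \<otimes> b) \<otimes> (a \<otimes> b) = v" using v vc by (simp add: m0)
  have cb: "conj_by a b = inv (a \<otimes> a) \<otimes> inv b \<otimes> v"
  proof -
    have "a \<otimes> (b \<otimes> a) \<otimes> b = v" using abv by (simp add: m_assoc)
    then have "b \<otimes> a = inv a \<otimes> v \<otimes> inv b"
      using vc(1) by (metis a_in b_in inv_closed inv_solve_left inv_solve_right m_assoc m_closed)
    then have "conj_by a b = inv a \<otimes> (inv a \<otimes> v \<otimes> inv b)" by (simp add: conj_by_def m_assoc)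
    then show ?thesis using vc(1) central_commute[OF vc(3), of "inv b"]
      by (simp add: m_assoc inv_mult_group)
  qed
  have cbp: "conj_by b (a \<otimes> a) = inv (a \<otimes> a) \<otimes> \<sigma> w"
    using arg_cong[OF ca, of \<sigma>] wc(1) by (simp add: sig_conj_by sig_mult sig_inv sig_a sig_b)
  \<comment> \<open>Squaring the formula \<open>cb\<close> computes
    \<open>conj_by a (b \<otimes> b)\<close> a second time, now with the error
    \<open>\<sigma> w\<close> coming from \<open>cbp\<close>.\<close>
  have sw: "\<sigma> w = w"
  proof -
    have swN: "\<sigma> w \<in> klein" using klein_sig[OF e1 w(1)] .
    note swc = klein_closed[OF e1 swN] klein_central[OF e1 swN]
    have "conj_by a (b \<otimes> b) = conj_by a b \<otimes> conj_by a b" by (simp add: conj_by_mult)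
    also have "\<dots> = inv (a \<otimes> a) \<otimes> inv b \<otimes> (v \<otimes> (inv (a \<otimes> a) \<otimes> inv b)) \<otimes> v"
      unfolding cb using vc(1) by (simp add: m_assoc)
    also have "v \<otimes> (inv (a \<otimes> a) \<otimes> inv b) = inv (a \<otimes> a) \<otimes> inv b \<otimes> v"
      using central_commute[OF vc(3)] by simp
    also have "inv (a \<otimes> a) \<otimes> inv b \<otimes> (inv (a \<otimes> a) \<otimes> inv b \<otimes> v) \<otimes> v
        = inv (a \<otimes> a) \<otimes> inv (conj_by b (a \<otimes> a)) \<otimes> inv (b \<otimes> b) \<otimes> (v \<otimes> v)"
      using vc(1) by (simp add: conj_by_def m_assoc inv_mult_group)
    also have "\<dots> = inv (a \<otimes> a) \<otimes> (\<sigma> w \<otimes> (a \<otimes> a)) \<otimes> inv (b \<otimes> b)"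
      unfolding cbp using swc(1) klein_inv[OF e1 swN] vc(2) by (simp add: inv_mult_group m_assoc)
    also have "\<sigma> w \<otimes> (a \<otimes> a) = (a \<otimes> a) \<otimes> \<sigma> w" using central_commute[OF swc(2)] by simp
    also have "inv (a \<otimes> a) \<otimes> ((a \<otimes> a) \<otimes> \<sigma> w) \<otimes> inv (b \<otimes> b) = \<sigma> w \<otimes> inv (b \<otimes> b)"
      using swc(1) by simp
    also have "\<dots> = inv (b \<otimes> b) \<otimes> \<sigma> w" using central_commute[OF swc(2)] by simp
    finally have "inv (b \<otimes> b) \<otimes> w = inv (b \<otimes> b) \<otimes> \<sigma> w" unfolding ca .
    then show ?thesis using wc(1) swc(1) by simp
  qed
  \<comment> \<open>\<open>\<sigma>\<close> sends the square of \<open>a \<otimes> b\<close> to the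
    square of \<open>b \<otimes> a\<close>, which is its conjugate by \<open>a\<close>, and
    \<open>v\<close> is central.\<close>
  have sv: "\<sigma> v = v"
  proof -
    have "\<sigma> v = b \<otimes> a \<otimes> (b \<otimes> a)" using arg_cong[OF abv, of \<sigma>] by (simp add: sig_mult sig_a sig_b)
    also have "\<dots> = conj_by a ((a \<otimes> b) \<otimes> (a \<otimes> b))" by (simp add: conj_by_def m_assoc)
    also have "\<dots> = v" unfolding abv using vc by (simp add: conj_by_central)
    finally show ?thesis .
  qed
  have ex: "\<exists>k<2. x = (z1 \<otimes> z2) [^] (k::nat)" if x: "x \<in> klein" "\<sigma> x = x" for x
  proof -
    consider "x = \<one>" | "x = z1 \<otimes> z2" using klein_sig_fixed[OF e1 x] by blast
    then show ?thesis
    proof cases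
      case 1 then show ?thesis by (intro exI[of _ 0]) simp
    next
      case 2 then show ?thesis by (intro exI[of _ 1]) simp
    qed
  qed
  obtain m' where m': "m' < 2" "v = (z1 \<otimes> z2) [^] (m'::nat)" using ex[OF v(1) sv] by blast
  obtain l' where l': "l' < 2" "w = (z1 \<otimes> z2) [^] (l'::nat)" using ex[OF w(1) sw] by blast
  have "\<not> split_cyclic"
    using ns group_hom.split_cyclic_image[OF klein_rep_group_hom[OF e1]] e1 by auto
  moreover have "e \<noteq> 2" using e3 by simp
  ultimately show ?thesis
    unfolding nonmetacyclic_case_def using m' l' abv ca pq by metis
qed

end

end

lemma dichotomy:
  assumes "isobicyclic_triple G a b \<sigma> e" "e \<ge> 1"
  shows "isobicyclic_triple.metacyclic_case G a b e \<or> e \<ge> 2 \<and> isobicyclic_triple.nonmetacyclic_case G a b e"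
  using assms
proof (induction e arbitrary: G a b \<sigma>)
  case 0
  then show ?case by simp
next
  case (Suc e)
  interpret isobicyclic_triple G a b \<sigma> "Suc e" by (rule Suc.prems)
  consider "Suc e = 1" | "Suc e = 2" | "Suc e \<ge> 3" by linarith
  then show ?case
  proof cases
    case 1
    then show ?thesis using commuting_metacyclic_case base_commute by simp
  next
    case 2
    then show ?thesis using dichotomy_e2 by simp
  next
    case 3
    have "isobicyclic_triple klein_quot (klein_rep a) (klein_rep b) (klein_rep \<circ> \<sigma>) (Suc e - 1)" using klein_quot_triple by simp
    then have "isobicyclic_triple.metacyclic_case klein_quot (klein_rep a) (klein_rep b) e \<or> e \<ge> 2 \<and> isobicyclic_triple.nonmetacyclic_case klein_quot (klein_rep a) (klein_rep b) e"
      using Suc.IH 3 by simp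
    then show ?thesis using metacyclic_case_step[OF 3] nonmetacyclic_case_step[OF 3] 3 by auto
  qed
qed

section \<open>Homomorphisms from presented groups\<close>

primrec weval :: "('a, 'm) monoid_scheme \<Rightarrow> ('x \<Rightarrow> 'a) \<Rightarrow> 'x word \<Rightarrow> 'a" where
  "weval G f [] = \<one>\<^bsub>G\<^esub>"
| "weval G f (p # w) = (if snd p then f (fst p) else inv\<^bsub>G\<^esub> f (fst p)) \<otimes>\<^bsub>G\<^esub> weval G f w"

locale group_assignment = group G for G :: "('a, 'm) monoid_scheme" (structure) +
  fixes f :: "'x \<Rightarrow> 'a"
  assumes f_closed [simp]: "f x \<in> carrier G"
begin

lemma weval_closed [simp]: "weval G f w \<in> carrier G"
  by (induction w) simp_all

lemma weval_append: "weval G f (u @ v) = weval G f u \<otimes> weval G f v"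
  by (induction u) (simp_all add: m_assoc)

lemma weval_gen: "weval G f (gen x) = f x"
  by (simp add: gen_def)

lemma weval_winv: "weval G f (winv w) = inv (weval G f w)"
proof (induction w)
  case (Cons p w)
  have "winv (p # w) = winv w @ [(fst p, \<not> snd p)]" by (simp add: winv_def case_prod_beta)
  then show ?case using Cons by (simp add: weval_append inv_mult_group)
qed (simp add: winv_def)

lemma weval_wpow: "weval G f (wpow w m) = weval G f w [^] m"
proof (induction m)
  case (Suc m)
  have "wpow w (Suc m) = w @ wpow w m" by (simp add: wpow_def)
  then show ?case using Suc nat_pow_Suc2[OF weval_closed] by (metis weval_append)
qed (simp add: wpow_def)

lemma weval_wconj: "weval G f (wconj u v) = conj_by (weval G f v) (weval G f u)"
  by (simp add: wconj_def weval_append weval_winv conj_by_def m_assoc)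

lemma weval_wcomm: "weval G f (wcomm u v) =
    inv (weval G f u) \<otimes> inv (weval G f v) \<otimes> weval G f u \<otimes> weval G f v"
  by (simp add: wcomm_def weval_append weval_winv m_assoc)

lemmas weval_simps = weval_append weval_gen weval_winv weval_wpow weval_wconj weval_wcomm

lemma weval_pres_eq:
  assumes "pres_eq R u v" and "\<And>u v. (u, v) \<in> R \<Longrightarrow> weval G f u = weval G f v"
  shows "weval G f u = weval G f v"
  using assms(1) by (induction rule: pres_eq.induct) (auto simp: weval_append assms(2))

text \<open>Von Dyck's theorem: evaluation is constant on the classes of \<open>pres_eq\<close>, so
  it does not matter which word \<open>SOME\<close> picks.\<close>

lemma presented_group_hom:
  assumes "\<And>u v. (u, v) \<in> R \<Longrightarrow> weval G f u = weval G f v"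
  shows "\<exists>h \<in> hom (presented_group R) G. \<forall>w. h (pres_class R w) = weval G f w"
proof -
  define h where "h C = weval G f (SOME w. C = pres_class R w)" for C
  have h: "h (pres_class R w) = weval G f w" for w
  proof -
    have "pres_class R w = pres_class R (SOME v. pres_class R w = pres_class R v)"
      by (rule someI[of "\<lambda>v. pres_class R w = pres_class R v" w]) simp
    then show ?thesis unfolding h_def pres_class_eq_iff using weval_pres_eq[OF _ assms] by metis
  qed
  then have "h \<in> hom (presented_group R) G"
    by (auto simp: hom_def presented_group_simps presented_group_mult weval_append)
  with h show ?thesis by blast
qed

lemma is_iso_presented_group:
  assumes rel: "\<And>u v. (u, v) \<in> R \<Longrightarrow> weval G f u = weval G f v"
    and surj: "carrier G \<subseteq> range (weval G f)"
    and inj: "\<And>w. weval G f w = \<one> \<Longrightarrow> pres_eq R w []"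
  shows "G \<cong> presented_group R"
proof -
  interpret P: group "presented_group R" by (rule group_presented_group)
  obtain h where h: "h \<in> hom (presented_group R) G" "\<And>w. h (pres_class R w) = weval G f w"
    using presented_group_hom[OF rel] by blast
  interpret H: group_hom "presented_group R" G h
    using h(1) by unfold_locales
  have "inj_on h (carrier (presented_group R))"
  proof (subst H.inj_on_one_iff, intro allI impI)
    fix C assume "C \<in> carrier (presented_group R)" "h C = \<one>"
    then obtain w where "C = pres_class R w" "weval G f w = \<one>"
      using h(2) by (auto simp: presented_group_simps)
    then show "C = \<one>\<^bsub>presented_group R\<^esub>"
      using inj by (simp add: presented_group_simps pres_class_eq_iff)
  qed
  moreover have "h ` carrier (presented_group R) = carrier G"
    unfolding presented_group_simps image_image h(2) using surj by auto
  ultimately have "h \<in> iso (presented_group R) G" using h(1) by (simp add: iso_iff)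
  then show ?thesis using P.iso_sym is_isoI by blast
qed

text \<open>As every generator has a finite order dividing \<open>n\<close>, inverse letters are
  positive powers, and it suffices that \<open>S\<close> is preserved by left multiplication with
  generators.\<close>

lemma weval_mem:
  fixes n :: nat
  assumes n: "n > 0" and pow: "\<And>x. f x [^] n = \<one>"
    and one: "\<one> \<in> S" and S: "S \<subseteq> carrier G" and step: "\<And>x s. s \<in> S \<Longrightarrow> f x \<otimes> s \<in> S"
  shows "weval G f w \<in> S"
proof (induction w)
  case (Cons p w)
  have "f x [^] (k::nat) \<otimes> s \<in> S" if "s \<in> S" for x k s
    using that
  proof (induction k)
    case (Suc k)
    have "f x [^] Suc k \<otimes> s = f x \<otimes> (f x [^] k \<otimes> s)"
      using Suc.prems S nat_pow_Suc2[OF f_closed, of x k] by (metis f_closed m_assoc nat_pow_closed subsetD)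
    then show ?case using Suc step by simp
  qed (use S in auto)
  then show ?case using Cons step inv_pow_eq[OF f_closed pow n] by simp
qed (simp add: one)

end

definition pgen :: "('x word \<times> 'x word) set \<Rightarrow> 'x \<Rightarrow> 'x word set" where
  "pgen R x = pres_class R (gen x)"

lemma presented_group_assignment: "group_assignment (presented_group R) (pgen R)"
  by (intro group_assignment.intro group_presented_group group_assignment_axioms.intro)
    (simp add: presented_group_simps pgen_def)

lemma weval_presented_group: "weval (presented_group R) (pgen R) w = pres_class R w"
proof (induction w)
  case (Cons p w)
  interpret group_assignment "presented_group R" "pgen R" by (rule presented_group_assignment)
  obtain x s where p: "p = (x, s)" by (cases p)
  have "weval (presented_group R) (pgen R) [p] = pres_class R [p]"
  proof (cases s)
    case True
    then show ?thesis by (simp add: p pgen_def gen_def presented_group_mult presented_group_simps)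
  next
    case False
    have "pres_class R [p] \<otimes>\<^bsub>presented_group R\<^esub> pgen R x = \<one>\<^bsub>presented_group R\<^esub>"
      using pres_eq.cancel[of R x False]
      by (simp add: p False pgen_def gen_def presented_group_mult presented_group_simps pres_class_eq_iff)
    then have "inv\<^bsub>presented_group R\<^esub> pgen R x = pres_class R [p]"
      by (intro inv_equality) (simp_all add: presented_group_simps pgen_def)
    then show ?thesis by (simp add: p False presented_group_simps(2) presented_group_mult)
  qed
  then show ?case using weval_append[of "[p]" w] Cons by (simp add: presented_group_mult)
qed (simp add: presented_group_simps)

lemma weval_presented_group_rel:
  "(u, v) \<in> R \<Longrightarrow> weval (presented_group R) (pgen R) u = weval (presented_group R) (pgen R) v"
  by (simp add: weval_presented_group pres_class_eq_iff pres_eq.rel)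

text \<open>Distinctness of the normal forms is asked for only in \<open>G\<close>. A word that is
  trivial in \<open>G\<close> has a normal form whose exponents are multiples of \<open>n\<close> by
  \<open>indep\<close>, and \<open>pow\<close> then makes it trivial in the presented group as
  well.\<close>

lemma (in group_assignment) is_iso_presented_groupI:
  fixes n :: nat
  assumes rel: "\<And>u v. (u, v) \<in> R \<Longrightarrow> weval G f u = weval G f v"
    and pow: "pgen R p [^]\<^bsub>presented_group R\<^esub> n = \<one>\<^bsub>presented_group R\<^esub>"
      "pgen R q [^]\<^bsub>presented_group R\<^esub> n = \<one>\<^bsub>presented_group R\<^esub>"
    and normal_forms: "\<And>C. C \<in> carrier (presented_group R) \<Longrightarrow> \<exists>(i::nat) (j::nat).
      C = pgen R p [^]\<^bsub>presented_group R\<^esub> i \<otimes>\<^bsub>presented_group R\<^esub> pgen R q [^]\<^bsub>presented_group R\<^esub> j"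
    and indep: "\<And>(i::nat) (j::nat). f p [^] i \<otimes> f q [^] j = \<one> \<Longrightarrow> n dvd i \<and> n dvd j"
    and surj: "\<And>x. x \<in> carrier G \<Longrightarrow> \<exists>(i::nat) (j::nat). x = f p [^] i \<otimes> f q [^] j"
  shows "G \<cong> presented_group R"
proof (rule is_iso_presented_group[OF rel])
  interpret P: group_assignment "presented_group R" "pgen R" by (rule presented_group_assignment)
  let ?w = "\<lambda>i j. wpow (gen p) i @ wpow (gen q) j"
  have w: "weval G f (?w i j) = f p [^] i \<otimes> f q [^] j" for i j by (simp add: weval_simps)
  have Pw: "pres_class R (?w i j) = pgen R p [^]\<^bsub>presented_group R\<^esub> i \<otimes>\<^bsub>presented_group R\<^esub>
      pgen R q [^]\<^bsub>presented_group R\<^esub> j" for i j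
    by (simp add: P.weval_simps flip: weval_presented_group)
  show "carrier G \<subseteq> range (weval G f)"
    using surj w by (metis (no_types, lifting) rangeI subsetI)
  fix v assume v: "weval G f v = \<one>"
  have "pres_class R v \<in> carrier (presented_group R)" by (simp add: presented_group_simps)
  then obtain i j where ij: "pres_class R v = pres_class R (?w i j)" using normal_forms unfolding Pw by blast
  then have "weval G f v = f p [^] i \<otimes> f q [^] j"
    unfolding pres_class_eq_iff using weval_pres_eq[OF _ rel] w by metis
  then have "n dvd i" "n dvd j" using indep v by metis+
  moreover have "pgen R x [^]\<^bsub>presented_group R\<^esub> k = \<one>\<^bsub>presented_group R\<^esub>"
    if k: "n dvd k" "pgen R x [^]\<^bsub>presented_group R\<^esub> n = \<one>\<^bsub>presented_group R\<^esub>" for x k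
  proof -
    obtain c where "k = n * c" using k(1) by blast
    then show ?thesis using P.nat_pow_pow[OF P.f_closed, of x n c] k(2) by simp
  qed
  ultimately have "pres_class R v = \<one>\<^bsub>presented_group R\<^esub>"
    unfolding ij Pw using pow by simp
  then show "pres_eq R v []" by (simp add: presented_group_simps pres_class_eq_iff)
qed

section \<open>Isobicyclic and metacyclic groups in terms of elements\<close>

lemma isobicyclic_imp_triple:
  fixes G :: "('a, 'm) monoid_scheme" (structure)
  assumes "isobicyclic (2 ^ e) G"
  shows "\<exists>a b \<sigma>. isobicyclic_triple G a b \<sigma> e"
proof -
  interpret group G using assms by (simp add: isobicyclic_def)
  obtain a b \<sigma> where ab: "a \<in> carrier G" "b \<in> carrier G" and ord: "ord a = 2 ^ e" "ord b = 2 ^ e"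
    and prod: "carrier G = generate G {a} <#> generate G {b}"
    and int: "generate G {a} \<inter> generate G {b} = {\<one>}"
    and sig: "\<sigma> \<in> iso G G" "\<sigma> a = b" "\<sigma> b = a"
    using assms unfolding isobicyclic_def by blast
  have fin: "finite (carrier G)" using assms by (simp add: isobicyclic_def)
  have gen: "generate G {x} = {x [^] (k::nat) | k. True}" if "x \<in> carrier G" for x
    using generate_pow_on_finite_carrier[OF fin that] by simp
  have "isobicyclic_triple G a b \<sigma> e"
  proof
    fix x assume "x \<in> carrier G"
    then show "\<exists>(i::nat) (j::nat). x = a [^] i \<otimes> b [^] j"
      unfolding prod gen[OF ab(1)] gen[OF ab(2)] set_mult_def by blast
  next
    fix i j :: nat
    show "a [^] i \<otimes> b [^] j = \<one> \<longleftrightarrow> 2 ^ e dvd i \<and> 2 ^ e dvd j"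
    proof
      assume eq: "a [^] i \<otimes> b [^] j = \<one>"
      then have "a [^] i = inv (b [^] j)" using ab by (metis inv_equality inv_closed inv_inv nat_pow_closed)
      also have "\<dots> \<in> generate G {b}"
        using ab gen[OF ab(2)] generate_is_subgroup[of "{b}"] by (intro subgroup.m_inv_closed) auto
      finally have "a [^] i \<in> generate G {a} \<inter> generate G {b}" using gen[OF ab(1)] by auto
      then have "a [^] i = \<one>" unfolding int by simp
      moreover from this have "b [^] j = \<one>" using eq ab by simp
      ultimately show "2 ^ e dvd i \<and> 2 ^ e dvd j" using pow_eq_id ab ord by metis
    next
      assume "2 ^ e dvd i \<and> 2 ^ e dvd j"
      then show "a [^] i \<otimes> b [^] j = \<one>" using ab ord pow_eq_id[of a i] pow_eq_id[of b j] by simp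
    qed
  qed (use ab sig in \<open>auto simp: iso_def\<close>)
  then show ?thesis by blast
qed

lemma (in group) metacyclic_split_cyclic:
  assumes "metacyclic G" shows split_cyclic
proof -
  obtain N where N: "N \<lhd> G" "cyclic_group (G\<lparr>carrier := N\<rparr>)" "cyclic_group (G Mod N)"
    using assms unfolding metacyclic_def by blast
  interpret N: normal N G by (rule N(1))
  obtain x where x: "x \<in> N" "N = range (\<lambda>n::int. x [^]\<^bsub>G\<lparr>carrier := N\<rparr>\<^esub> n)"
    using N(2) group.cyclic_group[OF N.subgroup_is_group[OF is_group]] by auto
  have xN: "\<exists>i::int. g = x [^] i" if "g \<in> N" for g
    using that x int_pow_consistent[OF N.is_subgroup x(1)] by auto
  have xc: "x \<in> carrier G" using x N.subset by auto
  obtain C where C: "C \<in> carrier (G Mod N)" "carrier (G Mod N) = range (\<lambda>n::int. C [^]\<^bsub>G Mod N\<^esub> n)"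
    using N(3) group.cyclic_group[OF N.factorgroup_is_group] by auto
  then obtain y where y: "y \<in> carrier G" "C = N #> y"
    by (auto simp: FactGroup_def RCOSETS_def)
  have hom: "(\<lambda>g. N #> g) \<in> hom G (G Mod N)" by (rule N.r_coset_hom_Mod)
  interpret H: group_hom G "G Mod N" "\<lambda>g. N #> g"
    using hom N.factorgroup_is_group by (simp add: group_hom_def group_hom_axioms_def is_group)
  show ?thesis
    unfolding split_cyclic_def
  proof (rule bexI[OF _ xc], rule bexI[OF _ y(1)], intro conjI ballI)
    fix g assume g: "g \<in> carrier G"
    show "\<exists>i::int. conj_by g x = x [^] i"
      unfolding conj_by_def using xN N.inv_op_closed1[OF g x(1)] by blast
    have "N #> g \<in> carrier (G Mod N)" using g by (rule H.hom_closed)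
    then obtain j :: int where "N #> g = C [^]\<^bsub>G Mod N\<^esub> j" using C by auto
    also have "\<dots> = N #> (y [^] j)" using y by (simp add: H.hom_int_pow)
    finally have "g \<in> N #> (y [^] j)" using rcos_self[OF g N.is_subgroup] by simp
    then obtain h where "h \<in> N" "g = h \<otimes> y [^] j" unfolding r_coset_def by blast
    then show "\<exists>(i::int) (j::int). g = x [^] i \<otimes> y [^] j" using xN by blast
  qed
qed

section \<open>The metacyclic groups\<close>

text \<open>Squaring \<open>1 + 2 ^ s * q'\<close> with \<open>q'\<close> odd and
  \<open>s \<ge> 2\<close> raises the 2-adic valuation of the difference from 1 by exactly one: the
  square term adds an even number to the odd factor.\<close>

lemma one_plus_pow2_power:
  fixes r :: nat
  assumes r: "r = 1 + 2 ^ f * q" "odd q" and f: "f \<ge> 2"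
  shows "\<exists>q'. odd q' \<and> r ^ (2 ^ i) = 1 + 2 ^ (f + i) * q'"
proof (induction i)
  case 0
  then show ?case using r by auto
next
  case (Suc i)
  then obtain q' where q': "odd q'" "r ^ (2 ^ i) = 1 + 2 ^ (f + i) * q'" by blast
  obtain g where g: "f + i = Suc g" "g \<ge> 1" using f by (metis Suc_diff_1 Suc_le_D add_Suc le_add1 le_trans numeral_2_eq_2 One_nat_def Suc_le_mono)
  have "r ^ (2 ^ Suc i) = (r ^ (2 ^ i))\<^sup>2"
    by (simp add: mult.commute flip: power_mult)
  also have "\<dots> = (1 + 2 ^ (f + i) * q')\<^sup>2" unfolding q'(2) ..
  also have "\<dots> = 1 + 2 ^ (f + Suc i) * (q' + 2 ^ g * q'\<^sup>2)"
    by (simp add: g power2_eq_square algebra_simps)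
  finally show ?case using q'(1) g(2) by (intro exI[of _ "q' + 2 ^ g * q'\<^sup>2"]) auto
qed

text \<open>The exponent \<open>u\<close> is corrected one binary digit at a time. If it fails at
  the next modulus, it is off by an odd multiple of \<open>2 ^ k\<close>; adding
  \<open>2 ^ (d + 1)\<close> to \<open>u\<close> adds another odd multiple of \<open>2 ^ k\<close>,
  by \<open>one_plus_pow2_power\<close>, and the two sum to an even multiple. As
  \<open>d + 1 \<ge> 1\<close>, \<open>u\<close> stays odd.\<close>

lemma odd_power_cong:
  fixes r :: nat
  assumes r: "r = 1 + 2 ^ f * q" "odd q" and f: "f \<ge> 2" and ef: "e > f"
  shows "\<exists>u. odd u \<and> [r ^ u = 1 + 2 ^ f] (mod 2 ^ e)"
proof -
  have "\<exists>u. odd u \<and> [r ^ u = 1 + 2 ^ f] (mod 2 ^ (f + 1 + d))" for d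
  proof (induction d)
    case 0
    obtain p where "q = 2 * p + 1" using r(2) by (rule oddE)
    then have "r = 1 + 2 ^ f + 2 ^ (f + 1) * p" using r(1) by (simp add: algebra_simps)
    then show ?case by (intro exI[of _ 1]) (simp add: cong_def)
  next
    case (Suc d)
    define k where "k = f + 1 + d"
    have k: "k = f + (d + 1)" "k \<ge> 1" by (simp_all add: k_def)
    obtain u where u: "odd u" "[r ^ u = 1 + 2 ^ f] (mod 2 ^ k)" using Suc k_def by blast
    show ?case
    proof (cases "[r ^ u = 1 + 2 ^ f] (mod 2 ^ Suc k)")
      case True
      then show ?thesis using u by (auto simp: k_def)
    next
      case False
      have int_u: "[int (r ^ u) = int (1 + 2 ^ f)] (mod 2 ^ k)"
        using u(2) by (metis cong_int_iff of_nat_numeral of_nat_power)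
      then have "2 ^ k dvd int (r ^ u) - int (1 + 2 ^ f)" by (simp only: cong_iff_dvd_diff)
      then obtain c where "int (r ^ u) - int (1 + 2 ^ f) = 2 ^ k * c" by (rule dvdE)
      then have c: "int (r ^ u) = int (1 + 2 ^ f) + 2 ^ k * c" by simp
      have "odd c"
      proof
        assume "even c"
        then obtain c' where "c = 2 * c'" by blast
        then have "[int (r ^ u) = int (1 + 2 ^ f)] (mod 2 ^ Suc k)"
          unfolding cong_iff_dvd_diff c by simp
        then show False using False by (metis cong_int_iff of_nat_numeral of_nat_power)
      qed
      obtain q' where q': "odd q'" "r ^ (2 ^ (d + 1)) = 1 + 2 ^ k * q'"
        using one_plus_pow2_power[OF r f, of "d + 1"] k by auto
      have "odd (int (r ^ u))" using r f by simp
      then have "even (c + int (r ^ u) * int q')" using \<open>odd c\<close> q'(1) by simp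
      then obtain s where s: "c + int (r ^ u) * int q' = 2 * s" by blast
      have "r ^ (u + 2 ^ (d + 1)) = r ^ u + 2 ^ k * (r ^ u * q')"
        unfolding power_add[of r u "2 ^ (d + 1)"] q'(2) by (simp add: algebra_simps)
      then have "int (r ^ (u + 2 ^ (d + 1))) = int (r ^ u) + 2 ^ k * (int (r ^ u) * int q')"
        by simp
      also have "\<dots> = int (1 + 2 ^ f) + 2 ^ k * (c + int (r ^ u) * int q')"
        by (subst c) (simp add: algebra_simps)
      also have "\<dots> = int (1 + 2 ^ f) + 2 ^ Suc k * s" unfolding s by simp
      finally have "[int (r ^ (u + 2 ^ (d + 1))) = int (1 + 2 ^ f)] (mod 2 ^ Suc k)"
        unfolding cong_iff_dvd_diff by simp
      then have "[r ^ (u + 2 ^ (d + 1)) = 1 + 2 ^ f] (mod 2 ^ Suc k)"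
        by (metis cong_int_iff of_nat_numeral of_nat_power)
      moreover have "odd (u + 2 ^ (d + 1))" using u(1) by simp
      moreover have "Suc k = f + 1 + Suc d" by (simp add: k_def)
      ultimately show ?thesis by metis
    qed
  qed
  from this[of "e - f - 1"] show ?thesis using ef by simp
qed

text \<open>If \<open>r\<close> is congruent to 1, then \<open>f = e\<close>, since
  \<open>2 ^ e\<close> vanishes; otherwise \<open>f\<close> is the 2-adic valuation of
  \<open>r - 1\<close>. Replacing \<open>a\<close> by \<open>a [^] u\<close> replaces
  \<open>r\<close> by \<open>r ^ u\<close>, which brings the conjugation relation into the form used
  in \<open>G1\<close>.\<close>

lemma ex_odd_power_cong:
  fixes r :: nat
  assumes r: "r mod 4 = 1" and e: "e \<ge> 2"
  shows "\<exists>f u. f \<in> {2..e} \<and> odd u \<and> [r ^ u = 1 + 2 ^ f] (mod 2 ^ e)"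
proof (cases "[r = 1] (mod 2 ^ e)")
  case True
  then have "[r ^ 1 = 1 + 2 ^ e] (mod 2 ^ e)"
    unfolding cong_def by (simp only: power_one_right mod_add_self2)
  moreover have "e \<in> {2..e}" using e by simp
  ultimately show ?thesis using odd_one by blast
next
  case False
  have r1: "r \<ge> 1" using r by (cases r) auto
  have "r - 1 \<noteq> 0" using False r1 by (metis cong_refl diff_is_0_eq le_antisym)
  then obtain f q where fq: "r - 1 = 2 ^ f * q" "odd q"
    by (metis dvd_def mult.commute multiplicity_decompose' not_is_unit_0 zero_less_iff_neq_zero
        odd_one prime_nat_iff two_is_prime_nat)
  then have rq: "r = 1 + 2 ^ f * q" using r1 by simp
  have "4 dvd r - 1" using r r1 by presburger
  have f: "f \<ge> 2"
  proof (rule ccontr)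
    assume "\<not> f \<ge> 2"
    then have "f = 0 \<or> f = 1" by auto
    then show False using \<open>4 dvd r - 1\<close> fq by (auto elim!: dvdE oddE) presburger+
  qed
  have "\<not> 2 ^ e dvd 2 ^ f * q"
    using False r1 unfolding fq(1)[symmetric] by (metis cong_altdef_nat cong_sym)
  then have "f < e" by (metis dvd_mult2 le_imp_power_dvd linorder_not_less)
  then show ?thesis using odd_power_cong[OF rq fq(2) f] f by (meson atLeastAtMost_iff less_imp_le_nat)
qed

lemma (in group) conj_by_power:
  assumes "g \<in> carrier G" "h \<in> carrier G" "conj_by g h = h [^] (r::nat)"
  shows "conj_by (g [^] (i::nat)) h = h [^] (r ^ i)"
proof (induction i)
  case 0
  then show ?case using assms by (simp add: conj_by_def)
next
  case (Suc i)
  have "conj_by (g [^] Suc i) h = conj_by g (conj_by (g [^] i) h)" using assms by (simp add: conj_by_conj_by)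
  also have "\<dots> = h [^] (r ^ Suc i)" using assms by (simp add: Suc conj_by_pow nat_pow_pow)
  finally show ?case .
qed

definition G1_rel :: "nat \<Rightarrow> nat \<Rightarrow> (gen2 word \<times> gen2 word) set" where
  "G1_rel e f = {(wpow (gen GenX) (2 ^ e), []), (wpow (gen GenY) (2 ^ e), []),
     (wconj (gen GenX) (gen GenY), wpow (gen GenX) (1 + 2 ^ f))}"

lemma G1_eq: "G1 e f = presented_group (G1_rel e f)"
  by (simp add: G1_def G1_rel_def Let_def)

lemma (in group_assignment) G1_normal_form:
  fixes n r :: nat
  assumes n: "n > 0" and pow: "\<And>x. f x [^] n = \<one>" and r: "conj_by (f p) (f q) = f q [^] r"
    and univ: "\<And>x. x = p \<or> x = q"
  shows "\<exists>(i::nat) (j::nat). weval G f w = f p [^] i \<otimes> f q [^] j"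
proof -
  define S where "S = {f p [^] i \<otimes> f q [^] j | (i::nat) (j::nat). True}"
  have "weval G f w \<in> S"
  proof (rule weval_mem[OF n pow])
    have "\<one> = f p [^] (0::nat) \<otimes> f q [^] (0::nat)" by simp
    then show "\<one> \<in> S" unfolding S_def by blast
    show "S \<subseteq> carrier G" by (auto simp: S_def)
    fix x s assume "s \<in> S"
    then obtain i j :: nat where s: "s = f p [^] i \<otimes> f q [^] j" unfolding S_def by blast
    have "f p \<otimes> s = f p [^] Suc i \<otimes> f q [^] j"
      unfolding s nat_pow_Suc2[OF f_closed] by (simp add: m_assoc)
    then have "f p \<otimes> s \<in> S" unfolding S_def by blast
    moreover
    have "f q \<otimes> s = f p [^] i \<otimes> f q [^] (r ^ i + j)"
    proof -
      have "f q \<otimes> f p [^] i = f p [^] i \<otimes> f q [^] (r ^ i)"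
        using conj_by_power[OF f_closed f_closed r, of i] by (simp add: conj_by_eq_iff)
      then have "f q \<otimes> s = f p [^] i \<otimes> f q [^] (r ^ i) \<otimes> f q [^] j"
        unfolding s by (simp flip: m_assoc)
      then show ?thesis by (simp add: m_assoc nat_pow_mult)
    qed
    then have "f q \<otimes> s \<in> S" unfolding S_def by blast
    ultimately show "f x \<otimes> s \<in> S" using univ[of x] by auto
  qed
  then show ?thesis unfolding S_def by blast
qed

context isobicyclic_triple
begin

context
  fixes r :: nat
  assumes e2: "e \<ge> 2" and r4: "r mod 4 = 1" and r: "conj_by a ab_quot = ab_quot [^] r"
    and hz: "ab_quot [^] (2 ^ (e - 1) :: nat) = z1 \<otimes> z2"
begin

lemma ab_quot_pow: "ab_quot [^] (2 ^ e :: nat) = \<one>"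
proof -
  have "(2::nat) ^ e = 2 ^ (e - 1) + 2 ^ (e - 1)" using e2 by (cases e) auto
  then have "ab_quot [^] (2 ^ e :: nat) = ab_quot [^] (2 ^ (e - 1) :: nat) \<otimes> ab_quot [^] (2 ^ (e - 1) :: nat)"
    by (simp add: nat_pow_mult)
  also have "\<dots> = \<one>" unfolding hz by (rule klein_sq) (use e2 z_in_klein in auto)
  finally show ?thesis .
qed

lemma ab_quot_commute_pow: "ab_quot [^] (s::nat) \<otimes> a [^] (i::nat) = a [^] i \<otimes> ab_quot [^] (r ^ i * s)"
proof -
  have "conj_by (a [^] i) (ab_quot [^] s) = ab_quot [^] (r ^ i * s)"
    by (simp add: conj_by_pow conj_by_power[OF a_in ab_quot_in r] nat_pow_pow)
  then show ?thesis by (simp add: conj_by_eq_iff)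
qed

text \<open>\<open>b\<close> is \<open>a \<otimes> ab_quot\<close>, and collecting the powers of
  \<open>a\<close> on the left in \<open>b [^] j\<close> leaves a power of
  \<open>ab_quot\<close>.\<close>

lemma a_ab_quot_factor:
  assumes "x \<in> carrier G" shows "\<exists>(i::nat) (j::nat). x = a [^] i \<otimes> ab_quot [^] j"
proof -
  have "\<exists>s::nat. b [^] j = a [^] j \<otimes> ab_quot [^] s" for j :: nat
  proof (induction j)
    case 0
    show ?case by (intro exI[of _ 0]) simp
  next
    case (Suc j)
    then obtain s :: nat where s: "b [^] j = a [^] j \<otimes> ab_quot [^] s" by blast
    have "b [^] Suc j = a [^] j \<otimes> (ab_quot [^] s \<otimes> a [^] Suc 0) \<otimes> ab_quot"
      by (simp add: s m_assoc) (simp add: a_ab_quot)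
    also have "\<dots> = a [^] Suc j \<otimes> ab_quot [^] Suc (r ^ Suc 0 * s)"
      unfolding ab_quot_commute_pow by (simp add: m_assoc)
    finally show ?case by blast
  qed
  moreover obtain i j :: nat where "x = a [^] i \<otimes> b [^] j" using factor assms by blast
  ultimately obtain s :: nat where "x = a [^] i \<otimes> (a [^] j \<otimes> ab_quot [^] s)" by metis
  then have "x = a [^] (i + j) \<otimes> ab_quot [^] s" by (simp add: m_assoc flip: nat_pow_mult)
  then show ?thesis by blast
qed

text \<open>The converse counting to \<open>pow_generates\<close>: the reduced products exhaust a
  group whose order is their number, so no two of them coincide.\<close>

lemma a_ab_quot_indep:
  assumes "a [^] (i::nat) \<otimes> ab_quot [^] (j::nat) = \<one>"
  shows "2 ^ e dvd i \<and> 2 ^ e dvd j"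
proof -
  let ?f = "\<lambda>(i::nat, j::nat). a [^] i \<otimes> ab_quot [^] j" and ?D = "{..<2 ^ e :: nat} \<times> {..<2 ^ e :: nat}"
  have red: "a [^] i \<otimes> ab_quot [^] j = ?f (i mod 2 ^ e, j mod 2 ^ e)" for i j :: nat
    by (simp add: pow_mod a_pow ab_quot_pow)
  have "carrier G \<subseteq> ?f ` ?D"
  proof
    fix x assume "x \<in> carrier G"
    then obtain i j :: nat where "x = a [^] i \<otimes> ab_quot [^] j" using a_ab_quot_factor by blast
    then have "x = ?f (i mod 2 ^ e, j mod 2 ^ e)" using red by metis
    then show "x \<in> ?f ` ?D" by (rule image_eqI) simp
  qed
  moreover have "?f ` ?D \<subseteq> carrier G" by auto
  ultimately have "?f ` ?D = carrier G" by blast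
  then have "inj_on ?f ?D"
    by (intro eq_card_imp_inj_on) (simp_all add: card_carrier)
  moreover have "?f (i mod 2 ^ e, j mod 2 ^ e) = ?f (0, 0)"
    unfolding red[symmetric] by (simp add: assms)
  ultimately have "(i mod 2 ^ e, j mod 2 ^ e) = (0, 0)"
    by (rule inj_onD) simp_all
  then show ?thesis by (simp add: mod_eq_0_iff_dvd)
qed

lemma metacyclic_case_iso: "\<exists>f \<in> {2..e}. G \<cong> G1 e f"
proof -
  obtain f u where f: "f \<in> {2..e}" and u: "odd u" "[r ^ u = 1 + 2 ^ f] (mod 2 ^ e)"
    using ex_odd_power_cong[OF r4 e2] by blast
  \<comment> \<open>The normal generator is \<open>ab_quot\<close>; the power \<open>u\<close> of
    \<open>a\<close> normalises the conjugation exponent to \<open>1 + 2 ^ f\<close>.\<close>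
  define g where "g = case_gen2 ab_quot (a [^] u)"
  have gX: "g GenX = ab_quot" "g GenY = a [^] u" by (simp_all add: g_def)
  interpret A: group_assignment G g
    by unfold_locales (simp add: g_def split: gen2.split)
  have n: "(2::nat) ^ e > 0" by simp
  have cop: "coprime u (2 ^ e)" using u(1) by simp
  have conj_by: "conj_by (a [^] u) ab_quot = ab_quot [^] (1 + 2 ^ f :: nat)"
    unfolding conj_by_power[OF a_in ab_quot_in r] by (rule pow_cong[OF ab_quot_in ab_quot_pow u(2)])
  have gen2: "x = GenY \<or> x = GenX" for x by (cases x) auto
  let ?R = "G1_rel e f" and ?P = "presented_group (G1_rel e f)"
  interpret P: group_assignment "?P" "pgen ?R" by (rule presented_group_assignment)
  have rel: "weval (?P) (pgen ?R) v = weval (?P) (pgen ?R) w"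
    if "(v, w) \<in> ?R" for v w using weval_presented_group_rel[OF that] .
  have mem: "(wpow (gen x) (2 ^ e), []) \<in> ?R"
    "(wconj (gen GenX) (gen GenY), wpow (gen GenX) (1 + 2 ^ f)) \<in> ?R" for x
    by (cases x; simp add: G1_rel_def)+
  have Ppow: "pgen ?R x [^]\<^bsub>?P\<^esub> (2 ^ e :: nat) = \<one>\<^bsub>?P\<^esub>" for x
    using rel[OF mem(1)] unfolding P.weval_simps weval.simps .
  have Pcj: "P.conj_by (pgen ?R GenY) (pgen ?R GenX) = pgen ?R GenX [^]\<^bsub>?P\<^esub> (1 + 2 ^ f :: nat)"
    using rel[OF mem(2)] unfolding P.weval_simps .
  have "G \<cong> ?P"
  proof (rule A.is_iso_presented_groupI[where n = "2 ^ e" and p = GenY and q = GenX])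
    fix v w assume "(v, w) \<in> ?R"
    moreover have "(a [^] u) [^] (2 ^ e :: nat) = \<one>"
      using nat_pow_pow[OF a_in] a_pow_eq_one by simp
    ultimately show "weval G g v = weval G g w"
      unfolding G1_rel_def using conj_by by (auto simp only: A.weval_simps gX ab_quot_pow weval.simps prod.inject empty_iff insert_iff)
  next
    fix C assume "C \<in> carrier (?P)"
    then obtain w where "C = weval (?P) (pgen ?R) w"
      by (auto simp: presented_group_simps weval_presented_group)
    then show "\<exists>(i::nat) (j::nat). C = pgen ?R GenY [^]\<^bsub>?P\<^esub> i
        \<otimes>\<^bsub>?P\<^esub> pgen ?R GenX [^]\<^bsub>?P\<^esub> j"
      using P.G1_normal_form[OF n Ppow Pcj gen2] by blast
  next
    fix i j :: nat
    assume "g GenY [^] i \<otimes> g GenX [^] j = \<one>"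
    then have "2 ^ e dvd u * i" "2 ^ e dvd j"
      using a_ab_quot_indep unfolding gX nat_pow_pow[OF a_in] by blast+
    then show "2 ^ e dvd i \<and> 2 ^ e dvd j"
      using cop by (metis coprime_commute coprime_dvd_mult_right_iff)
  next
    fix x assume "x \<in> carrier G"
    then obtain i j :: nat where x: "x = a [^] i \<otimes> ab_quot [^] j" using a_ab_quot_factor by blast
    \<comment> \<open>\<open>u\<close> is odd, so \<open>a [^] u\<close> generates the same cyclic
      group as \<open>a\<close>.\<close>
    obtain u' where u': "[u * u' = 1] (mod 2 ^ e)" using cong_solve_coprime_nat[OF cop] by auto
    have "[u * (u' * i) = i] (mod 2 ^ e)"
      using cong_mult[OF u' cong_refl[of i]] by (simp add: mult.assoc)
    then have "a [^] i = (a [^] u) [^] (u' * i)"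
      unfolding nat_pow_pow[OF a_in] using pow_cong[OF a_in a_pow] by metis
    then show "\<exists>(i::nat) (j::nat). x = g GenY [^] i \<otimes> g GenX [^] j"
      unfolding gX x by metis
  qed (use Ppow in auto)
  then show ?thesis using f unfolding G1_eq by blast
qed

lemma metacyclic_case_metacyclic: "metacyclic G"
proof -
  define H where "H = generate G {ab_quot}"
  have H: "H = range (\<lambda>k::int. ab_quot [^] k)" unfolding H_def using generate_pow[OF ab_quot_in] by auto
  have sub: "subgroup H G" unfolding H_def by (rule generate_is_subgroup) simp
  have pow_H: "ab_quot [^] (k::nat) \<in> H" for k unfolding H by (metis int_pow_int rangeI)
  have nat_H: "\<exists>k::nat. h = ab_quot [^] k" if "h \<in> H" for h
    using that generate_pow_on_finite_carrier[OF finite_carrier ab_quot_in] unfolding H_def by auto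
  have xhq: "x \<otimes> ab_quot [^] (k::nat) \<otimes> inv x \<in> H" if x: "x \<in> carrier G" for x k
  proof -
    \<comment> \<open>\<open>conj_by\<close> puts the inverse on the left, so the element to be
      factored is \<open>inv x\<close>.\<close>
    obtain i j :: nat where ij: "inv x = a [^] i \<otimes> ab_quot [^] j" using a_ab_quot_factor x by blast
    have "x \<otimes> ab_quot [^] k \<otimes> inv x = conj_by (inv x) (ab_quot [^] k)" using x by (simp add: conj_by_def)
    also have "\<dots> = conj_by (ab_quot [^] j) (conj_by (a [^] i) (ab_quot [^] k))" by (simp add: ij conj_by_conj_by)
    also have "\<dots> = conj_by (ab_quot [^] j) (ab_quot [^] (r ^ i * k))"
      by (simp add: conj_by_pow conj_by_power[OF a_in ab_quot_in r] nat_pow_pow)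
    also have "\<dots> = ab_quot [^] (r ^ i * k)" by (simp add: conj_by_eq_iff nat_pow_comm)
    finally show ?thesis using pow_H by simp
  qed
  have nor: "H \<lhd> G"
    using normalI sub nat_H xhq unfolding normal_inv_iff by (metis)
  interpret N: normal H G by (rule nor)
  have "cyclic_group (subgroup_generated G {ab_quot})" by (rule cyclic_group_generated)
  then have cyc: "cyclic_group (G\<lparr>carrier := H\<rparr>)" by (simp add: subgroup_generated_def H_def)
  interpret M: group_hom G "G Mod H" "\<lambda>g. H #> g"
    using N.r_coset_hom_Mod N.factorgroup_is_group by (simp add: group_hom_def group_hom_axioms_def is_group)
  have "carrier (G Mod H) = range (\<lambda>k::int. (H #> a) [^]\<^bsub>G Mod H\<^esub> k)"
  proof
    show "carrier (G Mod H) \<subseteq> range (\<lambda>k::int. (H #> a) [^]\<^bsub>G Mod H\<^esub> k)"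
    proof
      fix C assume "C \<in> carrier (G Mod H)"
      then obtain x where x: "x \<in> carrier G" "C = H #> x" by (auto simp: FactGroup_def RCOSETS_def)
      obtain i j :: nat where ij: "x = a [^] i \<otimes> ab_quot [^] j" using a_ab_quot_factor x by blast
      have hj: "H #> ab_quot [^] j = \<one>\<^bsub>G Mod H\<^esub>" using coset_join2[OF _ sub pow_H] by (simp add: FactGroup_def)
      have "C = (H #> a [^] i) \<otimes>\<^bsub>G Mod H\<^esub> (H #> ab_quot [^] j)"
        unfolding x ij by (rule M.hom_mult) simp_all
      also have "\<dots> = H #> a [^] i"
        by (simp only: hj M.H.r_one M.hom_closed nat_pow_closed a_in)
      also have "\<dots> = (H #> a) [^]\<^bsub>G Mod H\<^esub> i" by (rule M.hom_nat_pow) simp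
      finally have "C = (H #> a) [^]\<^bsub>G Mod H\<^esub> i" .
      then show "C \<in> range (\<lambda>k::int. (H #> a) [^]\<^bsub>G Mod H\<^esub> k)" by (metis int_pow_int rangeI)
    qed
    show "range (\<lambda>k::int. (H #> a) [^]\<^bsub>G Mod H\<^esub> k) \<subseteq> carrier (G Mod H)"
      using M.H.int_pow_closed[OF M.hom_closed[OF a_in]] by blast
  qed
  then have "cyclic_group (G Mod H)" using M.H.cyclic_group M.hom_closed[OF a_in] by blast
  then show ?thesis unfolding metacyclic_def using is_group nor cyc by blast
qed

end

end

section \<open>The nonmetacyclic groups\<close>

text \<open>
  The assumption \<open>centralI\<close> stands in for generation by $a$ and $b$.  For $e = 2$ the
  element $z_1$ is $a^2$ itself, so it commutes with $b$ only if $l = 0$.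
\<close>

locale G2_pair = group G for G :: "('a, 'm) monoid_scheme" (structure) +
  fixes a b :: 'a and e l :: nat
  assumes a_in [simp]: "a \<in> carrier G" and b_in [simp]: "b \<in> carrier G"
    and e2: "e \<ge> 2" and el: "e \<ge> 3 \<or> l = 0"
    and a_pow: "a [^] (2 ^ e :: nat) = \<one>" and b_pow: "b [^] (2 ^ e :: nat) = \<one>"
    and pq: "(b \<otimes> b) \<otimes> (a \<otimes> a) = (a \<otimes> a) \<otimes> (b \<otimes> b)"
    and cja: "conj_by a (b \<otimes> b) = inv (b \<otimes> b) \<otimes> (a [^] (2 ^ (e - 1) :: nat) \<otimes> b [^] (2 ^ (e - 1) :: nat)) [^] l"
    and cjb: "conj_by b (a \<otimes> a) = inv (a \<otimes> a) \<otimes> (a [^] (2 ^ (e - 1) :: nat) \<otimes> b [^] (2 ^ (e - 1) :: nat)) [^] l"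
    and centralI: "w \<in> carrier G \<Longrightarrow> w \<otimes> a = a \<otimes> w \<Longrightarrow> w \<otimes> b = b \<otimes> w \<Longrightarrow> central w"
begin

definition "z1 = a [^] (2 ^ (e - 1) :: nat)"
definition "z2 = b [^] (2 ^ (e - 1) :: nat)"
definition "z = z1 \<otimes> z2"

lemma z_in [simp]: "z1 \<in> carrier G" "z2 \<in> carrier G" "z \<in> carrier G"
  by (simp_all add: z1_def z2_def z_def)

lemmas conj_by_z = cja[folded z1_def z2_def, folded z_def] cjb[folded z1_def z2_def, folded z_def]

lemma z_pow_half: "z1 = (a \<otimes> a) [^] (2 ^ (e - 2) :: nat)" "z2 = (b \<otimes> b) [^] (2 ^ (e - 2) :: nat)"
proof -
  have "e - 1 = Suc (e - 2)" using e2 by simp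
  then have *: "(2::nat) ^ (e - 1) = 2 * 2 ^ (e - 2)" by simp
  have sq: "x \<otimes> x = x [^] (2::nat)" if "x \<in> carrier G" for x using that by (simp add: numeral_2_eq_2)
  show "z1 = (a \<otimes> a) [^] (2 ^ (e - 2) :: nat)" "z2 = (b \<otimes> b) [^] (2 ^ (e - 2) :: nat)"
    unfolding z1_def z2_def * by (simp_all add: sq nat_pow_pow)
qed

lemma z_sq1: "z1 \<otimes> z1 = \<one>" "z2 \<otimes> z2 = \<one>"
proof -
  have "e = Suc (e - 1)" using e2 by simp
  then have *: "(2::nat) ^ e = 2 ^ (e - 1) + 2 ^ (e - 1)" by (metis mult_2 power_Suc)
  show "z1 \<otimes> z1 = \<one>" "z2 \<otimes> z2 = \<one>"
    using a_pow b_pow unfolding * z1_def z2_def by (simp_all add: nat_pow_mult)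
qed

lemma z1_p: "z1 \<otimes> (a \<otimes> a) = (a \<otimes> a) \<otimes> z1" and z1_q: "z1 \<otimes> (b \<otimes> b) = (b \<otimes> b) \<otimes> z1"
  and z2_p: "z2 \<otimes> (a \<otimes> a) = (a \<otimes> a) \<otimes> z2" and z2_q: "z2 \<otimes> (b \<otimes> b) = (b \<otimes> b) \<otimes> z2"
  unfolding z_pow_half by (rule group_commutes_pow; simp add: pq)+

lemma z1_z2: "z1 \<otimes> z2 = z2 \<otimes> z1"
  unfolding z_pow_half(1) by (rule group_commutes_pow) (simp_all add: z2_p)

lemma z_sq: "z \<otimes> z = \<one>"
proof -
  have "z \<otimes> z = z1 \<otimes> (z2 \<otimes> z1) \<otimes> z2" by (simp add: z_def m_assoc)
  also have "\<dots> = (z1 \<otimes> z1) \<otimes> (z2 \<otimes> z2)" unfolding z1_z2[symmetric] by (simp add: m_assoc)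
  finally show ?thesis by (simp add: z_sq1)
qed

lemma z_p: "z \<otimes> (a \<otimes> a) = (a \<otimes> a) \<otimes> z" and z_q: "z \<otimes> (b \<otimes> b) = (b \<otimes> b) \<otimes> z"
proof -
  have "z \<otimes> x = x \<otimes> z" if "x \<in> carrier G" "z1 \<otimes> x = x \<otimes> z1" "z2 \<otimes> x = x \<otimes> z2" for x
  proof -
    have "z \<otimes> x = z1 \<otimes> (z2 \<otimes> x)" using that(1) by (simp add: z_def m_assoc)
    also have "\<dots> = (z1 \<otimes> x) \<otimes> z2" unfolding that(3) using that(1) by (simp add: m_assoc)
    also have "\<dots> = x \<otimes> z" unfolding that(2) using that(1) by (simp add: z_def m_assoc)
    finally show ?thesis .
  qed
  then show "z \<otimes> (a \<otimes> a) = (a \<otimes> a) \<otimes> z" "z \<otimes> (b \<otimes> b) = (b \<otimes> b) \<otimes> z"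
    using z1_p z2_p z1_q z2_q by simp_all
qed

lemma z_pow_even: "even k \<Longrightarrow> z [^] (k::nat) = \<one>"
proof (elim evenE)
  fix c assume "k = 2 * c"
  moreover have "z [^] (2::nat) = \<one>" by (simp add: numeral_2_eq_2 z_sq)
  ultimately show "z [^] k = \<one>" using nat_pow_pow[OF z_in(3), of 2 c] by simp
qed

text \<open>Raising the relation to the power \<open>2 ^ (e - 2)\<close> kills
  \<open>z [^] l\<close>, as \<open>l * 2 ^ (e - 2)\<close> is even by \<open>el\<close>, and what
  is left is the inverse of an element whose square is 1.\<close>

lemma conj_half:
  assumes g: "g \<in> carrier G" and x: "x \<in> carrier G" and eq: "conj_by g x = inv x \<otimes> z [^] l"
    and zx: "z \<otimes> x = x \<otimes> z" and sq: "x [^] (2 ^ (e - 2) :: nat) \<otimes> x [^] (2 ^ (e - 2) :: nat) = \<one>"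
  shows "conj_by g (x [^] (2 ^ (e - 2) :: nat)) = x [^] (2 ^ (e - 2) :: nat)"
proof -
  let ?K = "2 ^ (e - 2) :: nat"
  have c: "inv x \<otimes> z [^] l = z [^] l \<otimes> inv x"
    by (rule inv_commute) (use x zx group_commutes_pow[of z x l] in auto)
  have "conj_by g (x [^] ?K) = (inv x \<otimes> z [^] l) [^] ?K" using g x by (simp add: conj_by_pow eq)
  also have "\<dots> = inv x [^] ?K \<otimes> (z [^] l) [^] ?K"
    by (rule pow_mult_distrib) (use x c in auto)
  also have "(z [^] l) [^] ?K = z [^] (l * ?K)" by (simp add: nat_pow_pow)
  also have "\<dots> = \<one>" by (rule z_pow_even) (use el in auto)
  also have "inv x [^] ?K = inv (x [^] ?K)" using x by (simp add: nat_pow_inv)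
  also have "\<dots> = x [^] ?K" using sq x by (simp add: inv_equality)
  finally show ?thesis using x by simp
qed

lemma z1_central: "central z1"
proof (rule centralI)
  show "z1 \<otimes> a = a \<otimes> z1" unfolding z1_def by (metis a_in nat_pow_Suc nat_pow_Suc2)
  have "conj_by b z1 = z1"
    unfolding z_pow_half(1)
    by (rule conj_half) (use conj_by_z(2) z_p z_sq1(1)[unfolded z_pow_half(1)] in simp_all)
  then show "z1 \<otimes> b = b \<otimes> z1" by (simp add: conj_by_eq_iff)
qed simp

lemma z2_central: "central z2"
proof (rule centralI)
  show "z2 \<otimes> b = b \<otimes> z2" unfolding z2_def by (metis b_in nat_pow_Suc nat_pow_Suc2)
  have "conj_by a z2 = z2"
    unfolding z_pow_half(2)
    by (rule conj_half) (use conj_by_z(1) z_q z_sq1(2)[unfolded z_pow_half(2)] in simp_all)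
  then show "z2 \<otimes> a = a \<otimes> z2" by (simp add: conj_by_eq_iff)
qed simp

lemma z_central: "central z"
  unfolding z_def by (rule central_mult[OF z1_central z2_central])

lemma zk_central: "central (z [^] (k::nat))"
  by (rule central_pow[OF z_central])

lemma zk_inv: "inv (z [^] (k::nat)) = z [^] k"
proof (rule inv_equality)
  show "z [^] k \<otimes> z [^] k = \<one>" using z_pow_even[of "k + k"] by (simp add: nat_pow_mult)
qed simp_all

text \<open>The relations are symmetric in \<open>a\<close> and \<open>b\<close> because
  \<open>z1\<close> and \<open>z2\<close> commute. Facts about powers of \<open>b\<close> acting on
  \<open>a \<otimes> a\<close> are thereby transferred to \<open>a\<close> acting on
  \<open>b \<otimes> b\<close>.\<close>

lemma G2_pair_swap: "G2_pair G b a e l"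
proof unfold_locales
  have 1: "b [^] (2 ^ (e - 1) :: nat) \<otimes> a [^] (2 ^ (e - 1) :: nat) = z"
    unfolding z_def z1_z2 unfolding z1_def z2_def ..
  show "conj_by a (b \<otimes> b) = inv (b \<otimes> b) \<otimes> (b [^] (2 ^ (e - 1) :: nat) \<otimes> a [^] (2 ^ (e - 1) :: nat)) [^] l"
    "conj_by b (a \<otimes> a) = inv (a \<otimes> a) \<otimes> (b [^] (2 ^ (e - 1) :: nat) \<otimes> a [^] (2 ^ (e - 1) :: nat)) [^] l"
    unfolding 1 by (rule conj_by_z)+
qed (use e2 el a_pow b_pow pq centralI in simp_all)

lemma b_p: "b \<otimes> (a \<otimes> a) = inv (a \<otimes> a) \<otimes> b \<otimes> z [^] l"
proof -
  have zl: "z [^] l \<in> carrier G" by simp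
  have "conj_by b (inv (a \<otimes> a)) = inv (conj_by b (a \<otimes> a))" by (rule conj_by_inv) simp_all
  also have "\<dots> = inv (z [^] l) \<otimes> inv (inv (a \<otimes> a))" unfolding conj_by_z by (rule inv_mult_group) simp_all
  also have "\<dots> = z [^] l \<otimes> (a \<otimes> a)" by (simp only: zk_inv inv_inv m_closed a_in)
  finally have "inv (a \<otimes> a) \<otimes> b = b \<otimes> (z [^] l \<otimes> (a \<otimes> a))" by (subst (asm) conj_by_eq_iff) auto
  also have "z [^] l \<otimes> (a \<otimes> a) = (a \<otimes> a) \<otimes> z [^] l" by (rule central_commute[OF zk_central]) simp
  finally have "inv (a \<otimes> a) \<otimes> b \<otimes> z [^] l = b \<otimes> (a \<otimes> a) \<otimes> (z [^] l \<otimes> z [^] l)"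
    by (simp add: m_assoc)
  also have "z [^] l \<otimes> z [^] l = \<one>" using zk_inv[of l] by (metis r_inv zl)
  finally show ?thesis by simp
qed

lemma ab_rel_aux: "a \<otimes> b \<otimes> ((a \<otimes> a) \<otimes> inv (b \<otimes> b) \<otimes> z [^] (k::nat)) = inv a \<otimes> inv b \<otimes> z [^] (k + l)"
proof -
  have "a \<otimes> b \<otimes> ((a \<otimes> a) \<otimes> inv (b \<otimes> b) \<otimes> z [^] k) = a \<otimes> (b \<otimes> (a \<otimes> a)) \<otimes> inv (b \<otimes> b) \<otimes> z [^] k"
    by (simp add: m_assoc)
  also have "\<dots> = (a \<otimes> inv (a \<otimes> a)) \<otimes> b \<otimes> (z [^] l \<otimes> inv (b \<otimes> b)) \<otimes> z [^] k"
    unfolding b_p by (simp add: m_assoc)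
  also have "z [^] l \<otimes> inv (b \<otimes> b) = inv (b \<otimes> b) \<otimes> z [^] l"
    by (rule central_commute[OF zk_central]) simp
  also have "(a \<otimes> inv (a \<otimes> a)) \<otimes> b \<otimes> (inv (b \<otimes> b) \<otimes> z [^] l) \<otimes> z [^] k =
      (a \<otimes> inv (a \<otimes> a)) \<otimes> (b \<otimes> inv (b \<otimes> b)) \<otimes> (z [^] l \<otimes> z [^] k)"
    by (simp add: m_assoc)
  also have "\<dots> = inv a \<otimes> inv b \<otimes> z [^] (k + l)"
    by (simp add: inv_mult_group nat_pow_mult add.commute)
  finally show ?thesis .
qed

text \<open>Moving \<open>b\<close> past \<open>a \<otimes> a\<close> costs a factor
  \<open>z [^] l\<close>, which is why \<open>k\<close> turns into \<open>k + l\<close>. The second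
  form is the one that the lifting argument delivers, with \<open>m\<close> in place of
  \<open>k + l\<close>.\<close>

lemma commutator_iff:
  "inv b \<otimes> inv a \<otimes> b \<otimes> a = (a \<otimes> a) \<otimes> inv (b \<otimes> b) \<otimes> z [^] (k::nat) \<longleftrightarrow>
    (a \<otimes> b) \<otimes> (a \<otimes> b) = z [^] (k + l)" (is "?c = ?X \<longleftrightarrow> ?s = ?Y")
proof -
  have X: "?X \<in> carrier G" and Y: "?Y \<in> carrier G" by simp_all
  have "?c = ?X \<longleftrightarrow> a \<otimes> b \<otimes> ?c = a \<otimes> b \<otimes> ?X" using X by simp
  also have "a \<otimes> b \<otimes> ?c = b \<otimes> a" by (simp add: m_assoc)
  also have "a \<otimes> b \<otimes> ?X = inv a \<otimes> inv b \<otimes> ?Y" by (rule ab_rel_aux)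
  also have "b \<otimes> a = inv a \<otimes> inv b \<otimes> ?Y \<longleftrightarrow> a \<otimes> (b \<otimes> a) \<otimes> b = a \<otimes> (inv a \<otimes> inv b \<otimes> ?Y) \<otimes> b"
    using Y by simp
  also have "a \<otimes> (b \<otimes> a) \<otimes> b = ?s" by (simp add: m_assoc)
  also have "a \<otimes> (inv a \<otimes> inv b \<otimes> ?Y) \<otimes> b = inv b \<otimes> (?Y \<otimes> b)" using Y by (simp add: m_assoc)
  also have "?Y \<otimes> b = b \<otimes> ?Y" by (rule central_commute[OF zk_central]) simp
  also have "inv b \<otimes> (b \<otimes> ?Y) = ?Y" using Y by simp
  finally show ?thesis .
qed

definition "normal_forms = {a [^] i \<otimes> b [^] j | (i::nat) (j::nat). True}"

lemma normal_formsI: "a [^] (i::nat) \<otimes> b [^] (j::nat) \<in> normal_forms"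
  unfolding normal_forms_def by blast

lemma normal_forms_closed: "x \<in> normal_forms \<Longrightarrow> x \<in> carrier G"
  by (auto simp: normal_forms_def)

lemma normal_forms_a: "x \<in> normal_forms \<Longrightarrow> a [^] (k::nat) \<otimes> x \<in> normal_forms"
proof -
  assume "x \<in> normal_forms"
  then obtain i j :: nat where x: "x = a [^] i \<otimes> b [^] j" unfolding normal_forms_def by blast
  have "a [^] k \<otimes> x = a [^] (k + i) \<otimes> b [^] j" unfolding x by (simp add: m_assoc flip: nat_pow_mult)
  then show ?thesis using normal_formsI by simp
qed

lemma normal_forms_b: "x \<in> normal_forms \<Longrightarrow> x \<otimes> b [^] (k::nat) \<in> normal_forms"
proof -
  assume "x \<in> normal_forms"
  then obtain i j :: nat where x: "x = a [^] i \<otimes> b [^] j" unfolding normal_forms_def by blast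
  have "x \<otimes> b [^] k = a [^] i \<otimes> b [^] (j + k)" unfolding x by (simp add: m_assoc flip: nat_pow_mult)
  then show ?thesis using normal_formsI by simp
qed

lemma normal_forms_z: assumes x: "x \<in> normal_forms" shows "z [^] (k::nat) \<otimes> x \<in> normal_forms"
proof (induction k)
  case 0
  then show ?case using x normal_forms_closed by simp
next
  case (Suc k)
  have xc: "x \<in> carrier G" by (rule normal_forms_closed[OF x])
  have "z [^] Suc k \<otimes> x = z [^] k \<otimes> z1 \<otimes> (z2 \<otimes> x)" using xc by (simp add: z_def m_assoc)
  also have "z2 \<otimes> x = x \<otimes> z2" by (rule central_commute[OF z2_central xc])
  also have "z [^] k \<otimes> z1 = z1 \<otimes> z [^] k" by (rule central_commute[OF zk_central]) simp
  also have "z1 \<otimes> z [^] k \<otimes> (x \<otimes> z2) = a [^] (2 ^ (e - 1) :: nat) \<otimes> (z [^] k \<otimes> x \<otimes> b [^] (2 ^ (e - 1) :: nat))"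
    unfolding z1_def[symmetric] z2_def[symmetric] using xc by (simp add: m_assoc)
  also have "\<dots> \<in> normal_forms" by (rule normal_forms_a[OF normal_forms_b[OF Suc]])
  finally show ?case .
qed

text \<open>Induction on \<open>i\<close> in steps of two: \<open>m\<close> gives
  \<open>b \<otimes> a = inv a \<otimes> z [^] m \<otimes> inv b\<close>, and \<open>b_p\<close>
  moves \<open>b\<close> past \<open>a \<otimes> a\<close>. The factors \<open>z\<close> are
  harmless, being central and a product of a power of \<open>a\<close> and a power of
  \<open>b\<close>.\<close>

lemma normal_forms_b_left:
  assumes m: "(a \<otimes> b) \<otimes> (a \<otimes> b) = z [^] (m::nat)" and x: "x \<in> normal_forms"
  shows "b \<otimes> x \<in> normal_forms"
proof -
  have "b \<otimes> a [^] i \<in> normal_forms" for i :: nat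
  proof (induction i rule: induct_nat_012)
    case 0
    show ?case using normal_formsI[of 0 1] by simp
  next
    case 1
    have inva: "inv a = a [^] (2 ^ e - 1 :: nat)" "inv b = b [^] (2 ^ e - 1 :: nat)"
      by (rule inv_pow_eq; simp add: a_pow b_pow)+
    have "b \<otimes> a = inv a \<otimes> ((a \<otimes> b) \<otimes> (a \<otimes> b)) \<otimes> inv b" by (simp add: m_assoc)
    also have "\<dots> = inv a \<otimes> z [^] m \<otimes> inv b" unfolding m ..
    also have "inv a \<otimes> z [^] m = z [^] m \<otimes> inv a" by (rule central_commute[OF zk_central, symmetric]) simp
    also have "z [^] m \<otimes> inv a \<otimes> inv b = z [^] m \<otimes> (inv a \<otimes> inv b)" by (simp add: m_assoc)
    also have "\<dots> \<in> normal_forms" unfolding inva by (rule normal_forms_z[OF normal_formsI])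
    finally show ?case by simp
  next
    case (ge2 i)
    have invp: "inv (a \<otimes> a) = a [^] (2 * (2 ^ e - 1) :: nat)"
    proof -
      have "inv a = a [^] (2 ^ e - 1 :: nat)" by (rule inv_pow_eq) (simp_all add: a_pow)
      then show ?thesis by (simp add: inv_mult_group nat_pow_mult mult_2)
    qed
    have "b \<otimes> a [^] Suc (Suc i) = b \<otimes> (a \<otimes> a) \<otimes> a [^] i"
      using nat_pow_Suc2[OF a_in, of i] nat_pow_Suc2[OF a_in, of "Suc i"] by (simp add: m_assoc)
    also have "\<dots> = inv (a \<otimes> a) \<otimes> (b \<otimes> z [^] l) \<otimes> a [^] i" unfolding b_p by (simp add: m_assoc)
    also have "b \<otimes> z [^] l = z [^] l \<otimes> b" by (rule central_commute[OF zk_central, symmetric]) simp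
    also have "inv (a \<otimes> a) \<otimes> (z [^] l \<otimes> b) \<otimes> a [^] i = inv (a \<otimes> a) \<otimes> (z [^] l \<otimes> (b \<otimes> a [^] i))"
      by (simp add: m_assoc)
    also have "\<dots> \<in> normal_forms" unfolding invp by (rule normal_forms_a[OF normal_forms_z[OF ge2(1)]])
    finally show ?case .
  qed
  moreover obtain i j :: nat where "x = a [^] i \<otimes> b [^] j" using x unfolding normal_forms_def by blast
  ultimately show ?thesis using normal_forms_b[of "b \<otimes> a [^] i" j] by (simp add: m_assoc)
qed

end

section \<open>The presentation of G2 and its normal forms\<close>

definition G2_rel :: "nat \<Rightarrow> nat \<Rightarrow> nat \<Rightarrow> (gen2 word \<times> gen2 word) set" where
  "G2_rel e k l = (let a = gen GenX; b = gen GenY; n = 2 ^ e;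
          z = wpow a (n div 2) @ wpow b (n div 2) in
        {(wpow a n, []),
         (wpow b n, []),
         (wcomm (wpow b 2) (wpow a 2), []),
         (wcomm b a, wpow a 2 @ wpow (winv b) 2 @ wpow z k),
         (wconj (wpow b 2) a, wpow (winv b) 2 @ wpow z l),
         (wconj (wpow a 2) b, wpow (winv a) 2 @ wpow z l)})"

lemma G2_eq: "G2 e k l = presented_group (G2_rel e k l)"
  by (simp add: G2_def G2_rel_def Let_def)

abbreviation "G2_pres e k l \<equiv> presented_group (G2_rel e k l)"
abbreviation "G2_a e k l \<equiv> pgen (G2_rel e k l) GenX"
abbreviation "G2_b e k l \<equiv> pgen (G2_rel e k l) GenY"

definition (in group) G2_rels_hold :: "'a \<Rightarrow> 'a \<Rightarrow> nat \<Rightarrow> nat \<Rightarrow> nat \<Rightarrow> bool" where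
  "G2_rels_hold a b e k l \<longleftrightarrow> a [^] (2 ^ e :: nat) = \<one> \<and> b [^] (2 ^ e :: nat) = \<one> \<and>
     (b \<otimes> b) \<otimes> (a \<otimes> a) = (a \<otimes> a) \<otimes> (b \<otimes> b) \<and>
     (let z = a [^] (2 ^ (e - 1) :: nat) \<otimes> b [^] (2 ^ (e - 1) :: nat) in
     inv b \<otimes> inv a \<otimes> b \<otimes> a = (a \<otimes> a) \<otimes> inv (b \<otimes> b) \<otimes> z [^] k \<and>
     conj_by a (b \<otimes> b) = inv (b \<otimes> b) \<otimes> z [^] l \<and>
     conj_by b (a \<otimes> a) = inv (a \<otimes> a) \<otimes> z [^] l)"

lemma (in group) commutator_eq_one_iff:
  assumes "x \<in> carrier G" "y \<in> carrier G"
  shows "inv x \<otimes> inv y \<otimes> x \<otimes> y = \<one> \<longleftrightarrow> x \<otimes> y = y \<otimes> x"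
proof -
  have "inv x \<otimes> inv y \<otimes> x \<otimes> y = inv (y \<otimes> x) \<otimes> (x \<otimes> y)" using assms by (simp add: inv_mult_group m_assoc)
  then show ?thesis using assms by (simp add: inv_solve_left')
qed

lemma G2_rels_iff:
  fixes G :: "('a, 'm) monoid_scheme" (structure) and f :: "gen2 \<Rightarrow> 'a"
  assumes "group_assignment G f" and "e \<ge> 1"
  shows "(\<forall>(u, v) \<in> G2_rel e k l. weval G f u = weval G f v) \<longleftrightarrow>
    group.G2_rels_hold G (f GenX) (f GenY) e k l"
proof -
  interpret group_assignment G f by fact
  have sq: "x [^] (2::nat) = x \<otimes> x" if "x \<in> carrier G" for x using that by (simp add: numeral_2_eq_2)
  have isq: "inv x \<otimes> inv x = inv (x \<otimes> x)" if "x \<in> carrier G" for x using that by (simp add: inv_mult_group)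
  have h: "(2::nat) ^ e div 2 = 2 ^ (e - 1)" using assms by (cases e) auto
  have c: "inv (f GenY \<otimes> f GenY) \<otimes> inv (f GenX \<otimes> f GenX) \<otimes> f GenY \<otimes> f GenY \<otimes> f GenX \<otimes> f GenX = \<one> \<longleftrightarrow>
      f GenY \<otimes> f GenY \<otimes> f GenX \<otimes> f GenX = f GenX \<otimes> f GenX \<otimes> f GenY \<otimes> f GenY"
    using commutator_eq_one_iff[of "f GenY \<otimes> f GenY" "f GenX \<otimes> f GenX"]
    by (simp only: m_assoc[symmetric] f_closed m_closed inv_closed)
  show ?thesis
    unfolding G2_rel_def G2_rels_hold_def Let_def h
    by (simp only: ball_simps case_prod_conv insert_iff weval_simps weval.simps sq isq f_closed inv_closed m_closed
        c m_assoc[symmetric] nat_pow_closed simp_thms)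
qed

lemma (in group) G2_rels_hold_imp_pair:
  assumes "a \<in> carrier G" "b \<in> carrier G" "e \<ge> 2" "e \<ge> 3 \<or> l = 0" "G2_rels_hold a b e k l"
    and "\<And>w. w \<in> carrier G \<Longrightarrow> w \<otimes> a = a \<otimes> w \<Longrightarrow> w \<otimes> b = b \<otimes> w \<Longrightarrow> central w"
  shows "G2_pair G a b e l"
  by unfold_locales (use assms in \<open>simp_all add: G2_rels_hold_def Let_def\<close>)

lemma (in G2_pair) G2_rels_hold_iff:
  "G2_rels_hold a b e k l \<longleftrightarrow> (a \<otimes> b) \<otimes> (a \<otimes> b) = z [^] (k + l)"
  unfolding commutator_iff[symmetric]
  unfolding G2_rels_hold_def Let_def z_def z1_def z2_def
  using a_pow b_pow pq cja cjb by blast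

lemma (in group_assignment) centralI_range:
  assumes range: "carrier G = range (weval G f)" and w: "w \<in> carrier G"
    and c: "\<And>x. w \<otimes> f x = f x \<otimes> w"
  shows "central w"
  unfolding central_def
proof (intro conjI ballI w)
  have inv: "w \<otimes> inv (f x) = inv (f x) \<otimes> w" for x using inv_commute[OF f_closed w c] by simp
  have "w \<otimes> weval G f v = weval G f v \<otimes> w" for v
  proof (induction v)
    case (Cons p v)
    let ?y = "if snd p then f (fst p) else inv (f (fst p))"
    have y: "?y \<in> carrier G" "w \<otimes> ?y = ?y \<otimes> w" using c inv by auto
    have "w \<otimes> weval G f (p # v) = (w \<otimes> ?y) \<otimes> weval G f v" using w y(1) by (simp add: m_assoc)
    also have "\<dots> = ?y \<otimes> (w \<otimes> weval G f v)" unfolding y(2) using w y(1) by (simp add: m_assoc)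
    also have "\<dots> = weval G f (p # v) \<otimes> w" unfolding Cons using w y(1) by (simp add: m_assoc)
    finally show ?case .
  qed (use w in simp)
  then show "w \<otimes> x = x \<otimes> w" if "x \<in> carrier G" for x using that range by auto
qed

lemma presented_group_range: "carrier (presented_group R) = range (weval (presented_group R) (pgen R))"
  by (simp add: presented_group_simps weval_presented_group)

lemma G2_pair_presented:
  assumes "e \<ge> 2" "e \<ge> 3 \<or> l = 0"
  shows "G2_pair (G2_pres e k l) (G2_a e k l) (G2_b e k l) e l"
    and "group.G2_rels_hold (G2_pres e k l) (G2_a e k l) (G2_b e k l) e k l"
proof -
  let ?R = "G2_rel e k l" and ?P = "presented_group (G2_rel e k l)"
  interpret P: group_assignment "?P" "pgen ?R" by (rule presented_group_assignment)
  show hold: "P.G2_rels_hold (pgen ?R GenX) (pgen ?R GenY) e k l"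
    using G2_rels_iff[OF P.group_assignment_axioms, of e k l] weval_presented_group_rel[of _ _ ?R] assms by auto
  show "G2_pair (?P) (pgen ?R GenX) (pgen ?R GenY) e l"
  proof (rule P.G2_rels_hold_imp_pair[OF _ _ assms hold])
    fix w assume w: "w \<in> carrier (?P)"
      "w \<otimes>\<^bsub>?P\<^esub> pgen ?R GenX = pgen ?R GenX \<otimes>\<^bsub>?P\<^esub> w"
      "w \<otimes>\<^bsub>?P\<^esub> pgen ?R GenY = pgen ?R GenY \<otimes>\<^bsub>?P\<^esub> w"
    show "P.central w"
    proof (rule P.centralI_range[OF presented_group_range w(1)])
      show "w \<otimes>\<^bsub>?P\<^esub> pgen ?R x = pgen ?R x \<otimes>\<^bsub>?P\<^esub> w" for x
        using w by (cases x) auto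
    qed
  qed simp_all
qed

lemma G2_normal_form:
  assumes "e \<ge> 2" "e \<ge> 3 \<or> l = 0" and C: "C \<in> carrier (G2_pres e k l)"
  shows "C \<in> G2_pair.normal_forms (G2_pres e k l) (G2_a e k l) (G2_b e k l)"
proof -
  let ?R = "G2_rel e k l" and ?P = "presented_group (G2_rel e k l)"
  interpret P: group_assignment "?P" "pgen ?R" by (rule presented_group_assignment)
  interpret P: G2_pair "?P" "pgen ?R GenX" "pgen ?R GenY" e l by (rule G2_pair_presented(1)[OF assms(1,2)])
  have m: "(pgen ?R GenX \<otimes>\<^bsub>?P\<^esub> pgen ?R GenY) \<otimes>\<^bsub>?P\<^esub>
      (pgen ?R GenX \<otimes>\<^bsub>?P\<^esub> pgen ?R GenY) = P.z [^]\<^bsub>?P\<^esub> (k + l)"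
    using G2_pair_presented(2)[OF assms(1,2)] P.G2_rels_hold_iff by blast
  obtain w where w: "C = weval (?P) (pgen ?R) w" using C unfolding presented_group_range by blast
  show ?thesis unfolding w
  proof (rule P.weval_mem[where n = "2 ^ e"])
    show "pgen ?R x [^]\<^bsub>?P\<^esub> (2 ^ e :: nat) = \<one>\<^bsub>?P\<^esub>" for x
      by (cases x) (simp_all add: P.a_pow P.b_pow)
    show "\<one>\<^bsub>?P\<^esub> \<in> P.normal_forms" using P.normal_formsI[of 0 0] by simp
    show "P.normal_forms \<subseteq> carrier (?P)" using P.normal_forms_closed by blast
    fix x s assume s: "s \<in> P.normal_forms"
    show "pgen ?R x \<otimes>\<^bsub>?P\<^esub> s \<in> P.normal_forms"
    proof (cases x)
      case GenX then show ?thesis using P.normal_forms_a[OF s, of 1] by simp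
    next
      case GenY then show ?thesis using P.normal_forms_b_left[OF m s] by simp
    qed
  qed simp
qed

lemma (in isobicyclic_triple) nonmetacyclic_case_iso:
  assumes e2: "e \<ge> 2" and B: nonmetacyclic_case
  shows "\<exists>(k::nat) (l::nat). k < 2 \<and> l < 2 \<and> (e = 2 \<longrightarrow> k = 0 \<and> l = 0) \<and> G \<cong> G2 e k l"
proof -
  have e1: "e \<ge> 1" using e2 by simp
  obtain m l :: nat where ml: "m < 2" "l < 2" "e = 2 \<longrightarrow> m = 0 \<and> l = 0"
    and abab: "(a \<otimes> b) \<otimes> (a \<otimes> b) = (z1 \<otimes> z2) [^] m"
    and ca: "conj_by a (b \<otimes> b) = inv (b \<otimes> b) \<otimes> (z1 \<otimes> z2) [^] l"
    and pq: "(b \<otimes> b) \<otimes> (a \<otimes> a) = (a \<otimes> a) \<otimes> (b \<otimes> b)"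
    using B unfolding nonmetacyclic_case_def by blast
  have el: "e \<ge> 3 \<or> l = 0" using ml e2 by linarith
  have "z2 \<otimes> z1 = z1 \<otimes> z2" using central_commute[OF z2_central[OF e1]] by simp
  then have cb: "conj_by b (a \<otimes> a) = inv (a \<otimes> a) \<otimes> (z1 \<otimes> z2) [^] l"
    using arg_cong[OF ca, of \<sigma>] by (simp add: sig_conj_by sig_mult sig_inv sig_pow sig_a sig_b)
  interpret g: G2_pair G a b e l
    by unfold_locales
      (use e2 el a_pow b_pow pq ca[unfolded z1_def z2_def] cb[unfolded z1_def z2_def] centralI in simp_all)
  have gz: "g.z = z1 \<otimes> z2" by (simp add: g.z_def g.z1_def g.z2_def z1_def z2_def)
  \<comment> \<open>The presentation asks for \<open>k + l\<close> congruent to \<open>m\<close>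
    modulo 2, and \<open>m + 2 * l\<close> is.\<close>
  define k where "k = (m + l) mod 2"
  have k: "k < 2" "e = 2 \<longrightarrow> k = 0 \<and> l = 0" using ml by (auto simp: k_def)
  have "m = 0 \<or> m = 1" "l = 0 \<or> l = 1" using ml by auto
  then have "g.z [^] (k + l) = g.z [^] m"
    using g.z_sq by (auto simp: k_def)
  then have hold: "G2_rels_hold a b e k l" using abab by (simp add: g.G2_rels_hold_iff gz)
  define f where "f = case_gen2 a b"
  have f: "f GenX = a" "f GenY = b" by (simp_all add: f_def)
  interpret A: group_assignment G f
    by unfold_locales (simp add: f_def split: gen2.split)
  let ?R = "G2_rel e k l" and ?P = "presented_group (G2_rel e k l)"
  interpret P: G2_pair "?P" "pgen ?R GenX" "pgen ?R GenY" e l by (rule G2_pair_presented(1)[OF e2 el])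
  have "G \<cong> ?P"
  proof (rule A.is_iso_presented_groupI[where n = "2 ^ e" and p = GenX and q = GenY])
    show "weval G f u = weval G f v" if "(u, v) \<in> ?R" for u v
      using G2_rels_iff[OF A.group_assignment_axioms e1, of k l] hold that unfolding f by blast
    show "\<exists>(i::nat) (j::nat). C = pgen ?R GenX [^]\<^bsub>?P\<^esub> i
        \<otimes>\<^bsub>?P\<^esub> pgen ?R GenY [^]\<^bsub>?P\<^esub> j"
      if "C \<in> carrier (?P)" for C
      using G2_normal_form[OF e2 el that] unfolding P.normal_forms_def by blast
  qed (use P.a_pow P.b_pow indep factor in \<open>auto simp: f\<close>)
  then show ?thesis using k ml unfolding G2_eq by blast
qed

lemma classification:
  assumes n: "2 ^ e \<ge> (4::nat)" and iso: "isobicyclic (2 ^ e) G"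
  shows "(metacyclic G \<and> (\<exists>f \<in> {2..e}. G \<cong> G1 e f))
            \<or> (\<not> metacyclic G \<and>
                ((e = 2 \<and> G \<cong> G2 2 0 0)
               \<or> (e \<ge> 3 \<and> (\<exists>k \<in> {0, 1}. \<exists>l \<in> {0, 1}. G \<cong> G2 e k l))))"
proof -
  obtain a b \<sigma> where "isobicyclic_triple G a b \<sigma> e" using isobicyclic_imp_triple[OF iso] by blast
  then interpret isobicyclic_triple G a b \<sigma> e .
  have "(2::nat) ^ 2 \<le> 2 ^ e" using n by simp
  then have e2: "e \<ge> 2" by (subst (asm) power_increasing_iff) simp_all
  consider metacyclic_case | nonmetacyclic_case using dichotomy[OF isobicyclic_triple_axioms] e2 by auto
  then show ?thesis
  proof cases
    case 1
    then show ?thesis unfolding metacyclic_case_def using metacyclic_case_iso[OF e2] metacyclic_case_metacyclic[OF e2] by blast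
  next
    case 2
    then have "\<not> metacyclic G" using metacyclic_split_cyclic unfolding nonmetacyclic_case_def by blast
    moreover obtain k l :: nat where kl: "k < 2" "l < 2" "e = 2 \<longrightarrow> k = 0 \<and> l = 0" "G \<cong> G2 e k l"
      using nonmetacyclic_case_iso[OF e2 2] by blast
    have "k \<in> {0, 1}" "l \<in> {0, 1}" using kl by auto
    moreover have "e = 2 \<or> e \<ge> 3" using e2 by auto
    ultimately show ?thesis using kl by metis
  qed
qed

section \<open>A permutation representation\<close>

text \<open>
  $G_2(e; k, l)$ acts on the cosets $a^x \langle b\rangle$.  The pair $(i, s)$ encodes
  $x = 2i + s$, with $i$ taken modulo $2^{e-1} = 4J$; the parameter $m$ is $k + l$.
\<close>

definition pt_cong :: "int \<Rightarrow> int \<times> bool \<Rightarrow> int \<times> bool \<Rightarrow> bool" where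
  "pt_cong J x y \<longleftrightarrow> snd x = snd y \<and> 4 * J dvd fst x - fst y"

text \<open>The formulas for \<open>GenY\<close> come from collecting
  \<open>b \<otimes> a [^] x\<close> modulo \<open>\<langle>b\<rangle>\<close> on the right:
  \<open>b\<close> inverts \<open>a \<otimes> a\<close> up to \<open>z [^] l\<close>, and
  \<open>b \<otimes> a = inv a \<otimes> z [^] m \<otimes> inv b\<close>. Since \<open>z2\<close> is
  absorbed by \<open>\<langle>b\<rangle>\<close>, \<open>z\<close> acts as \<open>z1\<close>, the
  shift of \<open>i\<close> by \<open>2 * J\<close>. Points are kept as integers and compared by
  \<open>pt_cong\<close>.\<close>

fun act1 :: "int \<Rightarrow> int \<Rightarrow> int \<Rightarrow> gen2 \<Rightarrow> bool \<Rightarrow> int \<times> bool \<Rightarrow> int \<times> bool" where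
  "act1 J l m GenX True (i, s) = (if s then (i + 1, False) else (i, True))"
| "act1 J l m GenX False (i, s) = (if s then (i, False) else (i - 1, True))"
| "act1 J l m GenY True (i, s) = (if s then (- i - 1 + 2 * J * (l * i + m), True) else (- i + 2 * J * l * i, False))"
| "act1 J l m GenY False (i, s) = (if s then (- i - 1 + 2 * J * (l * i + m) + 2 * J * l, True) else (- i + 2 * J * l * i, False))"

primrec act :: "int \<Rightarrow> int \<Rightarrow> int \<Rightarrow> gen2 word \<Rightarrow> int \<times> bool \<Rightarrow> int \<times> bool" where
  "act J l m [] x = x"
| "act J l m (p # w) x = act1 J l m (fst p) (snd p) (act J l m w x)"

lemma act_append: "act J l m (u @ v) x = act J l m u (act J l m v x)"
  by (induction u) simp_all

lemma pt_congI: "i = j + 4 * J * c \<Longrightarrow> pt_cong J (i, s) (j, s)"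
  by (simp add: pt_cong_def)

lemma pt_cong_refl [simp]: "pt_cong J x x"
  by (simp add: pt_cong_def)

lemma pt_cong_sym: "pt_cong J x y \<Longrightarrow> pt_cong J y x"
  by (simp add: pt_cong_def dvd_diff_commute)

lemma pt_cong_trans: "pt_cong J x y \<Longrightarrow> pt_cong J y z \<Longrightarrow> pt_cong J x z"
  unfolding pt_cong_def using dvd_add[of "4 * J" "fst x - fst y" "fst y - fst z"] by auto

lemma act1_cong: 
  assumes eq: "pt_cong J x y" shows "pt_cong J (act1 J l m g s x) (act1 J l m g s y)"
proof -
  obtain i t j where x: "x = (i, t)" and y: "y = (j, t)" and d: "4 * J dvd i - j"
    using eq by (cases x; cases y) (auto simp: pt_cong_def)
  obtain c where "i - j = 4 * J * c" using d by (rule dvdE)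
  then have c: "i = j + 4 * J * c" by simp
  show ?thesis
  proof (cases g)
    case GenX
    then show ?thesis unfolding x y c by (cases s; cases t) (simp_all add: pt_congI[of _ _ _ c])
  next
    case GenY
    \<comment> \<open>The witness is the quotient by \<open>4 * J\<close> of the change in
      \<open>- i + 2 * J * l * i\<close> when \<open>i\<close> grows by
      \<open>4 * J * c\<close>.\<close>
    then show ?thesis unfolding x y c
      by (cases s; cases t) (auto intro!: pt_congI[of _ _ _ "c * (2 * J * l - 1)"] simp: algebra_simps)
  qed
qed

lemma act_cong: "pt_cong J x y \<Longrightarrow> pt_cong J (act J l m w x) (act J l m w y)"
  by (induction w) (simp_all add: act1_cong)

text \<open>The maps of \<open>b\<close> and of its inverse undo each other only modulo
  \<open>4 * J\<close>; the explicit witnesses are what remains, divided by \<open>4 * J\<close>,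
  after expanding the composition.\<close>

lemma act1_cancel: "pt_cong J (act1 J l m g s (act1 J l m g (\<not> s) x)) x"
proof -
  obtain i t where x: "x = (i, t)" by (cases x)
  show ?thesis
  proof (cases g)
    case GenX
    then show ?thesis by (cases s; cases t) (simp_all add: x)
  next
    case GenY
    show ?thesis
    proof (cases t)
      case False
      then show ?thesis using GenY
        by (cases s) (auto intro!: pt_congI[of _ _ _ "- l * i + J * l * l * i"] simp: x algebra_simps)
    next
      case True
      show ?thesis
      proof (cases s)
        case s: True
        show ?thesis using GenY s True
          by (auto intro!: pt_congI[of _ _ _ "- l * i - l + J * l * (l * i + m + l)"] simp: x algebra_simps)
      next
        case s: False
        show ?thesis using GenY s True
          by (auto intro!: pt_congI[of _ _ _ "- l * i + J * l * (l * i + m)"] simp: x algebra_simps)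
      qed
    qed
  qed
qed

text \<open>\<open>act\<close> turns concatenation into composition and respects
  \<open>pt_cong\<close>, and cancellation is \<open>act1_cancel\<close>, so only the defining
  relations remain to be checked on points.\<close>

lemma act_pres_eq:
  assumes "pres_eq R u v" and R: "\<And>u v x. (u, v) \<in> R \<Longrightarrow> pt_cong J (act J l m u x) (act J l m v x)"
  shows "pt_cong J (act J l m u x) (act J l m v x)"
  using assms(1)
proof (induction arbitrary: x rule: pres_eq.induct)
  case (sym u v)
  then show ?case by (blast intro: pt_cong_sym)
next
  case (trans u v w)
  then show ?case by (blast intro: pt_cong_trans)
next
  case (append u u' v v')
  then show ?case unfolding act_append by (blast intro: pt_cong_trans act_cong)
next
  case (cancel g s)
  then show ?case using act1_cancel by simp
qed (simp_all add: R)

lemma act_wpow_Suc: "act J l m (wpow w (Suc t)) x = act J l m w (act J l m (wpow w t) x)"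
  by (simp add: wpow_def act_append)

lemma act_wpow_0: "act J l m (wpow w 0) x = x"
  by (simp add: wpow_def)

lemma wpow_2: "wpow w 2 = w @ w"
  by (simp add: wpow_def numeral_2_eq_2)

lemma act_X2: "act J l m (wpow (gen GenX) 2) (i, s) = (i + 1, s)"
  by (simp add: wpow_2 gen_def)

lemma act_X2_inv: "act J l m (wpow (winv (gen GenX)) 2) (i, s) = (i - 1, s)"
  "act J l m (winv (wpow (gen GenX) 2)) (i, s) = (i - 1, s)"
  by (simp_all add: wpow_2 gen_def winv_def)

text \<open>\<open>b \<otimes> b\<close> fixes the cosets of even powers of \<open>a\<close> and
  moves those of odd powers by \<open>z1 [^] l\<close>, because
  \<open>conj_by a (b \<otimes> b)\<close> has the extra factor \<open>z [^] l\<close>.\<close>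

lemma act_Y2: "pt_cong J (act J l m (wpow (gen GenY) 2) (i, s)) (i + 2 * J * l * of_bool s, s)"
proof (cases s)
  case True
  then show ?thesis
    by (auto intro!: pt_congI[of _ _ _ "- l * i - l + J * l * (l * i + m)"] simp: wpow_2 gen_def algebra_simps)
next
  case False
  then show ?thesis
    by (auto intro!: pt_congI[of _ _ _ "- l * i + J * l * l * i"] simp: wpow_2 gen_def algebra_simps)
qed

lemma act_Y2_inv: "pt_cong J (act J l m (wpow (winv (gen GenY)) 2) (i, s)) (i + 2 * J * l * of_bool s, s)"
proof (cases s)
  case True
  then show ?thesis
    by (auto intro!: pt_congI[of _ _ _ "- l * i - l + J * l * (l * i + m + l)"] simp: wpow_2 gen_def winv_def algebra_simps)
next
  case False
  then show ?thesis
    by (auto intro!: pt_congI[of _ _ _ "- l * i + J * l * l * i"] simp: wpow_2 gen_def winv_def algebra_simps)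
qed

lemma winv_wpow2: "winv (wpow w 2) = wpow (winv w) 2"
  by (simp add: wpow_2 winv_def)

lemma wpow_even: "wpow w (2 * t) = wpow (wpow w 2) t"
proof (induction t)
  case (Suc t)
  have "wpow w (2 * Suc t) = w @ w @ wpow w (2 * t)" by (simp add: wpow_def)
  then show ?case using Suc by (simp add: wpow_2) (simp add: wpow_def)
qed (simp add: wpow_def)

lemma act_X_pow: "act J l m (wpow (gen GenX) (2 * t)) (i, s) = (i + int t, s)"
  unfolding wpow_even by (induction t) (simp_all add: act_wpow_0 act_wpow_Suc act_X2)

lemma act_Y_pow: "pt_cong J (act J l m (wpow (gen GenY) (2 * t)) (i, s)) (i + int t * (2 * J * l * of_bool s), s)"
  unfolding wpow_even
proof (induction t)
  case (Suc t)
  have "pt_cong J (act J l m (wpow (gen GenY) 2) (act J l m (wpow (wpow (gen GenY) 2) t) (i, s)))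
     (i + int t * (2 * J * l * of_bool s) + 2 * J * l * of_bool s, s)"
    using pt_cong_trans[OF act_cong[OF Suc] act_Y2] .
  then show ?case by (simp add: act_wpow_Suc algebra_simps)
qed (simp add: act_wpow_0)

context
  fixes e k l :: nat and J :: int and n' :: nat
  assumes e: "e \<ge> 3" and J: "J = 2 ^ (e - 3)" and n': "n' = 2 ^ (e - 3)"
begin

abbreviation "zw \<equiv> wpow (gen GenX) (2 ^ e div 2) @ wpow (gen GenY) (2 ^ e div 2)"
abbreviation "ac \<equiv> act J (int l) (int (k + l))"

lemma Jn: "J = int n'" by (simp add: J n')

lemma pow_e: "(2::nat) ^ e = 2 * (4 * n')" "(2::nat) ^ e div 2 = 2 * (2 * n')"
proof -
  have "e = Suc (Suc (Suc (e - 3)))" using e by simp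
  then have "(2::nat) ^ e = 2 * (2 * (2 * n'))" unfolding n' by (metis power_Suc)
  then show "(2::nat) ^ e = 2 * (4 * n')" "(2::nat) ^ e div 2 = 2 * (2 * n')" by simp_all
qed

text \<open>\<open>b [^] (2 ^ (e - 1))\<close> moves nothing modulo \<open>4 * J\<close>, so only
  the factor \<open>a [^] (2 ^ (e - 1))\<close> is felt.\<close>

lemma act_z: "pt_cong J (ac zw (i, s)) (i + 2 * J, s)"
proof -
  have "pt_cong J (ac (wpow (gen GenY) (2 * (2 * n'))) (i, s)) (i + int (2 * n') * (2 * J * int l * of_bool s), s)"
    by (rule act_Y_pow)
  moreover have "pt_cong J (i + int (2 * n') * (2 * J * int l * of_bool s), s) (i, s)"
    by (rule pt_congI[of _ _ _ "int n' * int l * of_bool s"]) simp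
  ultimately have "pt_cong J (ac (wpow (gen GenY) (2 * (2 * n'))) (i, s)) (i, s)" by (rule pt_cong_trans)
  from act_cong[OF this, of "int l" "int (k + l)" "wpow (gen GenX) (2 * (2 * n'))"]
  show ?thesis unfolding act_append pow_e act_X_pow by (simp add: Jn)
qed

lemma act_z_pow: "pt_cong J (ac (wpow zw t) (i, s)) (i + 2 * J * int t, s)"
proof (induction t)
  case (Suc t)
  have "pt_cong J (ac zw (ac (wpow zw t) (i, s))) (i + 2 * J * int t + 2 * J, s)"
    using pt_cong_trans[OF act_cong[OF Suc] act_z] .
  then show ?case by (simp add: act_wpow_Suc algebra_simps del: act.simps)
qed (simp add: act_wpow_0)

lemma act_rhs: "pt_cong J (ac (u @ wpow zw t) (i, s)) (j, s')"
  if "pt_cong J (ac u (i + 2 * J * int t, s)) (j, s')"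
  using pt_cong_trans[OF act_cong[OF act_z_pow] that] unfolding act_append .

lemma act_G2_rel:
  assumes "(u, v) \<in> G2_rel e k l"
  shows "pt_cong J (ac u x) (ac v x)"
proof -
  obtain i s where x: "x = (i, s)" by (cases x)
  let ?a = "gen GenX" and ?b = "gen GenY"
  have r1: "pt_cong J (ac (wpow ?a (2 ^ e)) x) (ac [] x)"
    unfolding pow_e act_X_pow x by (simp add: Jn pt_congI[of _ _ _ 1])
  have r2: "pt_cong J (ac (wpow ?b (2 ^ e)) x) (ac [] x)"
  proof -
    have "pt_cong J (ac (wpow ?b (2 * (4 * n'))) (i, s)) (i + int (4 * n') * (2 * J * int l * of_bool s), s)"
      by (rule act_Y_pow)
    moreover have "pt_cong J (i + int (4 * n') * (2 * J * int l * of_bool s), s) (i, s)"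
      by (rule pt_congI[of _ _ _ "2 * int n' * int l * of_bool s"]) simp
    ultimately show ?thesis unfolding x pow_e act.simps by (rule pt_cong_trans)
  qed
  have r3: "pt_cong J (ac (wcomm (wpow ?b 2) (wpow ?a 2)) x) (ac [] x)"
  proof -
    have eq: "i + 1 + t - 1 = i + t" for t by simp
    have "pt_cong J (ac (wpow ?b 2) (i + 1, s)) (i + 1 + 2 * J * int l * of_bool s, s)" by (rule act_Y2)
    from act_cong[OF this, of "int l" "int (k + l)" "winv (wpow ?a 2)"]
    have "pt_cong J (ac (winv (wpow ?a 2)) (ac (wpow ?b 2) (i + 1, s))) (i + 2 * J * int l * of_bool s, s)"
      unfolding act_X2_inv(2) eq .
    from pt_cong_trans[OF act_cong[OF this] act_Y2_inv]
    have "pt_cong J (ac (wpow (winv ?b) 2) (ac (winv (wpow ?a 2)) (ac (wpow ?b 2) (i + 1, s))))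
       (i + 2 * J * int l * of_bool s + 2 * J * int l * of_bool s, s)" .
    moreover have "pt_cong J (i + 2 * J * int l * of_bool s + 2 * J * int l * of_bool s, s) (i, s)"
      by (rule pt_congI[of _ _ _ "int l * of_bool s"]) simp
    ultimately show ?thesis
      unfolding x wcomm_def act_append act_X2 winv_wpow2[of ?b] act.simps by (rule pt_cong_trans)
  qed
  have rhs: "pt_cong J (ac (wpow ?a 2 @ wpow (winv ?b) 2 @ wpow zw k) x) (i + 2 * J * int k + 2 * J * int l * of_bool s + 1, s)"
  proof -
    have "pt_cong J (ac (wpow (winv ?b) 2) (i + 2 * J * int k, s)) (i + 2 * J * int k + 2 * J * int l * of_bool s, s)"
      by (rule act_Y2_inv)
    from act_cong[OF act_rhs[OF this], of "int l" "int (k + l)" "wpow ?a 2"]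
    show ?thesis unfolding x act_append[of _ _ _ "wpow ?a 2"] act_X2 .
  qed
  have r4: "pt_cong J (ac (wcomm ?b ?a) x) (ac (wpow ?a 2 @ wpow (winv ?b) 2 @ wpow zw k) x)"
  proof (rule pt_cong_trans[OF _ pt_cong_sym[OF rhs]])
    show "pt_cong J (ac (wcomm ?b ?a) x) (i + 2 * J * int k + 2 * J * int l * of_bool s + 1, s)"
    proof (cases s)
      case True
      then show ?thesis
        by (auto intro!: pt_congI[of _ _ _ "- int l * (i + 1) + J * int l * int l * (i + 1)"]
            simp: x wcomm_def gen_def winv_def algebra_simps)
    next
      case False
      then show ?thesis
        by (auto intro!: pt_congI[of _ _ _ "- int l * i - int k - int l + J * int l * (int l * i + int k + int l)"]
            simp: x wcomm_def gen_def winv_def algebra_simps)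
    qed
  qed
  have r5: "pt_cong J (ac (wconj (wpow ?b 2) ?a) x) (ac (wpow (winv ?b) 2 @ wpow zw l) x)"
  proof -
    have r: "pt_cong J (ac (wpow (winv ?b) 2 @ wpow zw l) x) (i + 2 * J * int l + 2 * J * int l * of_bool s, s)"
      unfolding x by (rule act_rhs) (rule act_Y2_inv)
    \<comment> \<open>\<open>?a\<close> changes the parity \<open>s\<close>, so after conjugation
      the shift by \<open>b \<otimes> b\<close> occurs at the opposite parity.\<close>
    have "pt_cong J (ac (wconj (wpow ?b 2) ?a) x) (i + 2 * J * int l * of_bool (\<not> s), s)"
    proof (cases s)
      case True
      have "pt_cong J (ac (wpow ?b 2) (i + 1, False)) (i + 1, False)" using act_Y2[of J _ _ "i + 1" False] by simp
      from act_cong[OF this, of "int l" "int (k + l)" "winv ?a"]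
      show ?thesis unfolding wconj_def act_append x using True by (simp add: gen_def winv_def)
    next
      case False
      have "pt_cong J (ac (wpow ?b 2) (i, True)) (i + 2 * J * int l, True)" using act_Y2[of J _ _ i True] by simp
      from act_cong[OF this, of "int l" "int (k + l)" "winv ?a"]
      show ?thesis unfolding wconj_def act_append x using False by (simp add: gen_def winv_def)
    qed
    moreover have "pt_cong J (i + 2 * J * int l * of_bool (\<not> s), s) (i + 2 * J * int l + 2 * J * int l * of_bool s, s)"
      by (rule pt_congI[of _ _ _ "- int l * of_bool s"]) (simp add: of_bool_def)
    ultimately show ?thesis using r pt_cong_sym pt_cong_trans by blast
  qed
  have r6: "pt_cong J (ac (wconj (wpow ?a 2) ?b) x) (ac (wpow (winv ?a) 2 @ wpow zw l) x)"
  proof -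
    have "pt_cong J (ac (wpow (winv ?a) 2 @ wpow zw l) x) (i + 2 * J * int l - 1, s)"
      unfolding x by (rule act_rhs) (simp add: act_X2_inv)
    moreover have "pt_cong J (ac (wconj (wpow ?a 2) ?b) x) (i + 2 * J * int l - 1, s)"
    proof (cases s)
      case True
      then show ?thesis
        by (auto intro!: pt_congI[of _ _ _ "- int l * i + J * int l * (int l * i + int k + int l)"]
            simp: x wconj_def wpow_2 gen_def winv_def algebra_simps)
    next
      case False
      then show ?thesis
        by (auto intro!: pt_congI[of _ _ _ "- int l * i + J * int l * int l * i"]
            simp: x wconj_def wpow_2 gen_def winv_def algebra_simps)
    qed
    ultimately show ?thesis using pt_cong_sym pt_cong_trans by blast
  qed
  show ?thesis
    using assms r1 r2 r3 r4 r5 r6 unfolding G2_rel_def Let_def by blast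
qed

text \<open>Both words are tested on the point \<open>(0, False)\<close>, the coset
  \<open>\<langle>b\<rangle>\<close>: the first moves it by \<open>2 * J\<close>, the second by 2,
  and neither is a multiple of \<open>4 * J\<close>. All later separation of the groups rests on
  these two facts.\<close>

lemma G2_nontrivial:
  "\<not> pres_eq (G2_rel e k l) zw []" "\<not> pres_eq (G2_rel e k l) (wpow (gen GenX) 4) []"
proof -
  have J1: "J > 0" by (simp add: J)
  have *: "pt_cong J (ac u (0, False)) (0, False)" if "pres_eq (G2_rel e k l) u []" for u
    using act_pres_eq[OF that act_G2_rel, of "(0, False)"] by simp
  show "\<not> pres_eq (G2_rel e k l) zw []"
  proof
    assume "pres_eq (G2_rel e k l) zw []"
    from pt_cong_trans[OF pt_cong_sym[OF act_z] *[OF this]]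
    have "4 * J dvd 2 * J" by (simp add: pt_cong_def)
    then show False using J1 by (auto dest: zdvd_imp_le)
  qed
  show "\<not> pres_eq (G2_rel e k l) (wpow (gen GenX) 4) []"
  proof
    assume "pres_eq (G2_rel e k l) (wpow (gen GenX) 4) []"
    from *[OF this] have "pt_cong J (2, False) (0, False)"
      using act_X_pow[of J "int l" "int (k + l)" 2 0 False] by simp
    then have "4 * J dvd 2" by (simp add: pt_cong_def)
    then show False using J1 by (auto dest: zdvd_imp_le)
  qed
qed

end

section \<open>Inversion of squares\<close>

definition (in group) inverts_squares :: "'a \<Rightarrow> bool" where
  "inverts_squares u \<longleftrightarrow> u \<in> carrier G \<and> (\<forall>x\<in>carrier G. conj_by u (x \<otimes> x) = inv (x \<otimes> x))"

lemma (in group_hom) inverts_squares_image: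
  assumes u: "G.inverts_squares u" and surj: "h ` carrier G = carrier H"
  shows "H.inverts_squares (h u)"
  unfolding H.inverts_squares_def
proof (intro conjI ballI)
  show "h u \<in> carrier H" using u by (simp add: G.inverts_squares_def)
  fix y assume "y \<in> carrier H"
  then obtain x where x: "x \<in> carrier G" "y = h x" using surj by blast
  have uc: "u \<in> carrier G" "G.conj_by u (x \<otimes>\<^bsub>G\<^esub> x) = inv\<^bsub>G\<^esub> (x \<otimes>\<^bsub>G\<^esub> x)"
    using u x(1) by (simp_all add: G.inverts_squares_def)
  have "H.conj_by (h u) (h (x \<otimes>\<^bsub>G\<^esub> x)) = h (G.conj_by u (x \<otimes>\<^bsub>G\<^esub> x))"
    by (rule hom_conj_by[symmetric]) (use uc x in simp_all)
  also have "\<dots> = inv\<^bsub>H\<^esub> h (x \<otimes>\<^bsub>G\<^esub> x)" unfolding uc(2) by (rule hom_inv) (use x in simp)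
  finally show "H.conj_by (h u) (y \<otimes>\<^bsub>H\<^esub> y) = inv\<^bsub>H\<^esub> (y \<otimes>\<^bsub>H\<^esub> y)" using x by simp
qed

context G2_pair
begin

lemma swap_z: "G2_pair.z G b a e = z"
proof -
  interpret S: G2_pair G b a e l by (rule G2_pair_swap)
  show ?thesis by (simp add: S.z_def S.z1_def S.z2_def z_def z1_z2) (simp add: z1_def z2_def)
qed

lemma conj_by_b_pow_p: "conj_by (b [^] (j::nat)) (a \<otimes> a) = (if even j then a \<otimes> a else inv (a \<otimes> a) \<otimes> z [^] l)"
proof (induction j)
  case 0
  show ?case by (simp add: conj_by_def)
next
  case (Suc j)
  have *: "conj_by (b [^] Suc j) (a \<otimes> a) = conj_by b (conj_by (b [^] j) (a \<otimes> a))" by (simp add: conj_by_conj_by)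
  show ?case
  proof (cases "even j")
    case True
    then show ?thesis unfolding * Suc using conj_by_z(2) by simp
  next
    case False
    have zl: "z [^] l \<in> carrier G" "z [^] l \<otimes> z [^] l = \<one>"
      using r_inv[of "z [^] l"] by (simp_all add: zk_inv)
    have "conj_by b (inv (a \<otimes> a) \<otimes> z [^] l) = conj_by b (inv (a \<otimes> a)) \<otimes> conj_by b (z [^] l)" by (rule conj_by_mult) simp_all
    also have "\<dots> = inv (conj_by b (a \<otimes> a)) \<otimes> z [^] l"
      using conj_by_central[OF zk_central b_in] conj_by_inv[OF b_in m_closed[OF a_in a_in]] by simp
    also have "\<dots> = inv (z [^] l) \<otimes> inv (inv (a \<otimes> a)) \<otimes> z [^] l"
      unfolding conj_by_z by (subst inv_mult_group) simp_all
    also have "\<dots> = z [^] l \<otimes> (a \<otimes> a) \<otimes> z [^] l" by (simp only: zk_inv inv_inv m_closed a_in)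
    also have "z [^] l \<otimes> (a \<otimes> a) = (a \<otimes> a) \<otimes> z [^] l" by (rule central_commute[OF zk_central]) simp
    also have "(a \<otimes> a) \<otimes> z [^] l \<otimes> z [^] l = (a \<otimes> a) \<otimes> (z [^] l \<otimes> z [^] l)" by (rule m_assoc) simp_all
    also have "\<dots> = a \<otimes> a" unfolding zl(2) by simp
    finally show ?thesis unfolding * Suc using False by simp
  qed
qed

lemma conj_by_a_pow_q: "conj_by (a [^] (i::nat)) (b \<otimes> b) = (if even i then b \<otimes> b else inv (b \<otimes> b) \<otimes> z [^] l)"
  using G2_pair.conj_by_b_pow_p[OF G2_pair_swap] unfolding swap_z .

lemma conj_by_a_pow_p: "conj_by (a [^] (i::nat)) (a \<otimes> a) = a \<otimes> a"
  by (simp add: conj_by_eq_iff group_commutes_pow m_assoc)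

lemma conj_by_b_pow_q: "conj_by (b [^] (i::nat)) (b \<otimes> b) = b \<otimes> b"
  by (simp add: conj_by_eq_iff group_commutes_pow m_assoc)

lemma conj_by_nf_p: "conj_by (a [^] (i::nat) \<otimes> b [^] (j::nat)) (a \<otimes> a) =
    (if even j then a \<otimes> a else inv (a \<otimes> a) \<otimes> z [^] l)"
  using conj_by_conj_by[of "a [^] i" "b [^] j" "a \<otimes> a"] by (simp add: conj_by_a_pow_p conj_by_b_pow_p)

lemma pq_pow: "(b \<otimes> b) [^] (t::nat) \<otimes> (a \<otimes> a) [^] (s::nat) = (a \<otimes> a) [^] s \<otimes> (b \<otimes> b) [^] t"
proof -
  have "(a \<otimes> a) [^] s \<otimes> (b \<otimes> b) = (b \<otimes> b) \<otimes> (a \<otimes> a) [^] s"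
    by (rule group_commutes_pow) (simp_all add: pq)
  then have "(b \<otimes> b) [^] t \<otimes> (a \<otimes> a) [^] s = (a \<otimes> a) [^] s \<otimes> (b \<otimes> b) [^] t"
    by (intro group_commutes_pow) simp_all
  then show ?thesis .
qed

lemma pow_double: "x \<in> carrier G \<Longrightarrow> x [^] (2 * k :: nat) = (x \<otimes> x) [^] k"
  using nat_pow_pow[of x 2 k] by (simp add: numeral_2_eq_2)

text \<open>Depending on the parity of \<open>j\<close>, conjugation takes
  \<open>a \<otimes> a\<close> to itself or to \<open>inv (a \<otimes> a) \<otimes> z\<close>; the
  assumptions \<open>p\<close> and \<open>z\<close> keep both apart from
  \<open>inv (a \<otimes> a)\<close>.\<close>

lemma not_inverts_squares:
  assumes l: "l = 1" and gen: "carrier G \<subseteq> normal_forms" and p: "(a \<otimes> a) \<otimes> (a \<otimes> a) \<noteq> \<one>" and z: "z \<noteq> \<one>"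
  shows "\<not> inverts_squares u"
proof
  assume u: "inverts_squares u"
  then obtain i j :: nat where uij: "u = a [^] i \<otimes> b [^] j"
    using gen unfolding inverts_squares_def normal_forms_def by blast
  have eq: "conj_by u (a \<otimes> a) = inv (a \<otimes> a)" using u unfolding inverts_squares_def by simp
  show False
  proof (cases "even j")
    case True
    then have "a \<otimes> a = inv (a \<otimes> a)" using eq uij conj_by_nf_p[of i j] by simp
    then have "(a \<otimes> a) \<otimes> (a \<otimes> a) = \<one>" by (metis a_in m_closed r_inv)
    then show False using p by simp
  next
    case False
    then have "inv (a \<otimes> a) \<otimes> z = inv (a \<otimes> a)" using eq uij conj_by_nf_p[of i j] l by simp
    then show False using z by simp
  qed
qed

context
  assumes l0: "l = 0"
begin

text \<open>For \<open>l = 0\<close>, \<open>a \<otimes> b\<close> inverts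
  \<open>a \<otimes> a\<close> through its factor \<open>b\<close> and \<open>b \<otimes> b\<close>
  through its factor \<open>a\<close>; the two squares commute, so it inverts their products as
  well.\<close>

lemma conj_by_ab_pq: "conj_by (a \<otimes> b) ((a \<otimes> a) [^] (s::nat) \<otimes> (b \<otimes> b) [^] (t::nat)) = inv ((a \<otimes> a) [^] s \<otimes> (b \<otimes> b) [^] t)"
proof -
  have 1: "conj_by (a \<otimes> b) (a \<otimes> a) = inv (a \<otimes> a)"
    using conj_by_nf_p[of 1 1] by (simp add: l0)
  have "conj_by (a \<otimes> b) (b \<otimes> b) = conj_by b (conj_by a (b \<otimes> b))" by (simp add: conj_by_conj_by)
  also have "\<dots> = conj_by b (inv (b \<otimes> b))" using conj_by_z(1) by (simp add: l0)
  also have "\<dots> = inv (b \<otimes> b)" using conj_by_b_pow_q[of 1] by (simp add: conj_by_inv del: inv_mult_group)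
  finally have 2: "conj_by (a \<otimes> b) (b \<otimes> b) = inv (b \<otimes> b)" .
  have "conj_by (a \<otimes> b) ((a \<otimes> a) [^] s \<otimes> (b \<otimes> b) [^] t) = inv (a \<otimes> a) [^] s \<otimes> inv (b \<otimes> b) [^] t"
    using conj_by_mult[of "a \<otimes> b" "(a \<otimes> a) [^] s" "(b \<otimes> b) [^] t"] 1 2 by (simp add: conj_by_pow)
  also have "\<dots> = inv ((b \<otimes> b) [^] t \<otimes> (a \<otimes> a) [^] s)"
    by (simp add: inv_mult_group[of "(b \<otimes> b) [^] t" "(a \<otimes> a) [^] s"] nat_pow_inv)
  finally show ?thesis by (simp add: pq_pow)
qed

lemma square_odd_even:
  assumes i: "odd i" shows "(a [^] i \<otimes> b [^] (2 * t)) \<otimes> (a [^] i \<otimes> b [^] (2 * t :: nat)) = (a \<otimes> a) [^] (i::nat)"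
proof -
  let ?Q = "(b \<otimes> b) [^] t"
  have "conj_by (a [^] i) ?Q = inv ?Q"
    using conj_by_a_pow_q[of i] i by (simp add: conj_by_pow l0 nat_pow_inv)
  then have c: "?Q \<otimes> a [^] i = a [^] i \<otimes> inv ?Q" by (subst (asm) conj_by_eq_iff) simp_all
  have "(a [^] i \<otimes> ?Q) \<otimes> (a [^] i \<otimes> ?Q) = a [^] i \<otimes> (?Q \<otimes> a [^] i) \<otimes> ?Q" by (simp add: m_assoc)
  also have "\<dots> = a [^] i \<otimes> a [^] i" unfolding c by (simp add: m_assoc)
  also have "\<dots> = a [^] (2 * i)" by (simp add: nat_pow_mult mult_2)
  finally show ?thesis by (simp add: pow_double)
qed

lemma square_even_odd:
  assumes j: "odd j" shows "(a [^] (2 * t) \<otimes> b [^] j) \<otimes> (a [^] (2 * t :: nat) \<otimes> b [^] j) = (b \<otimes> b) [^] (j::nat)"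
proof -
  let ?P = "(a \<otimes> a) [^] t"
  have "conj_by (b [^] j) ?P = inv ?P"
    using conj_by_b_pow_p[of j] j by (simp add: conj_by_pow l0 nat_pow_inv)
  then have "conj_by (b [^] j) (inv ?P) = ?P" by (simp add: conj_by_inv)
  then have c: "b [^] j \<otimes> ?P = inv ?P \<otimes> b [^] j" by (subst (asm) conj_by_eq_iff) simp_all
  have "(?P \<otimes> b [^] j) \<otimes> (?P \<otimes> b [^] j) = ?P \<otimes> (b [^] j \<otimes> ?P) \<otimes> b [^] j" by (simp add: m_assoc)
  also have "\<dots> = b [^] j \<otimes> b [^] j" unfolding c by (simp add: m_assoc)
  also have "\<dots> = b [^] (2 * j)" by (simp add: nat_pow_mult mult_2)
  finally show ?thesis by (simp add: pow_double)
qed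

context
  fixes m :: nat
  assumes m: "(a \<otimes> b) \<otimes> (a \<otimes> b) = z [^] m"
begin

text \<open>The element is \<open>?P \<otimes> (a \<otimes> b) \<otimes> ?Q\<close> with
  \<open>?P\<close> and \<open>?Q\<close> powers of the two squares. In its square the inner pair is
  inverted on passing \<open>a \<otimes> b\<close> and cancels the outer one.\<close>

lemma square_odd_odd:
  "(a [^] (2 * s + 1) \<otimes> b [^] (2 * t + 1)) \<otimes> (a [^] (2 * s + 1 :: nat) \<otimes> b [^] (2 * t + 1 :: nat)) = z [^] m"
proof -
  let ?P = "(a \<otimes> a) [^] s" and ?Q = "(b \<otimes> b) [^] t"
  have "a [^] (2 * s + 1) = ?P \<otimes> a" by (simp add: pow_double)
  moreover have "b [^] (2 * t + 1) = b \<otimes> ?Q"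
    using nat_pow_Suc2[OF b_in, of "2 * t"] by (simp add: pow_double)
  moreover have "(?P \<otimes> a) \<otimes> (b \<otimes> ?Q) = ?P \<otimes> (a \<otimes> b) \<otimes> ?Q" by (simp add: m_assoc)
  ultimately have x: "a [^] (2 * s + 1) \<otimes> b [^] (2 * t + 1) = ?P \<otimes> (a \<otimes> b) \<otimes> ?Q" by simp
  have c: "(?P \<otimes> ?Q) \<otimes> (a \<otimes> b) = (a \<otimes> b) \<otimes> inv (?P \<otimes> ?Q)"
    using conj_by_ab_pq[of s t] by (subst (asm) conj_by_eq_iff) simp_all
  have "(?P \<otimes> (a \<otimes> b) \<otimes> ?Q) \<otimes> (?P \<otimes> (a \<otimes> b) \<otimes> ?Q) = ?P \<otimes> (a \<otimes> b) \<otimes> ((?Q \<otimes> ?P) \<otimes> (a \<otimes> b)) \<otimes> ?Q"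
    by (simp add: m_assoc)
  also have "\<dots> = ?P \<otimes> ((a \<otimes> b) \<otimes> (a \<otimes> b)) \<otimes> inv (?Q \<otimes> ?P) \<otimes> ?Q"
    unfolding pq_pow c by (simp add: m_assoc)
  also have "\<dots> = (?P \<otimes> z [^] m) \<otimes> inv ?P"
    unfolding m by (simp add: m_assoc inv_mult_group[of ?Q ?P])
  also have "?P \<otimes> z [^] m = z [^] m \<otimes> ?P" by (rule central_commute[OF zk_central, symmetric]) simp
  also have "z [^] m \<otimes> ?P \<otimes> inv ?P = z [^] m" by (simp add: m_assoc)
  finally show ?thesis unfolding x .
qed

text \<open>By the parities of \<open>i\<close> and \<open>j\<close>, every square is a product of
  powers of \<open>a \<otimes> a\<close> and \<open>b \<otimes> b\<close>, or is
  \<open>z [^] m\<close>. The former are covered by \<open>conj_by_ab_pq\<close>; the latter is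
  central and its own inverse.\<close>

lemma inverts_squares_ab:
  assumes gen: "carrier G \<subseteq> normal_forms" shows "inverts_squares (a \<otimes> b)"
  unfolding inverts_squares_def
proof (intro conjI ballI)
  fix x assume "x \<in> carrier G"
  then obtain i j :: nat where x: "x = a [^] i \<otimes> b [^] j" using gen unfolding normal_forms_def by blast
  have "(\<exists>(s::nat) (t::nat). x \<otimes> x = (a \<otimes> a) [^] s \<otimes> (b \<otimes> b) [^] t) \<or> x \<otimes> x = z [^] m"
  proof (cases "even i")
    case True
    then obtain s where i: "i = 2 * s" by blast
    show ?thesis
    proof (cases "even j")
      case True
      then obtain t where j: "j = 2 * t" by blast
      have "x \<otimes> x = (a \<otimes> a) [^] s \<otimes> ((b \<otimes> b) [^] t \<otimes> (a \<otimes> a) [^] s) \<otimes> (b \<otimes> b) [^] t"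
        unfolding x i j by (simp add: pow_double m_assoc)
      also have "\<dots> = (a \<otimes> a) [^] (s + s) \<otimes> (b \<otimes> b) [^] (t + t)"
        unfolding pq_pow by (simp add: m_assoc flip: nat_pow_mult)
      finally show ?thesis by blast
    next
      case False
      then have "x \<otimes> x = (a \<otimes> a) [^] (0::nat) \<otimes> (b \<otimes> b) [^] j" unfolding x i using square_even_odd by simp
      then show ?thesis by blast
    qed
  next
    case odd: False
    then obtain s where i: "i = 2 * s + 1" by (rule oddE)
    show ?thesis
    proof (cases "even j")
      case True
      then obtain t where j: "j = 2 * t" by blast
      then have "x \<otimes> x = (a \<otimes> a) [^] i \<otimes> (b \<otimes> b) [^] (0::nat)" unfolding x j using square_odd_even[OF odd] by simp
      then show ?thesis by blast
    next
      case False
      then obtain t where "j = 2 * t + 1" by (rule oddE)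
      then show ?thesis using square_odd_odd x i by simp
    qed
  qed
  then show "conj_by (a \<otimes> b) (x \<otimes> x) = inv (x \<otimes> x)"
  proof (elim disjE exE)
    assume "x \<otimes> x = z [^] m"
    then show ?thesis by (simp only: conj_by_central[OF zk_central] zk_inv m_closed a_in b_in)
  qed (simp only: conj_by_ab_pq)
qed simp

text \<open>Inverting \<open>a \<otimes> a\<close> forces \<open>j\<close> to be odd, inverting
  \<open>b \<otimes> b\<close> forces \<open>i\<close> to be odd, and then
  \<open>square_odd_odd\<close> applies.\<close>

lemma inverts_squares_sq:
  assumes gen: "carrier G \<subseteq> normal_forms" and p: "(a \<otimes> a) \<otimes> (a \<otimes> a) \<noteq> \<one>" and q: "(b \<otimes> b) \<otimes> (b \<otimes> b) \<noteq> \<one>"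
    and u: "inverts_squares u"
  shows "u \<otimes> u = z [^] m"
proof -
  obtain i j :: nat where uij: "u = a [^] i \<otimes> b [^] j"
    using u gen unfolding inverts_squares_def normal_forms_def by blast
  have eq: "conj_by u (a \<otimes> a) = inv (a \<otimes> a)" "conj_by u (b \<otimes> b) = inv (b \<otimes> b)"
    using u unfolding inverts_squares_def by simp_all
  have noninv: "x \<noteq> inv x" if "x \<in> carrier G" "x \<otimes> x \<noteq> \<one>" for x
    using that by (metis r_inv)
  have "odd j"
  proof
    assume "even j"
    then have "a \<otimes> a = inv (a \<otimes> a)" using eq(1) uij conj_by_nf_p[of i j] by simp
    then show False using noninv[OF m_closed[OF a_in a_in] p] by simp
  qed
  moreover have "odd i"
  proof
    assume "even i"
    have "conj_by u (b \<otimes> b) = conj_by (b [^] j) (conj_by (a [^] i) (b \<otimes> b))" by (simp add: uij conj_by_conj_by)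
    also have "\<dots> = b \<otimes> b" using \<open>even i\<close> by (simp add: conj_by_a_pow_q conj_by_b_pow_q)
    finally have "b \<otimes> b = inv (b \<otimes> b)" using eq(2) by simp
    then show False using noninv[OF m_closed[OF b_in b_in] q] by simp
  qed
  ultimately obtain s t where "i = 2 * s + 1" "j = 2 * t + 1" by (metis oddE)
  then show ?thesis using square_odd_odd uij by simp
qed

end

end

lemma z_pow_cong: "even (x + y) \<Longrightarrow> z [^] (x::nat) = z [^] (y::nat)"
proof -
  assume "even (x + y)"
  then have "[x = y] (mod 2)" by (auto simp: cong_def) presburger
  then show ?thesis using pow_cong[OF z_in(3) _, of 2] z_sq by (simp add: numeral_2_eq_2)
qed

text \<open>The square of \<open>b \<otimes> a\<close> is a conjugate of the square of
  \<open>a \<otimes> b\<close>, which is central.\<close>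

lemma swap_hold:
  assumes "G2_rels_hold a b e k l" shows "G2_rels_hold b a e k l"
proof -
  interpret S: G2_pair G b a e l by (rule G2_pair_swap)
  have *: "(a \<otimes> b) \<otimes> (a \<otimes> b) = z [^] (k + l)" using assms by (simp add: G2_rels_hold_iff)
  have "(b \<otimes> a) \<otimes> (b \<otimes> a) = conj_by a ((a \<otimes> b) \<otimes> (a \<otimes> b))" by (simp add: conj_by_def m_assoc)
  also have "\<dots> = z [^] (k + l)" unfolding * by (rule conj_by_central[OF zk_central a_in])
  finally show ?thesis by (simp add: S.G2_rels_hold_iff swap_z)
qed

text \<open>With \<open>c = 2 * d + 1\<close> and \<open>d\<close> odd, \<open>a [^] c\<close> is
  \<open>(a \<otimes> a) [^] d \<otimes> a\<close>. Moving \<open>(a \<otimes> a) [^] d\<close> past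
  \<open>a \<otimes> b\<close> inverts it and, as \<open>l = 1\<close>, leaves
  \<open>z [^] d\<close>, so the parity of \<open>k\<close> changes. \<open>z\<close> itself is
  unchanged because \<open>c\<close> is odd. The inverse \<open>c'\<close> recovers \<open>a\<close>
  from \<open>a [^] c\<close>, as \<open>centralI\<close> requires.\<close>

lemma power_hold:
  fixes c c' k' :: nat
  assumes l: "l = 1" and hold: "G2_rels_hold a b e k l" and c4: "c mod 4 = 3"
    and cc': "[c * c' = 1] (mod 2 ^ e)" and k': "odd (k + k')"
  shows "G2_rels_hold (a [^] c) b e k' l"
proof -
  obtain d where c: "c = 2 * d + 1" and d: "odd d" using c4 by (intro that[of "c div 2"]) presburger+
  have oc: "odd c" using c by simp
  have ac: "a [^] c = (a \<otimes> a) [^] d \<otimes> a" by (simp add: c pow_double)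
  have acac: "a [^] c \<otimes> a [^] c = (a \<otimes> a) [^] c" by (simp add: nat_pow_mult flip: mult_2) (simp add: pow_double)
  have z1c: "(a [^] c) [^] (2 ^ (e - 1) :: nat) = z1"
  proof -
    have "(a [^] c) [^] (2 ^ (e - 1) :: nat) = z1 [^] c" by (simp add: z1_def nat_pow_pow mult.commute)
    also have "\<dots> = (z1 \<otimes> z1) [^] d \<otimes> z1" by (simp add: c pow_double)
    finally show ?thesis by (simp add: z_sq1)
  qed
  have zc: "(a [^] c) [^] (2 ^ (e - 1) :: nat) \<otimes> b [^] (2 ^ (e - 1) :: nat) = z"
    unfolding z1c z2_def[symmetric] z_def ..
  interpret C: G2_pair G "a [^] c" b e l
  proof unfold_locales
    show "(a [^] c) [^] (2 ^ e :: nat) = \<one>"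
      using nat_pow_pow[OF a_in, of "2 ^ e" c] nat_pow_pow[OF a_in, of c "2 ^ e"] by (simp add: a_pow mult.commute)
    show "b \<otimes> b \<otimes> (a [^] c \<otimes> a [^] c) = a [^] c \<otimes> a [^] c \<otimes> (b \<otimes> b)"
      unfolding acac using pq_pow[of 1 c] by simp
    show "conj_by (a [^] c) (b \<otimes> b) = inv (b \<otimes> b) \<otimes> ((a [^] c) [^] (2 ^ (e - 1) :: nat) \<otimes> b [^] (2 ^ (e - 1) :: nat)) [^] l"
      unfolding zc using conj_by_a_pow_q[of c] oc by simp
    show "conj_by b (a [^] c \<otimes> a [^] c) = inv (a [^] c \<otimes> a [^] c) \<otimes> ((a [^] c) [^] (2 ^ (e - 1) :: nat) \<otimes> b [^] (2 ^ (e - 1) :: nat)) [^] l"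
    proof -
      have com: "inv (a \<otimes> a) \<otimes> z [^] l = z [^] l \<otimes> inv (a \<otimes> a)"
        by (rule central_commute[OF zk_central, symmetric]) simp
      have "conj_by b ((a \<otimes> a) [^] c) = (inv (a \<otimes> a) \<otimes> z [^] l) [^] c"
        using conj_by_z(2) by (simp add: conj_by_pow)
      also have "\<dots> = inv (a \<otimes> a) [^] c \<otimes> (z [^] l) [^] c"
        by (rule pow_mult_distrib[OF com]) simp_all
      also have "(z [^] l) [^] c = z [^] l" unfolding nat_pow_pow[OF z_in(3)]
        by (rule z_pow_cong) (simp add: l oc)
      also have "inv (a \<otimes> a) [^] c = inv ((a \<otimes> a) [^] c)" by (rule nat_pow_inv) simp
      finally show ?thesis unfolding zc acac .
    qed
    show "central w" if w: "w \<in> carrier G" "w \<otimes> a [^] c = a [^] c \<otimes> w" "w \<otimes> b = b \<otimes> w" for w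
    proof (rule centralI[OF w(1) _ w(3)])
      have "(a [^] c) [^] c' \<otimes> w = w \<otimes> (a [^] c) [^] c'"
        by (rule group_commutes_pow) (use w in simp_all)
      moreover have "(a [^] c) [^] c' = a"
        using pow_cong[OF a_in a_pow cc'] by (simp add: nat_pow_pow)
      ultimately show "w \<otimes> a = a \<otimes> w" by simp
    qed
  qed (use e2 el b_pow in simp_all)
  have "C.z = z" unfolding C.z_def C.z1_def C.z2_def by (rule zc)
  have abab: "(a \<otimes> b) \<otimes> (a \<otimes> b) = z [^] (k + l)" using hold by (simp add: G2_rels_hold_iff)
  let ?P = "(a \<otimes> a) [^] d"
  have "conj_by (a \<otimes> b) ?P = (inv (a \<otimes> a) \<otimes> z) [^] d"
    using conj_by_nf_p[of 1 1] by (simp add: conj_by_pow l)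
  also have "\<dots> = inv (a \<otimes> a) [^] d \<otimes> z [^] d"
    by (rule pow_mult_distrib) (use central_commute[OF z_central, of "inv (a \<otimes> a)"] in simp_all)
  also have "inv (a \<otimes> a) [^] d = inv ?P" by (rule nat_pow_inv) simp
  finally have "?P \<otimes> (a \<otimes> b) = (a \<otimes> b) \<otimes> (inv ?P \<otimes> z [^] d)" by (subst (asm) conj_by_eq_iff) simp_all
  then have "(a [^] c \<otimes> b) \<otimes> (a [^] c \<otimes> b) = (?P \<otimes> (a \<otimes> b)) \<otimes> (?P \<otimes> (a \<otimes> b))"
    unfolding ac by (simp add: m_assoc)
  also have "\<dots> = ?P \<otimes> (a \<otimes> b) \<otimes> ((a \<otimes> b) \<otimes> (inv ?P \<otimes> z [^] d))" using \<open>?P \<otimes> (a \<otimes> b) = _\<close> by simp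
  also have "\<dots> = ?P \<otimes> (((a \<otimes> b) \<otimes> (a \<otimes> b)) \<otimes> inv ?P) \<otimes> z [^] d" by (simp add: m_assoc)
  also have "((a \<otimes> b) \<otimes> (a \<otimes> b)) \<otimes> inv ?P = inv ?P \<otimes> z [^] (k + l)"
    unfolding abab by (rule central_commute[OF zk_central]) simp
  also have "?P \<otimes> (inv ?P \<otimes> z [^] (k + l)) \<otimes> z [^] d = z [^] (k + l + d)"
    by (simp add: nat_pow_mult)
  also have "\<dots> = z [^] (k' + l)" by (rule z_pow_cong) (use d k' in presburger)
  finally show ?thesis by (simp add: C.G2_rels_hold_iff \<open>C.z = z\<close>)
qed

end

section \<open>Counting isomorphism classes\<close>

lemma pgen_closed [simp]: "pgen R x \<in> carrier (presented_group R)"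
  by (simp add: presented_group_simps pgen_def)

lemma hom_pres_class:
  assumes "group_assignment G f" and h: "h \<in> hom (presented_group R) G"
    and gen: "\<And>x. h (pgen R x) = f x"
  shows "h (pres_class R w) = weval G f w"
proof -
  interpret A: group_assignment G f by fact
  interpret P: group_assignment "presented_group R" "pgen R" by (rule presented_group_assignment)
  interpret H: group_hom "presented_group R" G h using h by unfold_locales
  have "h (weval (presented_group R) (pgen R) w) = weval G f w"
    by (induction w) (simp_all add: gen)
  then show ?thesis by (simp add: weval_presented_group)
qed

lemma G2_hom:
  fixes G :: "('a, 'm) monoid_scheme" (structure)
  assumes "group G" and ab: "a \<in> carrier G" "b \<in> carrier G" and e: "e \<ge> 1"
    and hold: "group.G2_rels_hold G a b e k l"
  shows "\<exists>h \<in> hom (G2_pres e k l) G.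
    h (G2_a e k l) = a \<and> h (G2_b e k l) = b"
proof -
  interpret group G by fact
  define f where "f = case_gen2 a b"
  have f: "f GenX = a" "f GenY = b" by (simp_all add: f_def)
  interpret A: group_assignment G f
    by unfold_locales (use ab in \<open>simp add: f_def split: gen2.split\<close>)
  have "\<And>u v. (u, v) \<in> G2_rel e k l \<Longrightarrow> weval G f u = weval G f v"
    using G2_rels_iff[OF A.group_assignment_axioms e, of k l] hold unfolding f by blast
  from A.presented_group_hom[OF this] obtain h where h: "h \<in> hom (G2_pres e k l) G"
    "\<And>w. h (pres_class (G2_rel e k l) w) = weval G f w" by blast
  then show ?thesis using f by (intro bexI[OF _ h(1)]) (simp add: pgen_def A.weval_gen)
qed

lemma presented_group_endo:
  assumes h: "h \<in> hom (presented_group R) (presented_group R)" and gen: "\<And>x. h (pgen R x) = pgen R x"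
    and C: "C \<in> carrier (presented_group R)"
  shows "h C = C"
proof -
  obtain w where "C = pres_class R w" using C by (auto simp: presented_group_simps)
  then show ?thesis
    using hom_pres_class[OF presented_group_assignment h gen, of w] by (simp add: weval_presented_group)
qed

lemma G2_carrier_normal_forms:
  assumes "e \<ge> 2" "e \<ge> 3 \<or> l = 0"
  shows "carrier (G2_pres e k l) \<subseteq>
    G2_pair.normal_forms (G2_pres e k l) (G2_a e k l) (G2_b e k l)"
  using G2_normal_form[OF assms] by blast

lemma G2_z_neq_one:
  assumes e: "e \<ge> 3"
  shows "G2_pair.z (G2_pres e k l) (G2_a e k l) (G2_b e k l) e \<noteq>
    \<one>\<^bsub>G2_pres e k l\<^esub>"
proof
  let ?R = "G2_rel e k l" and ?P = "presented_group (G2_rel e k l)"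
  interpret A: group_assignment "?P" "pgen ?R" by (rule presented_group_assignment)
  have e2: "e \<ge> 2" "e \<ge> 3 \<or> l = 0" using e by auto
  interpret P: G2_pair "?P" "pgen ?R GenX" "pgen ?R GenY" e l by (rule G2_pair_presented(1)[OF e2])
  have h: "(2::nat) ^ e div 2 = 2 ^ (e - 1)" using e by (cases e) auto
  have z: "P.z = weval (?P) (pgen ?R)
      (wpow (gen GenX) (2 ^ e div 2) @ wpow (gen GenY) (2 ^ e div 2))"
    unfolding A.weval_simps h by (simp add: P.z_def P.z1_def P.z2_def)
  assume "P.z = \<one>\<^bsub>?P\<^esub>"
  then show False unfolding z weval_presented_group presented_group_simps(2) pres_class_eq_iff
    using G2_nontrivial(1)[OF e HOL.refl HOL.refl] by blast
qed

lemma G2_a4_neq_one: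
  assumes e: "e \<ge> 3"
  shows "(G2_a e k l \<otimes>\<^bsub>G2_pres e k l\<^esub> G2_a e k l) \<otimes>\<^bsub>G2_pres e k l\<^esub>
    (G2_a e k l \<otimes>\<^bsub>G2_pres e k l\<^esub> G2_a e k l) \<noteq>
    \<one>\<^bsub>G2_pres e k l\<^esub>"
proof
  let ?R = "G2_rel e k l" and ?P = "presented_group (G2_rel e k l)"
  assume "(pgen ?R GenX \<otimes>\<^bsub>?P\<^esub> pgen ?R GenX) \<otimes>\<^bsub>?P\<^esub>
    (pgen ?R GenX \<otimes>\<^bsub>?P\<^esub> pgen ?R GenX) = \<one>\<^bsub>?P\<^esub>"
  then have "pres_eq ?R ((gen GenX @ gen GenX) @ (gen GenX @ gen GenX)) []"
    by (simp only: pgen_def presented_group_mult presented_group_simps(2) pres_class_eq_iff)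
  moreover have "(gen GenX @ gen GenX) @ (gen GenX @ gen GenX) = wpow (gen GenX) 4"
    by (simp add: wpow_def numeral_eq_Suc)
  ultimately show False using G2_nontrivial(2)[OF e HOL.refl HOL.refl, of k l] by simp
qed

text \<open>The action on the cosets of \<open>\<langle>b\<rangle>\<close> cannot detect this
  element, which acts trivially modulo \<open>4 * J\<close>. The endomorphism exchanging the
  generators reduces the claim to \<open>G2_a4_neq_one\<close>.\<close>

lemma G2_b4_neq_one:
  assumes e: "e \<ge> 3"
  shows "(G2_b e k l \<otimes>\<^bsub>G2_pres e k l\<^esub> G2_b e k l) \<otimes>\<^bsub>G2_pres e k l\<^esub>
    (G2_b e k l \<otimes>\<^bsub>G2_pres e k l\<^esub> G2_b e k l) \<noteq>
    \<one>\<^bsub>G2_pres e k l\<^esub>"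
proof
  let ?R = "G2_rel e k l" and ?P = "presented_group (G2_rel e k l)"
  interpret A: group_assignment "?P" "pgen ?R" by (rule presented_group_assignment)
  have e2: "e \<ge> 2" "e \<ge> 3 \<or> l = 0" and e1: "e \<ge> 1" using e by auto
  interpret P: G2_pair "?P" "pgen ?R GenX" "pgen ?R GenY" e l by (rule G2_pair_presented(1)[OF e2])
  obtain h where h: "h \<in> hom (?P) (?P)"
      "h (pgen ?R GenX) = pgen ?R GenY" "h (pgen ?R GenY) = pgen ?R GenX"
    using G2_hom[OF A.is_group _ _ e1 P.swap_hold[OF G2_pair_presented(2)[OF e2]]] by auto
  interpret H: group_hom "?P" "?P" h using h(1) by unfold_locales
  assume eq: "(pgen ?R GenY \<otimes>\<^bsub>?P\<^esub> pgen ?R GenY) \<otimes>\<^bsub>?P\<^esub>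
    (pgen ?R GenY \<otimes>\<^bsub>?P\<^esub> pgen ?R GenY) = \<one>\<^bsub>?P\<^esub>"
  from arg_cong[OF eq, of h] show False using G2_a4_neq_one[OF e, of k l] by (simp add: h(2,3))
qed

text \<open>Existence of an element inverting all squares separates \<open>l = 0\<close> from
  \<open>l = 1\<close>; the triviality of its square separates \<open>k = 0\<close> from
  \<open>k = 1\<close> when \<open>l = 0\<close>.\<close>

lemma G2_inverts_squares:
  assumes e: "e \<ge> 3"
  shows "\<exists>u. group.inverts_squares (G2 e k 0) u"
    and "\<not> group.inverts_squares (G2 e k 1) u"
    and "\<exists>u. group.inverts_squares (G2 e 0 0) u \<and> u \<otimes>\<^bsub>G2 e 0 0\<^esub> u = \<one>\<^bsub>G2 e 0 0\<^esub>"
    and "group.inverts_squares (G2 e 1 0) u \<Longrightarrow> u \<otimes>\<^bsub>G2 e 1 0\<^esub> u \<noteq> \<one>\<^bsub>G2 e 1 0\<^esub>"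
proof -
  have e2: "e \<ge> 2" "e \<ge> 3 \<or> l = 0" for l using e by auto
  note normal_forms = G2_carrier_normal_forms[OF e2] and hold = G2_pair_presented(2)[OF e2]
  have *: "group.inverts_squares (G2 e k 0) (G2_a e k 0 \<otimes>\<^bsub>G2 e k 0\<^esub> G2_b e k 0)" for k
    unfolding G2_eq
    using G2_pair.inverts_squares_ab[OF G2_pair_presented(1)[OF e2] HOL.refl G2_pair.G2_rels_hold_iff[OF G2_pair_presented(1)[OF e2], THEN iffD1, OF hold] normal_forms] .
  show "\<exists>u. group.inverts_squares (G2 e k 0) u" using * by blast
  show "\<not> group.inverts_squares (G2 e k 1) u"
    unfolding G2_eq
    by (rule G2_pair.not_inverts_squares[OF G2_pair_presented(1)[OF e2] HOL.refl normal_forms G2_a4_neq_one[OF e] G2_z_neq_one[OF e]])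
  interpret A: G2_pair "G2_pres e 0 0" "G2_a e 0 0" "G2_b e 0 0" e 0
    by (rule G2_pair_presented(1)[OF e2])
  show "\<exists>u. group.inverts_squares (G2 e 0 0) u \<and> u \<otimes>\<^bsub>G2 e 0 0\<^esub> u = \<one>\<^bsub>G2 e 0 0\<^esub>"
    using *[of 0] A.G2_rels_hold_iff[of 0] hold[of 0 0] unfolding G2_eq by auto
  interpret B: G2_pair "G2_pres e 1 0" "G2_a e 1 0" "G2_b e 1 0" e 0
    by (rule G2_pair_presented(1)[OF e2])
  assume u: "group.inverts_squares (G2 e 1 0) u"
  have "u \<otimes>\<^bsub>G2 e 1 0\<^esub> u = B.z [^]\<^bsub>G2 e 1 0\<^esub> (1 + 0 :: nat)"
    using B.inverts_squares_sq[OF HOL.refl B.G2_rels_hold_iff[THEN iffD1, OF hold] normal_forms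
        G2_a4_neq_one[OF e] G2_b4_neq_one[OF e]] u unfolding G2_eq by blast
  also have "(1 + 0 :: nat) = Suc 0" by simp
  also have "B.z [^]\<^bsub>G2 e 1 0\<^esub> Suc 0 = B.z"
    unfolding G2_eq by (simp only: B.nat_pow_Suc B.nat_pow_0 B.l_one B.z_in)
  finally show "u \<otimes>\<^bsub>G2 e 1 0\<^esub> u \<noteq> \<one>\<^bsub>G2 e 1 0\<^esub>" using G2_z_neq_one[OF e, of 1 0] unfolding G2_eq by metis
qed

lemma inverts_squares_iso:
  assumes "group G" "group H" "G \<cong> H" "group.inverts_squares G u"
  shows "\<exists>v. group.inverts_squares H v \<and> (u \<otimes>\<^bsub>G\<^esub> u = \<one>\<^bsub>G\<^esub> \<longrightarrow> v \<otimes>\<^bsub>H\<^esub> v = \<one>\<^bsub>H\<^esub>)"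
proof -
  obtain h where h: "h \<in> iso G H" using assms(3) by (auto simp: is_iso_def)
  interpret group_hom G H h
    using assms(1,2) h by (simp add: group_hom_def group_hom_axioms_def iso_def)
  have u: "u \<in> carrier G" using assms(4) by (simp add: G.inverts_squares_def)
  have "H.inverts_squares (h u)" 
    by (rule inverts_squares_image[OF assms(4)]) (use h in \<open>simp add: iso_def bij_betw_def\<close>)
  moreover have "h u \<otimes>\<^bsub>H\<^esub> h u = \<one>\<^bsub>H\<^esub>" if "u \<otimes>\<^bsub>G\<^esub> u = \<one>\<^bsub>G\<^esub>"
    using arg_cong[OF that, of h] u by simp
  ultimately show ?thesis by blast
qed

lemma G2_group: "group (G2 e k l)"
  unfolding G2_eq by (rule group_presented_group)

text \<open>\<open>power_hold\<close> is used in both directions, with exponent 3 and with its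
  inverse \<open>c'\<close> modulo \<open>2 ^ e\<close>. The two resulting homomorphisms compose to
  the identity on generators, so no orders have to be compared.\<close>

lemma G2_iso_01_11:
  assumes e: "e \<ge> 3" shows "G2 e 0 1 \<cong> G2 e 1 1"
proof -
  let ?P = "G2_pres e 0 1" and ?Q = "G2_pres e 1 1"
  let ?a = "G2_a e 0 1" and ?b = "G2_b e 0 1"
  let ?c = "G2_a e 1 1" and ?d = "G2_b e 1 1"
  have e2: "e \<ge> 2" "e \<ge> 3 \<or> (1::nat) = 0" and e1: "e \<ge> 1" using e by auto
  interpret P: G2_pair ?P ?a ?b e 1 by (rule G2_pair_presented(1)[OF e2])
  interpret Q: G2_pair ?Q ?c ?d e 1 by (rule G2_pair_presented(1)[OF e2])
  obtain c' :: nat where c': "[3 * c' = 1] (mod 2 ^ e)"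
    using cong_solve_coprime_nat[of 3 "2 ^ e"] by auto
  have "(4::nat) dvd 2 ^ e" using le_imp_power_dvd[OF e2(1), of "2::nat"] by simp
  then have "[3 * c' = 1] (mod 4)" using c' cong_dvd_modulus_nat by blast
  \<comment> \<open>Modulo 4 the inverse of 3 is 3 again, so \<open>c'\<close> also meets the
    condition \<open>c mod 4 = 3\<close> of \<open>power_hold\<close>.\<close>
  then have c'4: "c' mod 4 = 3" unfolding cong_def by presburger
  have c'': "[c' * 3 = 1] (mod 2 ^ e)" using c' by (simp add: mult.commute)
  have "P.G2_rels_hold (?a [^]\<^bsub>?P\<^esub> (3::nat)) ?b e 1 1"
    by (rule P.power_hold[OF HOL.refl G2_pair_presented(2)[OF e2] _ c']) simp_all
  from G2_hom[OF P.is_group P.nat_pow_closed[OF P.a_in] P.b_in e1 this]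
  obtain h where h: "h \<in> hom ?Q ?P" "h ?c = ?a [^]\<^bsub>?P\<^esub> (3::nat)" "h ?d = ?b" by blast
  have "Q.G2_rels_hold (?c [^]\<^bsub>?Q\<^esub> c') ?d e 0 1"
    by (rule Q.power_hold[OF HOL.refl G2_pair_presented(2)[OF e2] c'4 c'']) simp
  from G2_hom[OF Q.is_group Q.nat_pow_closed[OF Q.a_in] Q.b_in e1 this]
  obtain g where g: "g \<in> hom ?P ?Q" "g ?a = ?c [^]\<^bsub>?Q\<^esub> c'" "g ?b = ?d" by blast
  interpret H: group_hom ?Q ?P h using h(1) by unfold_locales
  interpret K: group_hom ?P ?Q g using g(1) by unfold_locales
  have "h (g ?a) = h ?c [^]\<^bsub>?P\<^esub> c'" unfolding g(2) by (rule H.hom_nat_pow[OF Q.a_in])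
  also have "\<dots> = ?a [^]\<^bsub>?P\<^esub> (3 * c')" unfolding h(2) by (rule P.nat_pow_pow[OF P.a_in])
  also have "\<dots> = ?a [^]\<^bsub>?P\<^esub> (1::nat)" by (rule P.pow_cong[OF P.a_in P.a_pow c'])
  also have "\<dots> = ?a" by (rule P.nat_pow_eone[OF P.a_in])
  finally have "h (g ?a) = ?a" .
  then have hg: "(h \<circ> g) (pgen (G2_rel e 0 1) x) = pgen (G2_rel e 0 1) x" for x
    using g h by (cases x) simp_all
  have "g (h ?c) = g ?a [^]\<^bsub>?Q\<^esub> (3::nat)" unfolding h(2) by (rule K.hom_nat_pow[OF P.a_in])
  also have "\<dots> = ?c [^]\<^bsub>?Q\<^esub> (c' * 3)" unfolding g(2) by (rule Q.nat_pow_pow[OF Q.a_in])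
  also have "\<dots> = ?c [^]\<^bsub>?Q\<^esub> (1::nat)" by (rule Q.pow_cong[OF Q.a_in Q.a_pow c''])
  also have "\<dots> = ?c" by (rule Q.nat_pow_eone[OF Q.a_in])
  finally have "g (h ?c) = ?c" .
  then have gh: "(g \<circ> h) (pgen (G2_rel e 1 1) x) = pgen (G2_rel e 1 1) x" for x
    using g h by (cases x) simp_all
  have hgP: "h \<circ> g \<in> hom ?P ?P" using g(1) h(1) by (rule hom_compose)
  have 1: "h (g x) = x" if "x \<in> carrier ?P" for x
    using presented_group_endo[OF hgP hg that] unfolding o_apply .
  have ghQ: "g \<circ> h \<in> hom ?Q ?Q" using h(1) g(1) by (rule hom_compose)
  have 2: "g (h x) = x" if "x \<in> carrier ?Q" for x
    using presented_group_endo[OF ghQ gh that] unfolding o_apply .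
  have "group_isomorphisms ?P ?Q g h"
    unfolding group_isomorphisms_def using g(1) h(1) 1 2 by blast
  then have "g \<in> iso ?P ?Q" using P.iso_iff_group_isomorphisms by blast
  then show ?thesis unfolding G2_eq by (rule is_isoI)
qed

lemma G2_not_iso:
  assumes e: "e \<ge> 3"
  shows "\<not> G2 e k 0 \<cong> G2 e k' 1" and "\<not> G2 e 0 0 \<cong> G2 e 1 0"
proof -
  show "\<not> G2 e k 0 \<cong> G2 e k' 1"
  proof
    assume iso: "G2 e k 0 \<cong> G2 e k' 1"
    obtain u where "group.inverts_squares (G2 e k 0) u" using G2_inverts_squares(1)[OF e] by blast
    from inverts_squares_iso[OF G2_group G2_group iso this] show False
      using G2_inverts_squares(2)[OF e] by blast
  qed
  show "\<not> G2 e 0 0 \<cong> G2 e 1 0"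
  proof
    assume iso: "G2 e 0 0 \<cong> G2 e 1 0"
    obtain u where "group.inverts_squares (G2 e 0 0) u" "u \<otimes>\<^bsub>G2 e 0 0\<^esub> u = \<one>\<^bsub>G2 e 0 0\<^esub>"
      using G2_inverts_squares(3)[OF e] by blast
    with inverts_squares_iso[OF G2_group G2_group iso] show False
      using G2_inverts_squares(4)[OF e] by blast
  qed
qed

lemma num_iso_classes_G2:
  assumes e: "e \<ge> 3"
  shows "num_iso_classes {G2 e k l | k l. k \<in> {0, 1} \<and> l \<in> {0, 1}} = 3"
proof -
  define S where "S = {G2 e k l | k l. k \<in> {0, 1} \<and> l \<in> {0, 1}}"
  define r where "r = {(G, H). G \<in> S \<and> H \<in> S \<and> G \<cong> H}"
  have S: "S = {G2 e 0 0, G2 e 1 0, G2 e 0 1, G2 e 1 1}" unfolding S_def by auto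
  have grp: "group G" if "G \<in> S" for G using that G2_group unfolding S_def by auto
  have "equiv S r"
    unfolding r_def
  proof (intro equivI refl_onI symI transI)
    show "{(G, H). G \<in> S \<and> H \<in> S \<and> G \<cong> H} \<subseteq> S \<times> S" by auto
    show "(G, G) \<in> {(G, H). G \<in> S \<and> H \<in> S \<and> G \<cong> H}" if "G \<in> S" for G
      using that by (simp add: iso_refl)
    show "(H, G) \<in> {(G, H). G \<in> S \<and> H \<in> S \<and> G \<cong> H}" if "(G, H) \<in> {(G, H). G \<in> S \<and> H \<in> S \<and> G \<cong> H}" for G H
      using that group.iso_sym grp by blast
    show "(G, K) \<in> {(G, H). G \<in> S \<and> H \<in> S \<and> G \<cong> H}"
      if "(G, H) \<in> {(G, H). G \<in> S \<and> H \<in> S \<and> G \<cong> H}" "(H, K) \<in> {(G, H). G \<in> S \<and> H \<in> S \<and> G \<cong> H}" for G H K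
      using that iso_trans by blast
  qed
  then have eq: "r `` {G} = r `` {H} \<longleftrightarrow> G \<cong> H" if "G \<in> S" "H \<in> S" for G H
    using eq_equiv_class_iff[of S r G H] that by (simp add: r_def)
  have in_S: "G2 e 0 0 \<in> S" "G2 e 1 0 \<in> S" "G2 e 0 1 \<in> S" "G2 e 1 1 \<in> S" unfolding S by simp_all
  have "S // r = {r `` {G2 e 0 0}, r `` {G2 e 1 0}, r `` {G2 e 0 1}, r `` {G2 e 1 1}}"
    unfolding quotient_def S by auto
  also have "r `` {G2 e 1 1} = r `` {G2 e 0 1}"
    using eq[OF in_S(3,4)] G2_iso_01_11[OF e] by simp
  finally have "S // r = {r `` {G2 e 0 0}, r `` {G2 e 1 0}, r `` {G2 e 0 1}}" by simp
  moreover have "r `` {G2 e 0 0} \<noteq> r `` {G2 e 1 0}" "r `` {G2 e 0 0} \<noteq> r `` {G2 e 0 1}"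
    "r `` {G2 e 1 0} \<noteq> r `` {G2 e 0 1}"
    using eq in_S G2_not_iso[OF e] by metis+
  ultimately have "card (S // r) = 3" by simp
  then show ?thesis unfolding num_iso_classes_def r_def S_def .
qed

theorem theorem1p1:
  shows "(\<forall>(G :: ('a, 'b) monoid_scheme) (n :: nat) (e :: nat).
            n = 2 ^ e \<and> n \<ge> 4 \<and> isobicyclic n G \<longrightarrow>
              (metacyclic G \<and> (\<exists>f \<in> {2..e}. G \<cong> G1 e f))
            \<or> (\<not> metacyclic G \<and>
                ((e = 2 \<and> G \<cong> G2 2 0 0)
               \<or> (e \<ge> 3 \<and> (\<exists>k \<in> {0, 1}. \<exists>l \<in> {0, 1}. G \<cong> G2 e k l)))))
       \<and> (\<forall>e \<ge> 3.
            num_iso_classes {G2 e k l | k l. k \<in> {0, 1} \<and> l \<in> {0, 1}} = 3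
          \<and> G2 e 0 1 \<cong> G2 e 1 1)"
proof (intro conjI allI impI)
  fix G :: "('a, 'b) monoid_scheme" and n e :: nat
  assume "n = 2 ^ e \<and> n \<ge> 4 \<and> isobicyclic n G"
  then have "2 ^ e \<ge> (4::nat)" "isobicyclic (2 ^ e) G" by auto
  then show "(metacyclic G \<and> (\<exists>f \<in> {2..e}. G \<cong> G1 e f))
            \<or> (\<not> metacyclic G \<and>
                ((e = 2 \<and> G \<cong> G2 2 0 0)
               \<or> (e \<ge> 3 \<and> (\<exists>k \<in> {0, 1}. \<exists>l \<in> {0, 1}. G \<cong> G2 e k l))))"
    by (rule classification)
qed (simp_all only: num_iso_classes_G2 G2_iso_01_11)

end
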